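(* For every $K=1,2,\dots$, the Markov kernel $\Lambda^\infty_K:\widetilde{\mathbb G}_\infty\dashrightarrow\widetilde{\mathbb G}_K$ is Feller; that is, the operator $f\mapsto\Lambda^\infty_K f$, $(\Lambda^\infty_K f)(X)=\sum_{Y\in\widetilde{\mathbb G}_K}\Lambda^\infty_K(X,Y)f(Y)$ for $X\in\widetilde{\mathbb G}_\infty$, maps $C_0(\widetilde{\mathbb G}_K)$ into $C_0(\widetilde{\mathbb G}_\infty)$.
   Context: Fix $q\in(0,1)$, $\zeta_+>0$, $\zeta_-<0$. Let $\mathfrak L=\{\zeta_+q^n:n\in\mathbb Z\}\cup\{\zeta_-q^n:n\in\mathbb Z\}\subset\mathbb R$ and $\bar{\mathfrak L}=\mathfrak L\cup\{0\}$. For $K\ge1$, $\mathbb G_K$ is the set of $K$-point subsets $(a_1<\dots<a_K)$ of $\mathfrak L$, viewed as a subset of the cone $\Delta_K=\{(a_1,\dots,a_K)\in\mathbb R^K:a_1\le\dots\le a_K\}$; $\widetilde{\mathbb G}_K$ is the closure of $\mathbb G_K$ in $\Delta_K$ with the induced topology (its elements are the $K$-point configurations on $\bar{\mathfrak L}$ in which only $0$ may be a multiple point); it is countable and locally compact. $\widetilde{\mathbb G}_\infty$ is the set of all subsets (point configurations) $X\subset\mathfrak L$ that are bounded in $\mathbb R$, finite (possibly empty) or infinite. Two configurations are called $\varepsilon$-close if they coincide outside $(-\varepsilon,\varepsilon)$; this makes $\widetilde{\mathbb G}_\infty$ a uniform, hence topological, space, which is locally compact. For a partition $\nu$ with length $\ell(\nu)\le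 K$ let $S_{\nu\mid K}$ be the Schur polynomial in $K$ variables and $\widetilde S_{\nu\mid K}=S_{\nu\mid K}/S_{\nu\mid K}(1,q,\dots,q^{K-1})$. Let $S_{\nu\mid\infty}(X)$, $X\in\widetilde{\mathbb G}_\infty$, be the value of the Schur symmetric function $S_\nu$ at the points of $X$ (with the remaining variables equal to $0$ if $X$ is finite), and $\widetilde S_{\nu\mid\infty}(X)=S_{\nu\mid\infty}(X)/S_\nu(1,q,q^2,\dots)$. For $X\in\widetilde{\mathbb G}_\infty$, $\Lambda^\infty_K(X,\cdot)$ is the unique probability measure on $\widetilde{\mathbb G}_K$ such that $\sum_{Y\in\widetilde{\mathbb G}_K}\Lambda^\infty_K(X,Y)\widetilde S_{\nu\mid K}(Y)=\widetilde S_{\nu\mid\infty}(X)$ for all partitions $\nu$ with $\ell(\nu)\le K$ (existence and uniqueness of this measure are known). For a locally compact space $\mathfrak X$, $C_0(\mathfrak X)$ denotes the Banach space of (real-valued) continuous functions on $\mathfrak X$ vanishing at infinity, with the supremum norm. *)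

theory Defs
  imports "HOL-Probability.Probability"
begin

definition qlattice :: "real \<Rightarrow> real \<Rightarrow> real \<Rightarrow> real set" where
  "qlattice q zp zm = range (\<lambda>n::int. zp * q powi n) \<union> range (\<lambda>n::int. zm * q powi n)"

text \<open>
  Coordinates of \<open>K\<close>-tuples are numbered \<open>0, \<dots>, K - 1\<close>; a \<open>K\<close>-tuple is an extensional function
  on \<open>{..<K}\<close>, so that the Euclidean space of dimension \<open>K\<close> is \<open>powertop_real {..<K}\<close>.
\<close>

definition cone :: "nat \<Rightarrow> (nat \<Rightarrow> real) set" where
  "cone K = {a \<in> {..<K} \<rightarrow>\<^sub>E UNIV. mono_on {..<K} a}"

definition cone_topology :: "nat \<Rightarrow> (nat \<Rightarrow> real) topology" where
  "cone_topology K = subtopology (powertop_real {..<K}) (cone K)"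

definition configs :: "real \<Rightarrow> real \<Rightarrow> real \<Rightarrow> nat \<Rightarrow> (nat \<Rightarrow> real) set" where
  "configs q zp zm K = {a \<in> {..<K} \<rightarrow>\<^sub>E qlattice q zp zm. strict_mono_on {..<K} a}"

definition ext_configs :: "real \<Rightarrow> real \<Rightarrow> real \<Rightarrow> nat \<Rightarrow> (nat \<Rightarrow> real) set" where
  "ext_configs q zp zm K = cone_topology K closure_of configs q zp zm K"

definition ext_configs_topology :: "real \<Rightarrow> real \<Rightarrow> real \<Rightarrow> nat \<Rightarrow> (nat \<Rightarrow> real) topology" where
  "ext_configs_topology q zp zm K = subtopology (cone_topology K) (ext_configs q zp zm K)"

definition inf_configs :: "real \<Rightarrow> real \<Rightarrow> real \<Rightarrow> real set set" where
  "inf_configs q zp zm = {X. X \<subseteq> qlattice q zp zm \<and> bounded X}"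

definition eps_close :: "real \<Rightarrow> real set \<Rightarrow> real set \<Rightarrow> bool" where
  "eps_close \<epsilon> X Y \<longleftrightarrow> X - {-\<epsilon><..<\<epsilon>} = Y - {-\<epsilon><..<\<epsilon>}"

text \<open>The topology of the uniform structure whose basic entourages are the relations
  \<open>eps_close \<epsilon>\<close>, \<open>\<epsilon> > 0\<close>.\<close>

definition inf_configs_topology :: "real \<Rightarrow> real \<Rightarrow> real \<Rightarrow> real set topology" where
  "inf_configs_topology q zp zm = topology (\<lambda>U. U \<subseteq> inf_configs q zp zm \<and>
     (\<forall>X\<in>U. \<exists>\<epsilon>>0. \<forall>Y\<in>inf_configs q zp zm. eps_close \<epsilon> X Y \<longrightarrow> Y \<in> U))"

lemma eps_close_mono: "eps_close \<epsilon> X Y \<Longrightarrow> \<epsilon> \<le> \<delta> \<Longrightarrow> eps_close \<delta> X Y"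
proof -
  assume close: "eps_close \<epsilon> X Y" and le: "\<epsilon> \<le> \<delta>"
  have "Z - {-\<delta><..<\<delta>} = (Z - {-\<epsilon><..<\<epsilon>}) - {-\<delta><..<\<delta>}" for Z :: "real set"
    using le by auto
  then show "eps_close \<delta> X Y"
    using close unfolding eps_close_def by metis
qed

lemma openin_inf_configs_topology:
  "openin (inf_configs_topology q zp zm) U \<longleftrightarrow> U \<subseteq> inf_configs q zp zm \<and>
     (\<forall>X\<in>U. \<exists>\<epsilon>>0. \<forall>Y\<in>inf_configs q zp zm. eps_close \<epsilon> X Y \<longrightarrow> Y \<in> U)"
proof -
  have "istopology (\<lambda>U. U \<subseteq> inf_configs q zp zm \<and>
     (\<forall>X\<in>U. \<exists>\<epsilon>>0. \<forall>Y\<in>inf_configs q zp zm. eps_close \<epsilon> X Y \<longrightarrow> Y \<in> U))" (is "istopology ?P")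
    unfolding istopology_def
  proof (intro conjI allI impI)
    fix S T assume S: "?P S" and T: "?P T"
    show "S \<inter> T \<subseteq> inf_configs q zp zm" using S by blast
    show "\<forall>X\<in>S \<inter> T. \<exists>\<epsilon>>0. \<forall>Y\<in>inf_configs q zp zm. eps_close \<epsilon> X Y \<longrightarrow> Y \<in> S \<inter> T"
    proof
      fix X assume "X \<in> S \<inter> T"
      then obtain d e where "d > 0" "\<forall>Y\<in>inf_configs q zp zm. eps_close d X Y \<longrightarrow> Y \<in> S"
        and "e > 0" "\<forall>Y\<in>inf_configs q zp zm. eps_close e X Y \<longrightarrow> Y \<in> T"
        using S T by (metis IntD1 IntD2)
      then show "\<exists>\<epsilon>>0. \<forall>Y\<in>inf_configs q zp zm. eps_close \<epsilon> X Y \<longrightarrow> Y \<in> S \<inter> T"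
        using eps_close_mono[of "min d e" X _ d] eps_close_mono[of "min d e" X _ e]
        by (intro exI[of _ "min d e"]) simp
    qed
  next
    fix \<K> assume \<K>: "\<forall>K\<in>\<K>. ?P K"
    show "\<Union>\<K> \<subseteq> inf_configs q zp zm" using \<K> by blast
    show "\<forall>X\<in>\<Union>\<K>. \<exists>\<epsilon>>0. \<forall>Y\<in>inf_configs q zp zm. eps_close \<epsilon> X Y \<longrightarrow> Y \<in> \<Union>\<K>"
    proof
      fix X assume "X \<in> \<Union>\<K>"
      then obtain K where "K \<in> \<K>" "X \<in> K" by blast
      with \<K> obtain e where "e > 0" "\<forall>Y\<in>inf_configs q zp zm. eps_close e X Y \<longrightarrow> Y \<in> K"
        by meson
      with \<open>K \<in> \<K>\<close> show "\<exists>\<epsilon>>0. \<forall>Y\<in>inf_configs q zp zm. eps_close \<epsilon> X Y \<longrightarrow> Y \<in> \<Union>\<K>"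
        by blast
    qed
  qed
  then show ?thesis
    by (simp add: inf_configs_topology_def topology_inverse')
qed

lemma topspace_inf_configs_topology: "topspace (inf_configs_topology q zp zm) = inf_configs q zp zm"
proof
  show "topspace (inf_configs_topology q zp zm) \<subseteq> inf_configs q zp zm"
    using openin_inf_configs_topology openin_topspace by blast
  have "openin (inf_configs_topology q zp zm) (inf_configs q zp zm)"
    unfolding openin_inf_configs_topology by (auto intro: exI[of _ 1])
  then show "inf_configs q zp zm \<subseteq> topspace (inf_configs_topology q zp zm)"
    by (rule openin_subset)
qed

lemma topspace_ext_configs_topology: "topspace (ext_configs_topology q zp zm K) = ext_configs q zp zm K"
  unfolding ext_configs_topology_def ext_configs_def
  by (simp add: closure_of_subset_topspace inf.absorb2)

text \<open>A partition is the list of its nonzero parts, so its length is the length of the list.\<close>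

definition is_partition :: "nat list \<Rightarrow> bool" where
  "is_partition \<nu> \<longleftrightarrow> sorted_wrt (\<ge>) \<nu> \<and> 0 \<notin> set \<nu>"

definition cells :: "nat list \<Rightarrow> (nat \<times> nat) set" where
  "cells \<nu> = {(i, j). i < length \<nu> \<and> j < \<nu> ! i}"

definition ssyt :: "nat list \<Rightarrow> nat set \<Rightarrow> (nat \<times> nat \<Rightarrow> nat) set" where
  "ssyt \<nu> A = {T \<in> cells \<nu> \<rightarrow>\<^sub>E A.
     (\<forall>i j. (i, Suc j) \<in> cells \<nu> \<longrightarrow> T (i, j) \<le> T (i, Suc j)) \<and>
     (\<forall>i j. (Suc i, j) \<in> cells \<nu> \<longrightarrow> T (i, j) < T (Suc i, j))}"

definition schur_poly :: "nat \<Rightarrow> nat list \<Rightarrow> (nat \<Rightarrow> real) \<Rightarrow> real" where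
  "schur_poly K \<nu> x = (\<Sum>T\<in>ssyt \<nu> {..<K}. \<Prod>c\<in>cells \<nu>. x (T c))"

text \<open>The Schur symmetric function at a sequence of arguments. The sum is unconditional; it is
  meaningful for absolutely summable sequences, which is the only case in which it is used.\<close>

definition schur_fun :: "nat list \<Rightarrow> (nat \<Rightarrow> real) \<Rightarrow> real" where
  "schur_fun \<nu> x = (\<Sum>\<^sub>\<infinity>T\<in>ssyt \<nu> UNIV. \<Prod>c\<in>cells \<nu>. x (T c))"

text \<open>The points of a countable set listed without repetition, followed by zeros if the set is
  finite. The order is arbitrary; \<open>schur_fun\<close> is symmetric.\<close>

definition config_seq :: "real set \<Rightarrow> nat \<Rightarrow> real" where
  "config_seq X i = (if infinite X \<or> i < card X then from_nat_into X i else 0)"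

definition schur_norm :: "real \<Rightarrow> nat \<Rightarrow> nat list \<Rightarrow> (nat \<Rightarrow> real) \<Rightarrow> real" where
  "schur_norm q K \<nu> Y = schur_poly K \<nu> Y / schur_poly K \<nu> (\<lambda>i. q ^ i)"

definition schur_norm_inf :: "real \<Rightarrow> nat list \<Rightarrow> real set \<Rightarrow> real" where
  "schur_norm_inf q \<nu> X = schur_fun \<nu> (config_seq X) / schur_fun \<nu> (\<lambda>i. q ^ i)"

text \<open>The property which determines the probability measure \<open>\<Lambda>\<^sup>\<infinity>\<^sub>K(X, \<cdot>)\<close> uniquely.\<close>

definition is_link_measure ::
    "real \<Rightarrow> real \<Rightarrow> real \<Rightarrow> nat \<Rightarrow> real set \<Rightarrow> (nat \<Rightarrow> real) pmf \<Rightarrow> bool" where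
  "is_link_measure q zp zm K X p \<longleftrightarrow> set_pmf p \<subseteq> ext_configs q zp zm K \<and>
     (\<forall>\<nu>. is_partition \<nu> \<and> length \<nu> \<le> K \<longrightarrow>
        ((\<lambda>Y. pmf p Y * schur_norm q K \<nu> Y) has_sum schur_norm_inf q \<nu> X) (ext_configs q zp zm K))"

definition C0 :: "'a topology \<Rightarrow> ('a \<Rightarrow> real) set" where
  "C0 T = {f. continuous_map T euclideanreal f \<and>
     (\<forall>\<epsilon>>0. \<exists>C. compactin T C \<and> (\<forall>x \<in> topspace T - C. \<bar>f x\<bar> < \<epsilon>))}"

definition kernel_op :: "'b topology \<Rightarrow> ('a \<Rightarrow> 'b pmf) \<Rightarrow> ('b \<Rightarrow> real) \<Rightarrow> 'a \<Rightarrow> real" where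
  "kernel_op T \<Lambda> f = (\<lambda>x. \<Sum>\<^sub>\<infinity>y\<in>topspace T. pmf (\<Lambda> x) y * f y)"

definition feller :: "'a topology \<Rightarrow> 'b topology \<Rightarrow> ('a \<Rightarrow> 'b pmf) \<Rightarrow> bool" where
  "feller S T \<Lambda> \<longleftrightarrow> (\<forall>f \<in> C0 T. kernel_op T \<Lambda> f \<in> C0 S)"

end

theory Submission
  imports Defs "Jordan_Normal_Form.Determinant"
begin

text \<open>
  Since the expectations of the normalized Schur polynomials are prescribed, Pieri's rule for the
  elementary symmetric polynomials \<open>e\<^sub>r\<close> bounds the moments of \<open>e\<^sub>r\<close> under a link measure by
  those of a bounded variable; so the link measures of all \<open>X\<close> in a fixed interval live on one
  compact set. The polynomials \<open>e\<^sub>r\<close> separate the points of the cone, and by Pieri's rule the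
  algebra they generate lies in the span of the Schur polynomials. Continuity of the kernel follows
  from the Stone--Weierstrass theorem and from the continuity of \<open>S\<^sub>\<nu>(X)\<close> in \<open>X\<close>.

  For the decay at infinity only one-row shapes are needed. If \<open>a \<in> X\<close> and \<open>X' = X - {a}\<close>, then
  \<open>h\<^sub>n\<^sub>+\<^sub>1(X) - h\<^sub>n\<^sub>+\<^sub>1(X') = a h\<^sub>n(X)\<close>, which for the expectations \<open>v\<^sub>n\<close>, \<open>v'\<^sub>n\<close> of \<open>h\<^sub>n\<close> under the
  links reads \<open>v\<^sub>n\<^sub>+\<^sub>1 - v'\<^sub>n\<^sub>+\<^sub>1 = a (1 - q\<^sup>n\<^sup>+\<^sup>K) v\<^sub>n\<close>. Divided differences of polynomials are linear
  in the \<open>h\<^sub>n\<close> and are controlled by derivatives. Choosing a polynomial with bounded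
  \<open>(K - 1)\<close>-st derivative we obtain a function, bounded below by a positive constant on a given
  bounded set and nonnegative on the supports, whose expectation is \<open>O(1 / \<bar>a\<bar>)\<close>. Hence the mass
  of every bounded set tends to zero as \<open>X\<close> leaves all bounded intervals.
\<close>

section \<open>Tableaux and horizontal strips\<close>

text \<open>A link measure enters only through its expectations of Schur polynomials, so every
  weight has to be estimated by means of polynomials. Since the lattice has points of both signs,
  \<open>h_n\<close> is not of constant sign, and positivity must be found elsewhere:
  \<open>h_n(Y)\<close> is the divided difference of \<open>z^(n+K-1)\<close> at the
  \<open>K\<close> points of \<open>Y\<close>, and a divided difference of order \<open>K-1\<close>
  inherits the sign of the \<open>(K-1)\<close>-st derivative. In this language the factor
  \<open>1 - q^(n+K)\<close> turns the removal of \<open>a\<close> into a q-difference,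
  \<open>F(z) - F(q z) = z G(z)\<close>. A bounded increasing function as \<open>(K-1)\<close>-st
  derivative of \<open>F\<close>, such as the arctangent, keeps the expectations for
  \<open>F\<close> bounded and makes the \<open>(K-1)\<close>-st derivative of \<open>G\<close>
  positive on both sides of zero. As only polynomials have prescribed expectations, the arctangent
  is imitated by a polynomial on an interval containing the supports. This interval grows with
  \<open>X\<close> and the degree grows with it; the decay is uniform because the bounds on the
  derivatives do not involve the length of the interval.\<close>

definition diagram :: "(nat \<Rightarrow> nat) \<Rightarrow> (nat \<times> nat) set" where
  "diagram m = {(i, j). j < m i}"

definition tableaux :: "(nat \<times> nat) set \<Rightarrow> nat set \<Rightarrow> (nat \<times> nat \<Rightarrow> nat) set" where
  "tableaux D A = {T \<in> D \<rightarrow>\<^sub>E A.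
     (\<forall>i j. (i, Suc j) \<in> D \<longrightarrow> T (i, j) \<le> T (i, Suc j)) \<and>
     (\<forall>i j. (Suc i, j) \<in> D \<longrightarrow> T (i, j) < T (Suc i, j))}"

definition tableau_sum :: "(nat \<Rightarrow> nat) \<Rightarrow> nat set \<Rightarrow> (nat \<Rightarrow> real) \<Rightarrow> real" where
  "tableau_sum m A x = (\<Sum>T\<in>tableaux (diagram m) A. \<Prod>c\<in>diagram m. x (T c))"

text \<open>Row lengths are padded with zeros to a function on all natural numbers, so that
  interlacing and adding a cell to a row are pointwise conditions. The index \<open>K\<close> bounds
  the number of nonempty rows.\<close>

definition shapes :: "nat \<Rightarrow> (nat \<Rightarrow> nat) set" where
  "shapes K = {m. antimono m \<and> (\<forall>i\<ge>K. m i = 0)}"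

lemma shapes_mono: "K \<le> L \<Longrightarrow> shapes K \<subseteq> shapes L"
  by (auto simp: shapes_def)

lemma shapesD: "m \<in> shapes K \<Longrightarrow> i \<le> j \<Longrightarrow> m j \<le> m i" "m \<in> shapes K \<Longrightarrow> K \<le> i \<Longrightarrow> m i = 0"
  by (auto simp: shapes_def antimono_def)

lemma diagram_eq_Sigma: "m \<in> shapes K \<Longrightarrow> diagram m = Sigma {..<K} (\<lambda>i. {..<m i})"
  by (force simp: shapes_def diagram_def not_less[symmetric])

lemma finite_diagram: "m \<in> shapes K \<Longrightarrow> finite (diagram m)"
  by (simp add: diagram_eq_Sigma)

lemma card_diagram: "m \<in> shapes K \<Longrightarrow> card (diagram m) = (\<Sum>i<K. m i)"
  by (simp add: diagram_eq_Sigma)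

lemma finite_tableaux: "finite D \<Longrightarrow> finite A \<Longrightarrow> finite (tableaux D A)"
  by (rule finite_subset[of _ "D \<rightarrow>\<^sub>E A"]) (auto simp: tableaux_def intro: finite_PiE)

lemma diagram_0: "diagram (\<lambda>_. 0) = {}"
  by (simp add: diagram_def)

lemma tableaux_empty: "tableaux {} A = {\<lambda>_. undefined}"
  by (auto simp: tableaux_def)

lemma empty_shape: "(\<lambda>_. 0) \<in> shapes K"
  by (simp add: shapes_def antimono_def)

lemma tableau_sum_empty_shape: "tableau_sum (\<lambda>_. 0) A x = 1"
  by (simp add: tableau_sum_def diagram_0 tableaux_empty)

lemma tableaux_row_mono:
  assumes T: "T \<in> tableaux (diagram m) A" and "j \<le> j'" "j' < m i"
  shows "T (i, j) \<le> T (i, j')"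
  using assms(2,3)
proof (induction j' rule: dec_induct)
  case (step n)
  then have "T (i, n) \<le> T (i, Suc n)" using T by (auto simp: tableaux_def diagram_def)
  then show ?case using step by simp
qed simp

lemma tableaux_row_index_le:
  assumes T: "T \<in> tableaux (diagram m) A" and m: "m \<in> shapes K" and "j < m i"
  shows "i \<le> T (i, j)"
  using assms(3)
proof (induction i)
  case (Suc i)
  have "m (Suc i) \<le> m i" using shapesD(1)[OF m] by simp
  then have "i \<le> T (i, j)" using Suc by simp
  moreover have "T (i, j) < T (Suc i, j)" using T Suc.prems by (auto simp: tableaux_def diagram_def)
  ultimately show ?case by simp
qed simp

text \<open>Column strictness makes row \<open>n\<close> start with a letter that is at least
  \<open>n\<close>, and the alphabet has only the letters below \<open>n\<close>.\<close>

lemma tableau_sum_eq_0: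
  assumes m: "m \<in> shapes K" and "m n > 0"
  shows "tableau_sum m {..<n} x = 0"
proof -
  have "tableaux (diagram m) {..<n} = {}"
  proof (rule ccontr)
    assume "tableaux (diagram m) {..<n} \<noteq> {}"
    then obtain T where T: "T \<in> tableaux (diagram m) {..<n}" by blast
    have "n \<le> T (n, 0)" using tableaux_row_index_le[OF T m] assms(2) by simp
    moreover have "T (n, 0) < n" using T assms(2) by (auto simp: tableaux_def diagram_def)
    ultimately show False by simp
  qed
  then show ?thesis by (simp add: tableau_sum_def)
qed

text \<open>The shapes which remain after a horizontal strip is removed from \<open>m\<close>.\<close>

definition interlacing :: "nat \<Rightarrow> (nat \<Rightarrow> nat) \<Rightarrow> (nat \<Rightarrow> nat) set" where
  "interlacing K m = {\<mu>. (\<forall>i<K. m (Suc i) \<le> \<mu> i \<and> \<mu> i \<le> m i) \<and> (\<forall>i\<ge>K. \<mu> i = 0)}"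

lemma interlacing_shapes: "m \<in> shapes (Suc K) \<Longrightarrow> \<mu> \<in> interlacing K m \<Longrightarrow> \<mu> \<in> shapes K"
proof -
  assume m: "m \<in> shapes (Suc K)" and mu: "\<mu> \<in> interlacing K m"
  have "\<mu> (Suc i) \<le> \<mu> i" for i
  proof (cases "Suc i < K")
    case True
    then have "\<mu> (Suc i) \<le> m (Suc i)" "m (Suc i) \<le> \<mu> i" using mu by (auto simp: interlacing_def)
    then show ?thesis by simp
  next
    case False
    then show ?thesis using mu by (simp add: interlacing_def)
  qed
  then show ?thesis using mu
    by (auto simp: shapes_def interlacing_def intro: antimonoI lift_Suc_antimono_le)
qed

lemma interlacing_le: "m \<in> shapes (Suc K) \<Longrightarrow> \<mu> \<in> interlacing K m \<Longrightarrow> \<mu> i \<le> m i"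
  by (cases "i < K") (auto simp: interlacing_def)

lemma interlacing_ge: "m \<in> shapes (Suc K) \<Longrightarrow> \<mu> \<in> interlacing K m \<Longrightarrow> m (Suc i) \<le> \<mu> i"
  by (cases "i < K") (auto simp: interlacing_def shapes_def)

lemma finite_interlacing: "finite (interlacing K m)"
proof -
  define f where "f g = (\<lambda>i. if i < K then g i else (0::nat))" for g :: "nat \<Rightarrow> nat"
  have "interlacing K m \<subseteq> f ` (PiE {..<K} (\<lambda>i. {..m i}))"
  proof
    fix \<mu> assume mu: "\<mu> \<in> interlacing K m"
    have "\<mu> = f (restrict \<mu> {..<K})" using mu by (auto simp: f_def interlacing_def)
    moreover have "restrict \<mu> {..<K} \<in> PiE {..<K} (\<lambda>i. {..m i})" using mu by (auto simp: interlacing_def)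
    ultimately show "\<mu> \<in> f ` (PiE {..<K} (\<lambda>i. {..m i}))" by blast
  qed
  then show ?thesis by (rule finite_subset) (intro finite_imageI finite_PiE; simp)
qed

text \<open>The cells with the largest letter \<open>K\<close> form a horizontal strip.\<close>

lemma tableau_sum_Suc:
  assumes m: "m \<in> shapes (Suc K)"
  shows "tableau_sum m {..<Suc K} x =
    (\<Sum>\<mu>\<in>interlacing K m. tableau_sum \<mu> {..<K} x * x K ^ (\<Sum>i<Suc K. m i - \<mu> i))"
proof -
  define D where "D = diagram m"
  define S where "S = (SIGMA \<mu> : interlacing K m. tableaux (diagram \<mu>) {..<K})"
  \<comment> \<open>Rows increase weakly, so the letters below \<open>K\<close> fill an initial
    segment of each row; \<open>low T\<close> records the lengths of these segments, the shape that
    is left when the letter \<open>K\<close> is erased.\<close>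
  define low where "low T i = card {j. j < m i \<and> T (i, j) < K}" for T :: "nat \<times> nat \<Rightarrow> nat" and i
  define F where "F p = (\<lambda>c. if c \<in> D then if c \<in> diagram (fst p) then snd p c else K else undefined)"
    for p :: "(nat \<Rightarrow> nat) \<times> (nat \<times> nat \<Rightarrow> nat)"
  define G where "G T = (low T, restrict T (diagram (low T)))" for T
  have finD: "finite D" unfolding D_def using finite_diagram[OF m] .
  have sub: "diagram \<mu> \<subseteq> D" if "\<mu> \<in> interlacing K m" for \<mu>
    using interlacing_le[OF m that] by (auto simp: D_def diagram_def intro: less_le_trans)
  have low: "T (i, j) < K \<longleftrightarrow> j < low T i" if T: "T \<in> tableaux D {..<Suc K}" and "j < m i" for T i j
  proof -
    define L where "L = {j. j < m i \<and> T (i, j) < K}"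
    have finL: "finite L" by (simp add: L_def)
    have down: "a \<in> L" if "b \<in> L" "a \<le> b" for a b
    proof -
      have "T (i, a) \<le> T (i, b)"
        using tableaux_row_mono[OF T[unfolded D_def] that(2), of i] that(1) by (simp add: L_def)
      then show ?thesis using that by (simp add: L_def)
    qed
    have "L = {..<card L}"
    proof (cases "L = {}")
      case False
      have "L = {..Max L}" using down Max_in[OF finL False] Max_ge[OF finL] by blast
      then show ?thesis by (metis card_atMost lessThan_Suc_atMost)
    qed simp
    then have "j \<in> L \<longleftrightarrow> j < low T i" unfolding low_def L_def by blast
    then show ?thesis using that(2) by (simp add: L_def)
  qed
  have low_le: "low T i \<le> m i" for T i
    unfolding low_def using card_mono[of "{..<m i}" "{j. j < m i \<and> T (i, j) < K}"] by auto
  have bij: "bij_betw F S (tableaux D {..<Suc K})"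
  proof (rule bij_betwI[of F _ _ G])
    show "F \<in> S \<rightarrow> tableaux D {..<Suc K}"
    proof
      fix p assume "p \<in> S"
      then obtain \<mu> T where p: "p = (\<mu>, T)" and mu: "\<mu> \<in> interlacing K m"
        and T: "T \<in> tableaux (diagram \<mu>) {..<K}" by (auto simp: S_def)
      have TK: "c \<in> diagram \<mu> \<Longrightarrow> T c < K" for c using T by (auto simp: tableaux_def)
      have 1: "F p \<in> D \<rightarrow>\<^sub>E {..<Suc K}"
        using TK by (force simp: F_def p less_Suc_eq)
      have 2: "F p (i, j) \<le> F p (i, Suc j)" if "(i, Suc j) \<in> D" for i j
        using T TK[of "(i,j)"] that by (auto simp: F_def p D_def diagram_def tableaux_def)
      \<comment> \<open>The cell above a cell of \<open>D\<close> always belongs to the inner shape,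
        because the strip is horizontal; its letter is therefore below \<open>K\<close>.\<close>
      have 3: "F p (i, j) < F p (Suc i, j)" if "(Suc i, j) \<in> D" for i j
      proof -
        have "j < \<mu> i" using that interlacing_ge[OF m mu, of i] by (auto simp: D_def diagram_def)
        moreover have "j < m i" using calculation interlacing_le[OF m mu, of i] by simp
        ultimately show ?thesis
          using T TK[of "(i,j)"] that by (auto simp: F_def p D_def diagram_def tableaux_def)
      qed
      show "F p \<in> tableaux D {..<Suc K}" using 1 2 3 by (auto simp: tableaux_def)
    qed
    show "G \<in> tableaux D {..<Suc K} \<rightarrow> S"
    proof
      fix T assume T: "T \<in> tableaux D {..<Suc K}"
      have TS: "c \<in> D \<Longrightarrow> T c < Suc K" for c using T by (auto simp: tableaux_def)
      have col: "T (i, j) < T (Suc i, j)" if "(Suc i, j) \<in> D" for i j using that T by (auto simp: tableaux_def)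
      have one_row: "T (i, j) \<le> T (i, Suc j)" if "(i, Suc j) \<in> D" for i j using that T by (auto simp: tableaux_def)
      \<comment> \<open>A letter directly above another one is smaller, hence below
        \<open>K\<close>; so the inner row \<open>i\<close> is at least as long as row
        \<open>i + 1\<close> of \<open>m\<close>.\<close>
      have il: "low T \<in> interlacing K m"
      proof -
        have "m (Suc i) \<le> low T i" for i
        proof (rule ccontr)
          assume "\<not> m (Suc i) \<le> low T i"
          then have a: "low T i < m (Suc i)" by simp
          then have "(Suc i, low T i) \<in> D" by (simp add: D_def diagram_def)
          from col[OF this] TS[OF this] have "T (i, low T i) < K" by simp
          moreover have "low T i < m i" using a shapesD(1)[OF m, of i "Suc i"] by simp
          ultimately show False using low[OF T] by blast
        qed
        moreover have "low T i = 0" if "i \<ge> K" for i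
        proof (rule ccontr)
          assume "low T i \<noteq> 0"
          then have "0 < low T i" by simp
          moreover have "0 < m i" using calculation low_le[of T i] by simp
          ultimately have "T (i, 0) < K" using low[OF T] by blast
          moreover have "i \<le> T (i, 0)"
            using tableaux_row_index_le[OF T[unfolded D_def] m \<open>0 < m i\<close>] .
          ultimately show False using that by simp
        qed
        ultimately show ?thesis using low_le by (auto simp: interlacing_def)
      qed
      have K: "T c < K" if "c \<in> diagram (low T)" for c
        using that low[OF T, of "snd c" "fst c"] low_le[of T "fst c"] by (auto simp: diagram_def)
      have anti: "low T (Suc i) \<le> low T i" for i
        using shapesD(1)[OF interlacing_shapes[OF m il], of i "Suc i"] by simp
      have "restrict T (diagram (low T)) \<in> tableaux (diagram (low T)) {..<K}"
        unfolding tableaux_def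
      proof (intro CollectI conjI allI impI)
        show "restrict T (diagram (low T)) \<in> diagram (low T) \<rightarrow>\<^sub>E {..<K}" using K by auto
      next
        fix i j assume a: "(i, Suc j) \<in> diagram (low T)"
        then have "(i, j) \<in> diagram (low T)" "(i, Suc j) \<in> D" using low_le[of T i] by (auto simp: D_def diagram_def)
        then show "restrict T (diagram (low T)) (i, j) \<le> restrict T (diagram (low T)) (i, Suc j)"
          using a one_row by simp
      next
        fix i j assume a: "(Suc i, j) \<in> diagram (low T)"
        then have "(i, j) \<in> diagram (low T)" "(Suc i, j) \<in> D" using low_le[of T "Suc i"] anti[of i]
          by (auto simp: D_def diagram_def)
        then show "restrict T (diagram (low T)) (i, j) < restrict T (diagram (low T)) (Suc i, j)"
          using a col by simp
      qed
      then show "G T \<in> S" using il by (simp add: G_def S_def)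
    qed
    show "G (F p) = p" if pS: "p \<in> S" for p
    proof -
      obtain \<mu> T where p: "p = (\<mu>, T)" and mu: "\<mu> \<in> interlacing K m"
        and T: "T \<in> tableaux (diagram \<mu>) {..<K}" using pS by (auto simp: S_def)
      have TK: "c \<in> diagram \<mu> \<Longrightarrow> T c < K" for c using T by (auto simp: tableaux_def)
      have "{j. j < m i \<and> F p (i, j) < K} = {..<\<mu> i}" for i
        using TK[of "(i, _)"] interlacing_le[OF m mu, of i] by (auto simp: F_def p D_def diagram_def)
      then have l: "low (F p) = \<mu>" by (auto simp: low_def)
      have "restrict (F p) (diagram \<mu>) = T"
        using T sub[OF mu] by (auto simp: F_def p tableaux_def PiE_def extensional_def restrict_def fun_eq_iff)
      then show ?thesis unfolding G_def l by (simp add: p)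
    qed
    show "F (G T) = T" if T: "T \<in> tableaux D {..<Suc K}" for T
    proof
      fix c
      have "T c < Suc K" if "c \<in> D" using T that by (auto simp: tableaux_def)
      moreover have "T c = undefined" if "c \<notin> D" using T that by (auto simp: tableaux_def)
      moreover have "c \<in> diagram (low T) \<longleftrightarrow> T c < K" if "c \<in> D"
        using low[OF T, of "snd c" "fst c"] that by (auto simp: D_def diagram_def)
      ultimately show "F (G T) c = T c" by (auto simp: F_def G_def)
    qed
  qed
  have wt: "(\<Prod>c\<in>D. x (F (\<mu>, T) c)) = (\<Prod>c\<in>diagram \<mu>. x (T c)) * x K ^ (\<Sum>i<Suc K. m i - \<mu> i)"
    if mu: "\<mu> \<in> interlacing K m" for \<mu> T
  proof -
    have mu': "\<mu> \<in> shapes (Suc K)" using interlacing_shapes[OF m mu] shapes_mono[of K "Suc K"] by auto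
    have "card (D - diagram \<mu>) = (\<Sum>i<Suc K. m i) - (\<Sum>i<Suc K. \<mu> i)"
      using card_Diff_subset[OF finite_diagram[OF mu'] sub[OF mu]] card_diagram[OF mu'] card_diagram[OF m]
      by (simp add: D_def)
    also have "\<dots> = (\<Sum>i<Suc K. m i - \<mu> i)"
      using interlacing_le[OF m mu] by (subst sum_subtractf_nat) auto
    finally have cd: "card (D - diagram \<mu>) = (\<Sum>i<Suc K. m i - \<mu> i)" .
    have "(\<Prod>c\<in>D. x (F (\<mu>, T) c)) = (\<Prod>c\<in>D - diagram \<mu>. x (F (\<mu>, T) c)) * (\<Prod>c\<in>diagram \<mu>. x (F (\<mu>, T) c))"
      by (rule prod.subset_diff[OF sub[OF mu] finD])
    also have "(\<Prod>c\<in>D - diagram \<mu>. x (F (\<mu>, T) c)) = (\<Prod>c\<in>D - diagram \<mu>. x K)"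
      by (rule prod.cong) (auto simp: F_def)
    also have "(\<Prod>c\<in>diagram \<mu>. x (F (\<mu>, T) c)) = (\<Prod>c\<in>diagram \<mu>. x (T c))"
      using sub[OF mu] by (intro prod.cong) (auto simp: F_def)
    finally show ?thesis using cd by simp
  qed
  have fin: "finite (tableaux (diagram \<mu>) {..<K})" if "\<mu> \<in> interlacing K m" for \<mu>
    using finite_tableaux finite_diagram[OF interlacing_shapes[OF m that]] by blast
  have "tableau_sum m {..<Suc K} x = (\<Sum>p\<in>S. \<Prod>c\<in>D. x (F p c))"
    unfolding tableau_sum_def D_def[symmetric] by (rule sum.reindex_bij_betw[OF bij, symmetric])
  also have "\<dots> = (\<Sum>\<mu>\<in>interlacing K m. \<Sum>T\<in>tableaux (diagram \<mu>) {..<K}. \<Prod>c\<in>D. x (F (\<mu>, T) c))"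
    unfolding S_def by (subst sum.Sigma) (auto simp: finite_interlacing fin)
  also have "\<dots> = (\<Sum>\<mu>\<in>interlacing K m. \<Sum>T\<in>tableaux (diagram \<mu>) {..<K}.
      (\<Prod>c\<in>diagram \<mu>. x (T c)) * x K ^ (\<Sum>i<Suc K. m i - \<mu> i))"
    by (intro sum.cong refl wt)
  finally show ?thesis by (simp add: tableau_sum_def sum_distrib_right)
qed

section \<open>The bialternant formula and Pieri's rule\<close>

definition alternant :: "nat \<Rightarrow> (nat \<Rightarrow> nat) \<Rightarrow> (nat \<Rightarrow> real) \<Rightarrow> real" where
  "alternant n l x = Determinant.det (Matrix.mat n n (\<lambda>(i, j). x i ^ l j))"

text \<open>The exponents \<open>m + delta\<close> of the bialternant formula, with the staircase
  \<open>delta = (n - 1, ..., 1, 0)\<close>.\<close>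

definition shift_exps :: "nat \<Rightarrow> (nat \<Rightarrow> nat) \<Rightarrow> nat \<Rightarrow> nat" where
  "shift_exps n m j = m j + (n - 1 - j)"

lemma alternant_Leibniz:
  "alternant n l x = (\<Sum>p | p permutes {0..<n}. signof p * (\<Prod>j<n. x (p j) ^ l j))"
proof -
  have "(\<Prod>j<n. Matrix.mat n n (\<lambda>(i, j). x i ^ l j) $$ (p j, j)) = (\<Prod>j<n. x (p j) ^ l j)"
    if p: "p permutes {0..<n}" for p
  proof (rule prod.cong[OF refl])
    fix j assume "j \<in> {..<n}"
    then show "Matrix.mat n n (\<lambda>(i, j). x i ^ l j) $$ (p j, j) = x (p j) ^ l j"
      using permutes_in_image[OF p, of j] by simp
  qed
  then show ?thesis unfolding alternant_def
    by (subst det_col[where n = n]) (simp, intro sum.cong refl, simp)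
qed

lemma alternant_cong: "(\<And>j. j < n \<Longrightarrow> l j = l' j) \<Longrightarrow> alternant n l x = alternant n l' x"
  unfolding alternant_Leibniz by simp

lemma alternant_permute:
  assumes "p permutes {0..<n}"
  shows "alternant n l (x \<circ> p) = signof p * alternant n l x"
proof -
  have "p j < n" if "j < n" for j using permutes_in_image[OF assms, of j] that by simp
  then have *: "Matrix.mat n n (\<lambda>(i, j). (x \<circ> p) i ^ l j) =
      Matrix.mat n n (\<lambda>(i, j). Matrix.mat n n (\<lambda>(i, j). x i ^ l j) $$ (p i, j))"
    by (intro eq_matI) simp_all
  show ?thesis unfolding alternant_def *
    by (rule det_permute_rows[OF _ assms]) simp
qed

lemma alternant_eq_0:
  assumes "i < n" "j < n" "i \<noteq> j" "l i = l j"
  shows "alternant n l x = 0"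
  unfolding alternant_def
  by (rule det_identical_columns[OF _ assms(3,1,2)]) (use assms in \<open>auto intro!: eq_vecI\<close>)

text \<open>The left side is an entry of the matrix after the column operations below. The exponents
  \<open>p\<close> between \<open>a\<close> and \<open>b\<close> become the interlacing
  condition.\<close>

lemma power_diff_sum:
  fixes x z :: real
  assumes "a \<le> b"
  shows "x ^ b - z ^ (b - a) * x ^ a = (x - z) * (\<Sum>p\<in>{a..<b}. x ^ p * z ^ (b - 1 - p))"
proof -
  have "x ^ b - z ^ (b - a) * x ^ a = x ^ a * (x ^ (b - a) - z ^ (b - a))"
    using assms by (simp add: algebra_simps flip: power_add)
  also have "x ^ (b - a) - z ^ (b - a) = (x - z) * (\<Sum>i<b - a. z ^ (b - a - Suc i) * x ^ i)"
    by (rule power_diff_sumr2)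
  also have "x ^ a * ((x - z) * (\<Sum>i<b - a. z ^ (b - a - Suc i) * x ^ i)) =
      (x - z) * (\<Sum>i<b - a. x ^ (i + a) * z ^ (b - 1 - (i + a)))"
    by (simp add: sum_distrib_left power_add algebra_simps)
  also have "(\<Sum>i<b - a. x ^ (i + a) * z ^ (b - 1 - (i + a))) = (\<Sum>p\<in>{a..<b}. x ^ p * z ^ (b - 1 - p))"
    using sum.shift_bounds_nat_ivl[of "\<lambda>p. x ^ p * z ^ (b - 1 - p)" 0 a "b - a"] assms
    by (simp add: lessThan_atLeast0)
  finally show ?thesis .
qed

text \<open>Multiplication by the unipotent matrix \<open>U\<close> subtracts from each column a
  multiple of the next one, chosen so that the last row vanishes except for its final entry
  \<open>x n ^ l n\<close>. Expansion along that row leaves the smaller determinant. Monotonicity of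
  \<open>l\<close> makes the exponent differences genuine.\<close>

lemma alternant_Suc_columns:
  assumes l: "\<And>j. j < n \<Longrightarrow> l (Suc j) \<le> l j"
  shows "alternant (Suc n) l x = x n ^ l n *
    Determinant.det (Matrix.mat n n (\<lambda>(i, j). x i ^ l j - x n ^ (l j - l (Suc j)) * x i ^ l (Suc j)))"
proof -
  define N where "N = Suc n"
  define c where "c j = - (x n ^ (l j - l (Suc j)))" for j
  define A where "A = Matrix.mat N N (\<lambda>(i, j). x i ^ l j)"
  define U where "U = Matrix.mat N N (\<lambda>(i, j). if i = j then 1 else if i = Suc j then c j else 0)"
  define C where "C = Matrix.mat n n (\<lambda>(i, j). x i ^ l j - x n ^ (l j - l (Suc j)) * x i ^ l (Suc j))"
  have A: "A \<in> carrier_mat N N" and U: "U \<in> carrier_mat N N" by (auto simp: A_def U_def)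
  have "Determinant.det U = prod_list (diag_mat U)"
    by (rule det_lower_triangular[OF _ U]) (auto simp: U_def)
  also have "diag_mat U = replicate N 1" by (rule nth_equalityI) (auto simp: diag_mat_def U_def)
  finally have "Determinant.det U = 1" by simp
  then have dA: "alternant N l x = Determinant.det (A * U)"
    using det_mult[OF A U] by (simp add: alternant_def A_def)
  have entry: "(A * U) $$ (i, j) = x i ^ l j + (if Suc j < N then x i ^ l (Suc j) * c j else 0)"
    if "i < N" "j < N" for i j
  proof -
    have "(A * U) $$ (i, j) = (\<Sum>k\<in>{0..<N}. x i ^ l k * (if k = j then 1 else if k = Suc j then c j else 0))"
      using that A U by (simp add: A_def U_def scalar_prod_def)
    also have "\<dots> = (\<Sum>k\<in>{0..<N}. (if k = j then x i ^ l k else 0) + (if k = Suc j then x i ^ l k * c j else 0))"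
      by (intro sum.cong) auto
    also have "\<dots> = x i ^ l j + (if Suc j < N then x i ^ l (Suc j) * c j else 0)"
      using that by (simp add: sum.distrib)
    finally show ?thesis .
  qed
  have B: "A * U \<in> carrier_mat N N" using A U by simp
  have last: "(A * U) $$ (n, j) = 0" if "j < n" for j
    using entry[of n j] that l[OF that] by (simp add: N_def c_def flip: power_add)
  have "mat_delete (A * U) n n = C"
    by (rule eq_matI) (use entry A U in \<open>auto simp: mat_delete_def C_def c_def N_def\<close>)
  then have cof: "cofactor (A * U) n n = Determinant.det C" by (simp add: cofactor_def)
  have "Determinant.det (A * U) = (\<Sum>j<N. (A * U) $$ (n, j) * cofactor (A * U) n j)"
    by (rule laplace_expansion_row[OF B]) (simp add: N_def)
  also have "\<dots> = (A * U) $$ (n, n) * cofactor (A * U) n n" using last by (simp add: N_def)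
  finally show ?thesis using dA cof entry[of n n] by (simp add: N_def C_def)
qed

text \<open>Row \<open>i\<close> of the reduced matrix is divisible by \<open>x i - x n\<close>;
  what remains is expanded by multilinearity in the columns. The result is the same recursion as for
  sums over tableaux, up to the product of the differences.\<close>

lemma alternant_Suc:
  assumes m: "m \<in> shapes (Suc n)"
  shows "alternant (Suc n) (shift_exps (Suc n) m) x = (\<Prod>i<n. x i - x n) *
    (\<Sum>\<mu>\<in>interlacing n m. alternant n (shift_exps n \<mu>) x * x n ^ (\<Sum>i<Suc n. m i - \<mu> i))"
proof -
  define l where "l = shift_exps (Suc n) m"
  define S where "S j = {l (Suc j)..<l j}" for j
  have lS: "l (Suc j) < l j" if "j < n" for j
    using shapesD(1)[OF m, of j "Suc j"] that by (auto simp: l_def shift_exps_def)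
  have ac: "s * (P * (a * b)) = P * (a * (s * b))" for s P a b :: real by simp
  have pn: "p j < n" if "p permutes {0..<n}" "j < n" for p j
    using permutes_in_image[OF that(1), of j] that by simp
  let ?C = "Matrix.mat n n (\<lambda>(i, j). x i ^ l j - x n ^ (l j - l (Suc j)) * x i ^ l (Suc j))"
  have expand: "(\<Prod>j<n. ?C $$ (p j, j)) =
    (\<Prod>i<n. x i - x n) * (\<Sum>g\<in>PiE {..<n} S. (\<Prod>j<n. x n ^ (l j - 1 - g j)) * (\<Prod>j<n. x (p j) ^ g j))"
    if p: "p permutes {0..<n}" for p
  proof -
    have "(\<Prod>j<n. ?C $$ (p j, j)) = (\<Prod>j<n. (x (p j) - x n) * (\<Sum>r\<in>S j. x (p j) ^ r * x n ^ (l j - 1 - r)))"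
      using pn[OF p] lS by (intro prod.cong refl) (simp add: S_def less_imp_le power_diff_sum)
    also have "\<dots> = (\<Prod>j<n. x (p j) - x n) * (\<Prod>j<n. \<Sum>r\<in>S j. x (p j) ^ r * x n ^ (l j - 1 - r))"
      by (rule prod.distrib)
    also have "(\<Prod>j<n. x (p j) - x n) = (\<Prod>i<n. x i - x n)"
      using prod.permute[OF p, of "\<lambda>i. x i - x n"] by (simp add: lessThan_atLeast0 o_def)
    also have "(\<Prod>j<n. \<Sum>r\<in>S j. x (p j) ^ r * x n ^ (l j - 1 - r)) =
        (\<Sum>g\<in>PiE {..<n} S. \<Prod>j<n. x (p j) ^ g j * x n ^ (l j - 1 - g j))"
      by (rule prod_sum_PiE) (auto simp: S_def)
    finally show ?thesis by (simp add: prod.distrib mult.commute)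
  qed
  have "Determinant.det ?C = (\<Sum>p | p permutes {0..<n}. signof p * (\<Prod>j<n. ?C $$ (p j, j)))"
    by (rule det_col) simp
  also have "\<dots> = (\<Sum>p | p permutes {0..<n}. \<Sum>g\<in>PiE {..<n} S. (\<Prod>i<n. x i - x n) *
      ((\<Prod>j<n. x n ^ (l j - 1 - g j)) * (signof p * (\<Prod>j<n. x (p j) ^ g j))))"
  proof (intro sum.cong refl)
    fix p assume "p \<in> {p. p permutes {0..<n}}"
    then have p: "p permutes {0..<n}" by simp
    show "signof p * (\<Prod>j<n. ?C $$ (p j, j)) = (\<Sum>g\<in>PiE {..<n} S. (\<Prod>i<n. x i - x n) *
      ((\<Prod>j<n. x n ^ (l j - 1 - g j)) * (signof p * (\<Prod>j<n. x (p j) ^ g j))))"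
      unfolding expand[OF p] sum_distrib_left
      by (rule sum.cong[OF refl]) (rule ac)
  qed
  also have "\<dots> = (\<Prod>i<n. x i - x n) *
      (\<Sum>g\<in>PiE {..<n} S. (\<Prod>j<n. x n ^ (l j - 1 - g j)) * alternant n g x)"
    by (subst sum.swap) (simp add: alternant_Leibniz sum_distrib_left)
  \<comment> \<open>Writing the exponents as \<open>g = \<mu> + delta\<close> turns the range
    \<open>l (j + 1) \<le> g j < l j\<close> into
    \<open>m (j + 1) \<le> \<mu> j \<le> m j\<close>.\<close>
  also have "(\<Sum>g\<in>PiE {..<n} S. (\<Prod>j<n. x n ^ (l j - 1 - g j)) * alternant n g x) =
      (\<Sum>\<mu>\<in>interlacing n m. (\<Prod>j<n. x n ^ (m j - \<mu> j)) * alternant n (shift_exps n \<mu>) x)"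
  proof (rule sum.reindex_bij_witness[of _ "\<lambda>\<mu>. restrict (shift_exps n \<mu>) {..<n}"
        "\<lambda>g i. if i < n then g i - (n - 1 - i) else 0"], goal_cases)
    case (1 g)
    have *: "n - 1 - i \<le> g i" if "i < n" for i
      using PiE_mem[OF 1, of i] that by (auto simp: S_def l_def shift_exps_def)
    have "shift_exps n (\<lambda>i. if i < n then g i - (n - 1 - i) else 0) i = g i" if "i < n" for i
      using *[OF that] that unfolding shift_exps_def by simp
    then show ?case using 1 by (auto simp: PiE_def extensional_def restrict_def fun_eq_iff)
  next
    case (2 g)
    have "m (Suc i) \<le> g i - (n - 1 - i) \<and> g i - (n - 1 - i) \<le> m i" if "i < n" for i
      using PiE_mem[OF 2, of i] that by (auto simp: S_def l_def shift_exps_def)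
    then show ?case by (auto simp: interlacing_def)
  next
    case (3 \<mu>)
    then show ?case by (auto simp: shift_exps_def interlacing_def fun_eq_iff)
  next
    case (4 \<mu>)
    have "shift_exps n \<mu> i \<in> S i" if "i < n" for i
    proof -
      have "m (Suc i) \<le> \<mu> i" "\<mu> i \<le> m i" using 4 that by (auto simp: interlacing_def)
      then show ?thesis using that unfolding S_def l_def shift_exps_def atLeastLessThan_iff by arith
    qed
    then show ?case by simp
  next
    case (5 g)
    have *: "n - 1 - i \<le> g i" if "i < n" for i
      using PiE_mem[OF 5, of i] that by (auto simp: S_def l_def shift_exps_def)
    have "alternant n (shift_exps n (\<lambda>i. if i < n then g i - (n - 1 - i) else 0)) x = alternant n g x"
    proof (rule alternant_cong)
      fix i assume "i < n"
      with *[OF this] show "shift_exps n (\<lambda>i. if i < n then g i - (n - 1 - i) else 0) i = g i"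
        unfolding shift_exps_def by simp
    qed
    moreover have "l j - 1 - g j = m j - (g j - (n - 1 - j))" if "j < n" for j
      using *[OF that] that by (simp add: l_def shift_exps_def)
    ultimately show ?case by simp
  qed
  finally have det: "Determinant.det ?C = (\<Prod>i<n. x i - x n) *
      (\<Sum>\<mu>\<in>interlacing n m. (\<Prod>j<n. x n ^ (m j - \<mu> j)) * alternant n (shift_exps n \<mu>) x)" .
  \<comment> \<open>Row \<open>n\<close> of the strip has length \<open>m n = l n\<close>, since
    \<open>\<mu> n = 0\<close>; the factor \<open>x n ^ l n\<close> from the determinant supplies
    its weight.\<close>
  have "(\<Sum>\<mu>\<in>interlacing n m. (\<Prod>j<n. x n ^ (m j - \<mu> j)) * alternant n (shift_exps n \<mu>) x) * x n ^ l n =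
      (\<Sum>\<mu>\<in>interlacing n m.
      alternant n (shift_exps n \<mu>) x * x n ^ (\<Sum>i<Suc n. m i - \<mu> i))"
    unfolding sum_distrib_right
  proof (intro sum.cong refl)
    fix \<mu> assume "\<mu> \<in> interlacing n m"
    then have "l n = m n - \<mu> n" by (simp add: l_def shift_exps_def interlacing_def)
    then have "x n ^ (\<Sum>i<Suc n. m i - \<mu> i) = (\<Prod>j<n. x n ^ (m j - \<mu> j)) * x n ^ l n"
      by (simp add: power_add power_sum)
    then show "(\<Prod>j<n. x n ^ (m j - \<mu> j)) * alternant n (shift_exps n \<mu>) x * x n ^ l n =
        alternant n (shift_exps n \<mu>) x * x n ^ (\<Sum>i<Suc n. m i - \<mu> i)"
      by (simp only: mult_ac)
  qed
  note \<mu>_sum = this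
  have "alternant (Suc n) l x = x n ^ l n * Determinant.det ?C"
    using lS by (intro alternant_Suc_columns) (simp add: less_imp_le)
  also have "\<dots> = (\<Prod>i<n. x i - x n) * ((\<Sum>\<mu>\<in>interlacing n m.
      (\<Prod>j<n. x n ^ (m j - \<mu> j)) * alternant n (shift_exps n \<mu>) x) * x n ^ l n)"
    unfolding det by (rule mult.commute[THEN trans]) (rule mult.assoc)
  finally show ?thesis unfolding \<mu>_sum unfolding l_def .
qed

definition vandermonde :: "nat \<Rightarrow> (nat \<Rightarrow> real) \<Rightarrow> real" where
  "vandermonde n x = (\<Prod>j<n. \<Prod>i<j. x i - x j)"

lemma vandermonde_nonzero: "inj_on x {..<n} \<Longrightarrow> vandermonde n x \<noteq> 0"
  by (force simp: vandermonde_def inj_on_def)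

text \<open>Both sides obey the same branching recursion in the number of variables. Stated without
  division, the formula also holds at coinciding arguments.\<close>

lemma bialternant:
  "m \<in> shapes n \<Longrightarrow> tableau_sum m {..<n} x * vandermonde n x = alternant n (shift_exps n m) x"
proof (induction n arbitrary: m)
  case 0
  then have "m = (\<lambda>_. 0)" by (auto simp: shapes_def)
  then show ?case
    by (simp add: tableau_sum_def tableaux_def diagram_def vandermonde_def alternant_def)
next
  case (Suc n)
  have "tableau_sum m {..<Suc n} x * vandermonde (Suc n) x = (\<Prod>i<n. x i - x n) *
    (\<Sum>\<mu>\<in>interlacing n m. (tableau_sum \<mu> {..<n} x * vandermonde n x) * x n ^ (\<Sum>i<Suc n. m i - \<mu> i))"
    unfolding tableau_sum_Suc[OF Suc.prems]
    by (simp add: vandermonde_def sum_distrib_left sum_distrib_right algebra_simps del: sum.lessThan_Suc)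
  also have "\<dots> = (\<Prod>i<n. x i - x n) *
    (\<Sum>\<mu>\<in>interlacing n m. alternant n (shift_exps n \<mu>) x * x n ^ (\<Sum>i<Suc n. m i - \<mu> i))"
    using Suc.IH interlacing_shapes[OF Suc.prems] by simp
  finally show ?case using alternant_Suc[OF Suc.prems] by simp
qed

text \<open>The alternant and the Vandermonde product change by the same sign. Distinct arguments
  allow the Vandermonde product to be cancelled, which is enough for points of a
  configuration.\<close>

lemma tableau_sum_permute:
  assumes m: "m \<in> shapes n" and p: "p permutes {0..<n}" and x: "inj_on x {..<n}"
  shows "tableau_sum m {..<n} (x \<circ> p) = tableau_sum m {..<n} x"
proof -
  have v: "vandermonde n y = alternant n (shift_exps n (\<lambda>_. 0)) y" for y
    using bialternant[OF empty_shape, of n y] by (simp add: tableau_sum_empty_shape)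
  have "tableau_sum m {..<n} (x \<circ> p) * (signof p * vandermonde n x) =
      signof p * (tableau_sum m {..<n} x * vandermonde n x)"
    using bialternant[OF m, of "x \<circ> p"] bialternant[OF m, of x] by (simp add: v alternant_permute[OF p])
  then show ?thesis using vandermonde_nonzero[OF x] by (simp add: sign_def split: if_splits)
qed

section \<open>Multiplication by elementary symmetric polynomials\<close>

definition elem_sym :: "nat \<Rightarrow> nat \<Rightarrow> (nat \<Rightarrow> real) \<Rightarrow> real" where
  "elem_sym n r x = (\<Sum>I | I \<subseteq> {..<n} \<and> card I = r. \<Prod>i\<in>I. x i)"

definition add_cells :: "(nat \<Rightarrow> nat) \<Rightarrow> nat set \<Rightarrow> nat \<Rightarrow> nat" where
  "add_cells m I = (\<lambda>i. m i + (if i \<in> I then 1 else 0))"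

text \<open>In each Leibniz term \<open>elem_sym\<close> may be written in the permuted variables by
  symmetry. Multiplying by a product over \<open>I\<close> then raises the exponents of exactly the
  columns in \<open>I\<close>.\<close>

lemma alternant_elem_sym:
  "elem_sym n r x * alternant n l x = (\<Sum>I | I \<subseteq> {..<n} \<and> card I = r. alternant n (add_cells l I) x)"
proof -
  define \<I> where "\<I> = {I. I \<subseteq> {..<n} \<and> card I = r}"
  have "(\<Sum>I\<in>\<I>. \<Prod>i\<in>I. x i) * (\<Prod>j<n. x (p j) ^ l j) = (\<Sum>I\<in>\<I>. \<Prod>j<n. x (p j) ^ add_cells l I j)"
    if p: "p permutes {0..<n}" for p
  proof -
    have inj: "inj_on p I" for I using permutes_inj_on[OF p] .
    have im: "p ` {..<n} = {..<n}" using permutes_image[OF p] by (simp add: lessThan_atLeast0)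
    have p': "Hilbert_Choice.inv p permutes {0..<n}" using permutes_inv[OF p] .
    have im': "Hilbert_Choice.inv p ` {..<n} = {..<n}" using permutes_image[OF p'] by (simp add: lessThan_atLeast0)
    have "(\<Sum>I\<in>\<I>. \<Prod>i\<in>I. x i) = (\<Sum>I\<in>\<I>. \<Prod>i\<in>p ` I. x i)"
    proof (rule sum.reindex_bij_witness[of _ "(`) p" "(`) (Hilbert_Choice.inv p)"], goal_cases)
      case (1 I) then show ?case using permutes_surj[OF p] by (simp add: image_f_inv_f)
    next
      case (2 I)
      have "Hilbert_Choice.inv p ` I \<subseteq> {..<n}" using 2 im' by (auto simp: \<I>_def)
      moreover have "card (Hilbert_Choice.inv p ` I) = r" using 2 card_image[OF permutes_inj_on[OF p', of I]] by (simp add: \<I>_def)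
      ultimately show ?case by (simp add: \<I>_def)
    next
      case (3 I) then show ?case using permutes_inj[OF p] by (simp add: image_inv_f_f)
    next
      case (4 I)
      have "p ` I \<subseteq> {..<n}" using 4 im by (auto simp: \<I>_def)
      moreover have "card (p ` I) = r" using 4 card_image[OF inj[of I]] by (simp add: \<I>_def)
      ultimately show ?case by (simp add: \<I>_def)
    next
      case (5 I) then show ?case using permutes_surj[OF p] by (simp add: image_f_inv_f)
    qed
    also have "\<dots> = (\<Sum>I\<in>\<I>. \<Prod>j\<in>I. x (p j))" by (simp add: prod.reindex[OF inj])
    finally have "(\<Sum>I\<in>\<I>. \<Prod>i\<in>I. x i) = (\<Sum>I\<in>\<I>. \<Prod>j\<in>I. x (p j))" .
    moreover have "(\<Prod>j\<in>I. x (p j)) * (\<Prod>j<n. x (p j) ^ l j) = (\<Prod>j<n. x (p j) ^ add_cells l I j)"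
      if "I \<in> \<I>" for I
    proof -
      have "(\<Prod>j\<in>I. x (p j)) = (\<Prod>j<n. if j \<in> I then x (p j) else 1)"
        using that by (simp add: prod.If_cases \<I>_def Int_absorb1)
      then show ?thesis by (simp add: prod.distrib[symmetric] add_cells_def) (rule prod.cong, auto)
    qed
    ultimately show ?thesis by (simp add: sum_distrib_right)
  qed
  then have step: "(\<Sum>I\<in>\<I>. \<Prod>i\<in>I. x i) * (signof p * (\<Prod>j<n. x (p j) ^ l j)) =
      (\<Sum>I\<in>\<I>. signof p * (\<Prod>j<n. x (p j) ^ add_cells l I j))" if "p permutes {0..<n}" for p
    unfolding sum_distrib_left[symmetric] using that
    by (simp only: mult.left_commute[of "\<Sum>I\<in>\<I>. \<Prod>i\<in>I. x i"])
  have "elem_sym n r x * alternant n l x =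
      (\<Sum>p | p permutes {0..<n}. (\<Sum>I\<in>\<I>. \<Prod>i\<in>I. x i) * (signof p * (\<Prod>j<n. x (p j) ^ l j)))"
    unfolding elem_sym_def \<I>_def[symmetric] alternant_Leibniz by (rule sum_distrib_left)
  also have "\<dots> = (\<Sum>p | p permutes {0..<n}. \<Sum>I\<in>\<I>. signof p * (\<Prod>j<n. x (p j) ^ add_cells l I j))"
    by (intro sum.cong refl step) simp
  also have "\<dots> = (\<Sum>I\<in>\<I>. alternant n (add_cells l I) x)"
    unfolding alternant_Leibniz by (rule sum.swap)
  finally show ?thesis by (simp only: \<I>_def)
qed

definition vertical_strips :: "nat \<Rightarrow> nat \<Rightarrow> (nat \<Rightarrow> nat) \<Rightarrow> nat set set" where
  "vertical_strips n r m = {I. I \<subseteq> {..<n} \<and> card I = r \<and> add_cells m I \<in> shapes n}"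

text \<open>If adding the cells of \<open>I\<close> destroys monotonicity, then two equal rows
  \<open>i\<close>, \<open>i + 1\<close> exist of which only the lower one grows. The shifted
  exponents of these two columns coincide, so the alternant vanishes and only genuine shapes
  survive.\<close>

lemma pieri:
  assumes m: "m \<in> shapes n" and x: "inj_on x {..<n}"
  shows "elem_sym n r x * tableau_sum m {..<n} x =
    (\<Sum>I\<in>vertical_strips n r m. tableau_sum (add_cells m I) {..<n} x)"
proof -
  have shift: "add_cells (shift_exps n m) I = shift_exps n (add_cells m I)" for I
    by (auto simp: add_cells_def shift_exps_def)
  have zero: "alternant n (shift_exps n (add_cells m I)) x = 0"
    if I: "I \<subseteq> {..<n}" and bad: "add_cells m I \<notin> shapes n" for I
  proof -
    have "\<forall>i\<ge>n. add_cells m I i = 0" using I shapesD(2)[OF m] by (auto simp: add_cells_def)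
    with bad have "\<not> antimono (add_cells m I)" by (simp add: shapes_def)
    then obtain i where i: "add_cells m I i < add_cells m I (Suc i)"
      using lift_Suc_antimono_le[of "add_cells m I"] by (metis antimonoI not_le)
    have "m (Suc i) \<le> m i" using shapesD(1)[OF m] by simp
    with i have *: "m (Suc i) = m i" "Suc i \<in> I" "i \<notin> I" by (auto simp: add_cells_def split: if_splits)
    then have "Suc i < n" using I by auto
    then show ?thesis
      by (intro alternant_eq_0[of i n "Suc i"]) (use * in \<open>auto simp: shift_exps_def add_cells_def\<close>)
  qed
  have "elem_sym n r x * (tableau_sum m {..<n} x * vandermonde n x) =
      (\<Sum>I | I \<subseteq> {..<n} \<and> card I = r. alternant n (shift_exps n (add_cells m I)) x)"
    by (simp add: bialternant[OF m] alternant_elem_sym shift)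
  also have "\<dots> = (\<Sum>I\<in>vertical_strips n r m. alternant n (shift_exps n (add_cells m I)) x)"
    by (rule sum.mono_neutral_right) (auto simp: vertical_strips_def zero)
  also have "\<dots> = (\<Sum>I\<in>vertical_strips n r m. tableau_sum (add_cells m I) {..<n} x) * vandermonde n x"
    unfolding sum_distrib_right by (intro sum.cong refl) (simp add: bialternant vertical_strips_def)
  finally show ?thesis using vandermonde_nonzero[OF x] by simp
qed

text \<open>The crude bound by the number of all subsets suffices: the moment estimate needs a
  constant that does not depend on the shape.\<close>

lemma card_vertical_strips: "finite (vertical_strips n r m)" "card (vertical_strips n r m) \<le> 2 ^ n"
proof -
  have "vertical_strips n r m \<subseteq> Pow {..<n}" by (auto simp: vertical_strips_def)
  from finite_subset[OF this] card_mono[OF _ this]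
  show "finite (vertical_strips n r m)" "card (vertical_strips n r m) \<le> 2 ^ n"
    by (auto simp: card_Pow)
qed

lemma card_diagram_add_cells:
  assumes "m \<in> shapes n" "I \<in> vertical_strips n r m"
  shows "card (diagram (add_cells m I)) = card (diagram m) + r"
proof -
  have I: "I \<subseteq> {..<n}" "card I = r" "add_cells m I \<in> shapes n" using assms by (auto simp: vertical_strips_def)
  have "(\<Sum>i<n. if i \<in> I then 1 else 0) = r" using I by (simp add: sum.If_cases Int_absorb1)
  then show ?thesis using I assms(1) by (simp add: card_diagram add_cells_def sum.distrib)
qed

section \<open>Schur functions of infinite configurations\<close>

definition tableau_series :: "(nat \<Rightarrow> nat) \<Rightarrow> (nat \<Rightarrow> real) \<Rightarrow> real" where
  "tableau_series m x = (\<Sum>\<^sub>\<infinity>T\<in>tableaux (diagram m) UNIV. \<Prod>c\<in>diagram m. x (T c))"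

text \<open>Without the tableau conditions the sum over fillings factorizes over the cells, so
  absolute summability of \<open>x\<close> is all that is needed.\<close>

lemma fillings_summable:
  fixes x :: "nat \<Rightarrow> real"
  assumes "finite D" and x: "(\<lambda>i. \<bar>x i\<bar>) summable_on UNIV"
  shows "(\<lambda>T. \<bar>\<Prod>c\<in>D. x (T c)\<bar>) summable_on (D \<rightarrow>\<^sub>E B)"
proof -
  have "(\<lambda>i. \<bar>x i\<bar>) summable_on B" using summable_on_subset_banach[OF x] by simp
  then have "Infinite_Set_Sum.abs_summable_on x B"
    unfolding abs_summable_equivalent[symmetric] by simp
  then have "Infinite_Set_Sum.abs_summable_on (\<lambda>T. \<Prod>c\<in>D. x (T c)) (D \<rightarrow>\<^sub>E B)"
    by (intro abs_summable_on_prod_PiE assms) auto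
  then show ?thesis unfolding abs_summable_equivalent[symmetric] by simp
qed

lemma fillings_infsum:
  fixes x :: "nat \<Rightarrow> real"
  assumes "finite D" and x: "(\<lambda>i. \<bar>x i\<bar>) summable_on UNIV"
  shows "(\<Sum>\<^sub>\<infinity>T\<in>D \<rightarrow>\<^sub>E B. \<bar>\<Prod>c\<in>D. x (T c)\<bar>) = (\<Sum>\<^sub>\<infinity>i\<in>B. \<bar>x i\<bar>) ^ card D"
proof -
  have "(\<lambda>i. \<bar>x i\<bar>) summable_on B" using summable_on_subset_banach[OF x] by simp
  then show ?thesis unfolding abs_prod
    using infsum_prod_PiE_abs[of D "\<lambda>_ i. \<bar>x i\<bar>" "\<lambda>_. B"] assms(1) by simp
qed

text \<open>The error consists of the tableaux with some letter outside \<open>A\<close>. It is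
  dominated by all fillings with such a letter, and both totals of fillings are powers of sums of
  absolute values.\<close>

lemma tableau_series_diff_le:
  assumes D: "finite (diagram m)" and x: "(\<lambda>i. \<bar>x i\<bar>) summable_on UNIV" and A: "finite A"
  shows "\<bar>tableau_series m x - tableau_sum m A x\<bar>
    \<le> (\<Sum>\<^sub>\<infinity>i. \<bar>x i\<bar>) ^ card (diagram m) - (\<Sum>i\<in>A. \<bar>x i\<bar>) ^ card (diagram m)"
proof -
  define D where "D = diagram m"
  define w where "w T = (\<Prod>c\<in>D. x (T c))" for T
  have D': "finite D" using assms by (simp add: D_def)
  have sm: "(\<lambda>T. \<bar>w T\<bar>) summable_on D \<rightarrow>\<^sub>E UNIV"
    unfolding w_def by (rule fillings_summable[OF D' x])
  have sub: "tableaux D B \<subseteq> D \<rightarrow>\<^sub>E B" for B by (auto simp: tableaux_def)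
  have mono: "tableaux D A \<subseteq> tableaux D UNIV" by (auto simp: tableaux_def)
  have mono': "D \<rightarrow>\<^sub>E A \<subseteq> D \<rightarrow>\<^sub>E UNIV" by auto
  have diff: "tableaux D UNIV - tableaux D A \<subseteq> (D \<rightarrow>\<^sub>E UNIV) - (D \<rightarrow>\<^sub>E A)"
    by (auto simp: tableaux_def)
  have smw: "w summable_on B" if "B \<subseteq> D \<rightarrow>\<^sub>E UNIV" for B
    using summable_on_subset_banach[OF abs_summable_summable that, of w] sm by simp
  have smd: "(\<lambda>T. \<bar>w T\<bar>) summable_on B" if "B \<subseteq> D \<rightarrow>\<^sub>E UNIV" for B
    using summable_on_subset_banach[OF sm that] .
  have "tableau_series m x - tableau_sum m A x = infsum w (tableaux D UNIV) - infsum w (tableaux D A)"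
    unfolding tableau_series_def tableau_sum_def D_def[symmetric] w_def[symmetric]
    using finite_tableaux[OF D' A] by simp
  also have "\<dots> = infsum w (tableaux D UNIV - tableaux D A)"
    using mono sub[of UNIV] by (intro infsum_Diff[symmetric] smw) blast+
  finally have "\<bar>tableau_series m x - tableau_sum m A x\<bar> = \<bar>infsum w (tableaux D UNIV - tableaux D A)\<bar>"
    by simp
  also have "\<dots> \<le> (\<Sum>\<^sub>\<infinity>T\<in>tableaux D UNIV - tableaux D A. \<bar>w T\<bar>)"
    using norm_infsum_bound[of w "tableaux D UNIV - tableaux D A"] smd[of "tableaux D UNIV - tableaux D A"] sub[of UNIV]
    by auto
  also have "\<dots> \<le> (\<Sum>\<^sub>\<infinity>T\<in>(D \<rightarrow>\<^sub>E UNIV) - (D \<rightarrow>\<^sub>E A). \<bar>w T\<bar>)"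
    using sub[of UNIV] diff by (intro infsum_mono2 smd) auto
  also have "\<dots> = (\<Sum>\<^sub>\<infinity>T\<in>D \<rightarrow>\<^sub>E UNIV. \<bar>w T\<bar>) - (\<Sum>\<^sub>\<infinity>T\<in>D \<rightarrow>\<^sub>E A. \<bar>w T\<bar>)"
    by (intro infsum_Diff smd mono') (use mono' in auto)
  also have "\<dots> = (\<Sum>\<^sub>\<infinity>i. \<bar>x i\<bar>) ^ card D - (\<Sum>i\<in>A. \<bar>x i\<bar>) ^ card D"
    unfolding w_def fillings_infsum[OF D' x] using A by simp
  finally show ?thesis by (simp add: D_def)
qed

lemma tableau_series_abs_le:
  assumes "finite (diagram m)" and "(\<lambda>i. \<bar>x i\<bar>) summable_on UNIV"
  shows "\<bar>tableau_series m x\<bar> \<le> (\<Sum>\<^sub>\<infinity>i. \<bar>x i\<bar>) ^ card (diagram m)"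
proof (cases "diagram m = {}")
  case True
  then show ?thesis by (simp add: tableau_series_def tableaux_def)
next
  case False
  then have "tableaux (diagram m) {} = {}" by (auto simp: tableaux_def)
  then have "tableau_sum m {} x = 0" by (simp add: tableau_sum_def)
  moreover have "card (diagram m) > 0" using False assms(1) by (simp add: card_gt_0_iff)
  ultimately show ?thesis using tableau_series_diff_le[OF assms, of "{}"] by (simp add: zero_power)
qed

section \<open>Schur polynomials of finite sets of points\<close>

lemma tableau_sum_cong:
  "(\<And>i. i \<in> A \<Longrightarrow> x i = y i) \<Longrightarrow> tableau_sum m A x = tableau_sum m A y"
  unfolding tableau_sum_def by (intro sum.cong prod.cong refl) (auto simp: tableaux_def)

lemma mem_tableauxI:
  assumes "T \<in> D \<rightarrow>\<^sub>E A"
    and "\<And>i j. (i, Suc j) \<in> D \<Longrightarrow> T (i, j) \<le> T (i, Suc j)"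
    and "\<And>i j. (Suc i, j) \<in> D \<Longrightarrow> T (i, j) < T (Suc i, j)"
  shows "T \<in> tableaux D A"
  using assms by (simp add: tableaux_def)

lemma mem_tableauxD:
  assumes "T \<in> tableaux D A"
  shows "(i, Suc j) \<in> D \<Longrightarrow> T (i, j) \<le> T (i, Suc j)" "(Suc i, j) \<in> D \<Longrightarrow> T (i, j) < T (Suc i, j)"
  using assms by (auto simp: tableaux_def)

text \<open>The tableau conditions only compare letters, so an increasing relabelling of the
  alphabet preserves them.\<close>

lemma tableau_sum_image:
  assumes m: "m \<in> shapes K" and e: "strict_mono_on {..<n} e"
  shows "tableau_sum m (e ` {..<n}) x = tableau_sum m {..<n} (x \<circ> e)"
proof -
  define D where "D = diagram m"
  have inj: "inj_on e {..<n}" using e by (rule strict_mono_on_imp_inj_on)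
  have less: "e a < e b \<longleftrightarrow> a < b" if "a < n" "b < n" for a b
    using strict_mono_on_less[OF e] that by simp
  have le: "e a \<le> e b \<longleftrightarrow> a \<le> b" if "a < n" "b < n" for a b
    using strict_mono_on_less_eq[OF e] that by simp
  define i where "i = the_inv_into {..<n} e"
  have ie: "i (e a) = a" if "a < n" for a using inj that by (simp add: i_def the_inv_into_f_f)
  have ei: "e (i b) = b" "i b < n" if "b \<in> e ` {..<n}" for b using ie that by auto
  have down: "(j, k) \<in> D" if "(j, Suc k) \<in> D" for j k using that by (auto simp: D_def diagram_def)
  have down': "(j, k) \<in> D" if "(Suc j, k) \<in> D" for j k
    using that shapesD(1)[OF m, of j "Suc j"] by (auto simp: D_def diagram_def)
  have "tableau_sum m {..<n} (x \<circ> e) = (\<Sum>T\<in>tableaux D {..<n}. \<Prod>c\<in>D. x (e (T c)))"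
    by (simp add: tableau_sum_def D_def)
  also have "\<dots> = (\<Sum>T\<in>tableaux D (e ` {..<n}). \<Prod>c\<in>D. x (T c))"
  proof (rule sum.reindex_bij_witness[of _ "\<lambda>T. restrict (i \<circ> T) D" "\<lambda>T. restrict (e \<circ> T) D"], goal_cases)
    case (1 T)
    then show ?case using ie by (auto simp: tableaux_def fun_eq_iff restrict_def PiE_def extensional_def)
  next
    case (2 T)
    note T = 2
    have n: "T c < n" if "c \<in> D" for c using T that by (auto simp: tableaux_def)
    show ?case
    proof (rule mem_tableauxI, goal_cases)
      case (2 j k)
      then show ?case using mem_tableauxD(1)[OF T 2] le[OF n n] down by simp
    next
      case (3 j k)
      then show ?case using mem_tableauxD(2)[OF T 3] less[OF n n] down' by simp
    qed (use n in auto)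
  next
    case (3 T)
    then have "T c \<in> e ` {..<n}" if "c \<in> D" for c using that by (auto simp: tableaux_def)
    then show ?case using 3 ei by (auto simp: tableaux_def fun_eq_iff restrict_def PiE_def extensional_def)
  next
    case (4 T)
    note T = 4
    have n: "T c \<in> e ` {..<n}" if "c \<in> D" for c using T that by (auto simp: tableaux_def)
    have i_less: "i a < i b \<longleftrightarrow> a < b" and i_le: "i a \<le> i b \<longleftrightarrow> a \<le> b" if "a \<in> e ` {..<n}" "b \<in> e ` {..<n}" for a b
      using less le ei that by metis+
    show ?case
    proof (rule mem_tableauxI, goal_cases)
      case (2 j k)
      then show ?case using mem_tableauxD(1)[OF T 2] i_le[OF n n] down by simp
    next
      case (3 j k)
      then show ?case using mem_tableauxD(2)[OF T 3] i_less[OF n n] down' by simp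
    qed (use n ei in auto)
  next
    case (5 T)
    then show ?case by (intro prod.cong) auto
  qed
  also have "\<dots> = tableau_sum m (e ` {..<n}) x" by (simp add: tableau_sum_def D_def)
  finally show ?thesis by simp
qed

text \<open>Two enumerations of \<open>F\<close> differ by a permutation, and symmetry applies if
  the shape has at most \<open>n\<close> rows; with more rows both sides are zero. This is what
  makes a Schur polynomial a function of a set.\<close>

lemma tableau_sum_enumeration:
  assumes m: "m \<in> shapes K" and x: "bij_betw x {..<n} F" and y: "bij_betw y {..<n} F"
  shows "tableau_sum m {..<n} x = tableau_sum m {..<n} y"
proof (cases "m n = 0")
  case True
  have ms: "m \<in> shapes n"
    using m True by (auto simp: shapes_def antimono_def) (metis le_zero_eq)
  define p where "p i = (if i < n then the_inv_into {..<n} x (y i) else i)" for i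
  have b: "bij_betw (the_inv_into {..<n} x \<circ> y) {..<n} {..<n}"
    by (rule bij_betw_trans[OF y bij_betw_the_inv_into[OF x]])
  have "bij_betw p {0..<n} {0..<n}"
    using b by (subst bij_betw_cong[of _ _ "the_inv_into {..<n} x \<circ> y"]) (auto simp: p_def lessThan_atLeast0)
  then have p: "p permutes {0..<n}" by (rule bij_imp_permutes) (simp add: p_def)
  have "x (p i) = y i" if "i < n" for i
    using x y that by (auto simp: p_def bij_betw_def intro!: f_the_inv_into_f)
  then have "tableau_sum m {..<n} y = tableau_sum m {..<n} (x \<circ> p)"
    by (intro tableau_sum_cong) simp
  also have "\<dots> = tableau_sum m {..<n} x"
    by (rule tableau_sum_permute[OF ms p]) (use x in \<open>simp add: bij_betw_def\<close>)
  finally show ?thesis by simp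
next
  case False
  then show ?thesis using tableau_sum_eq_0[OF m] by simp
qed

definition finite_schur :: "(nat \<Rightarrow> nat) \<Rightarrow> real set \<Rightarrow> real" where
  "finite_schur m F = tableau_sum m {..<card F} (\<lambda>i. sorted_list_of_set F ! i)"

lemma bij_betw_sorted_list_of_set:
  "finite F \<Longrightarrow> bij_betw (\<lambda>i. sorted_list_of_set F ! i) {..<card F} F"
  by (rule bij_betw_nth) (auto simp: lessThan_atLeast0)

lemma finite_schur_eq:
  assumes m: "m \<in> shapes K" and "finite F" and x: "bij_betw x {..<n} F"
  shows "finite_schur m F = tableau_sum m {..<n} x"
proof -
  have n: "card F = n" using bij_betw_same_card[OF x] by simp
  show ?thesis unfolding finite_schur_def n
    using tableau_sum_enumeration[OF m _ x] bij_betw_sorted_list_of_set[OF assms(2)] n by simp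
qed

text \<open>Arbitrary finite index sets are allowed, because the indices at which an enumeration of
  a larger set visits \<open>F\<close> need not be consecutive.\<close>

lemma finite_schur_eq':
  assumes m: "m \<in> shapes K" and A: "finite A" and x: "bij_betw x A F"
  shows "finite_schur m F = tableau_sum m A x"
proof -
  define e where "e i = sorted_list_of_set A ! i" for i
  have len: "length (sorted_list_of_set A) = card A" by simp
  have e: "strict_mono_on {..<card A} e"
    using strict_sorted_list_of_set[of A] by (auto simp: e_def strict_mono_on_def sorted_wrt_iff_nth_less)
  have eA: "bij_betw e {..<card A} A"
    unfolding e_def by (rule bij_betw_nth) (use A in \<open>auto simp: lessThan_atLeast0\<close>)
  have "finite F" using bij_betw_finite[OF x] A by simp
  then have "finite_schur m F = tableau_sum m {..<card A} (x \<circ> e)"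
    using finite_schur_eq[OF m _ bij_betw_trans[OF eA x]] by simp
  also have "\<dots> = tableau_sum m A x"
    using tableau_sum_image[OF m e, of x] bij_betw_imp_surj_on[OF eA] by simp
  finally show ?thesis .
qed

section \<open>Passage to infinite sets of points\<close>

definition config_schur :: "(nat \<Rightarrow> nat) \<Rightarrow> real set \<Rightarrow> real" where
  "config_schur m X = tableau_series m (config_seq X)"

lemma bij_betw_config_seq:
  assumes "countable X"
  shows "bij_betw (config_seq X) {i. infinite X \<or> i < card X} X"
proof (cases "finite X")
  case True
  have "bij_betw (from_nat_into X) {..<card X} X" using bij_betw_from_nat_into_finite[OF True] .
  then have "bij_betw (config_seq X) {..<card X} X"
    by (subst bij_betw_cong[of _ _ "from_nat_into X"]) (auto simp: config_seq_def)
  then show ?thesis using True by (simp add: lessThan_def)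
next
  case False
  have "config_seq X = from_nat_into X" using False by (simp add: config_seq_def fun_eq_iff)
  then show ?thesis using bij_betw_from_nat_into[OF assms False] False by simp
qed

lemma config_seq_0: "\<not> (infinite X \<or> i < card X) \<Longrightarrow> config_seq X i = 0"
  by (auto simp: config_seq_def)

lemma config_seq_has_sum:
  assumes "countable X"
  shows "((\<lambda>i. \<bar>config_seq X i\<bar>) has_sum s) UNIV \<longleftrightarrow> ((\<lambda>x. \<bar>x\<bar>) has_sum s) X"
proof -
  have "((\<lambda>i. \<bar>config_seq X i\<bar>) has_sum s) UNIV \<longleftrightarrow>
      ((\<lambda>i. \<bar>config_seq X i\<bar>) has_sum s) {i. infinite X \<or> i < card X}"
    by (rule has_sum_cong_neutral) (auto simp: config_seq_0)
  also have "\<dots> \<longleftrightarrow> ((\<lambda>x. \<bar>x\<bar>) has_sum s) X"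
    by (rule has_sum_reindex_bij_betw[OF bij_betw_config_seq[OF assms]])
  finally show ?thesis .
qed

text \<open>The tableau estimate is applied to the indices whose values lie in \<open>F\<close>. The
  resulting bound no longer mentions the enumeration, only sums of absolute values.\<close>

lemma config_schur_diff_le:
  assumes m: "m \<in> shapes K" and X: "countable X" "(\<lambda>x. \<bar>x\<bar>) summable_on X" and F: "finite F" "F \<subseteq> X"
  shows "\<bar>config_schur m X - finite_schur m F\<bar>
    \<le> (\<Sum>\<^sub>\<infinity>x\<in>X. \<bar>x\<bar>) ^ card (diagram m) - (\<Sum>x\<in>F. \<bar>x\<bar>) ^ card (diagram m)"
proof -
  define J where "J = {i. infinite X \<or> i < card X}"
  define A where "A = {i \<in> J. config_seq X i \<in> F}"
  note b = bij_betw_config_seq[OF X(1), folded J_def]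
  have bA: "bij_betw (config_seq X) A F"
    using b F(2) by (auto simp: A_def bij_betw_def inj_on_def)
  have A: "finite A" using bij_betw_finite[OF bA] F(1) by simp
  have hs: "((\<lambda>i. \<bar>config_seq X i\<bar>) has_sum (\<Sum>\<^sub>\<infinity>x\<in>X. \<bar>x\<bar>)) UNIV"
    using config_seq_has_sum[OF X(1)] X(2) by (simp add: has_sum_infsum)
  have "(\<Sum>i\<in>A. \<bar>config_seq X i\<bar>) = (\<Sum>x\<in>F. \<bar>x\<bar>)"
    by (rule sum.reindex_bij_betw[OF bA])
  then show ?thesis
    using tableau_series_diff_le[OF finite_diagram[OF m] has_sum_imp_summable[OF hs] A]
      infsumI[OF hs] finite_schur_eq'[OF m A bA] by (simp add: config_schur_def)
qed

lemma config_schur_abs_le: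
  assumes m: "m \<in> shapes K" and X: "countable X" "(\<lambda>x. \<bar>x\<bar>) summable_on X"
  shows "\<bar>config_schur m X\<bar> \<le> (\<Sum>\<^sub>\<infinity>x\<in>X. \<bar>x\<bar>) ^ card (diagram m)"
proof -
  have hs: "((\<lambda>i. \<bar>config_seq X i\<bar>) has_sum (\<Sum>\<^sub>\<infinity>x\<in>X. \<bar>x\<bar>)) UNIV"
    using config_seq_has_sum[OF X(1)] X(2) by (simp add: has_sum_infsum)
  show ?thesis
    using tableau_series_abs_le[OF finite_diagram[OF m] has_sum_imp_summable[OF hs]] infsumI[OF hs]
    by (simp add: config_schur_def)
qed

text \<open>This describes the Schur function without an enumeration; identities for finite sets
  pass to infinite ones through this limit.\<close>

lemma finite_schur_tendsto:
  assumes m: "m \<in> shapes K" and X: "countable X" "(\<lambda>x. \<bar>x\<bar>) summable_on X"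
  shows "(finite_schur m \<longlongrightarrow> config_schur m X) (finite_subsets_at_top X)"
proof -
  define \<sigma> d where "\<sigma> = (\<Sum>\<^sub>\<infinity>x\<in>X. \<bar>x\<bar>)" and "d = card (diagram m)"
  have "((\<lambda>F. \<sigma> ^ d - (\<Sum>x\<in>F. \<bar>x\<bar>) ^ d) \<longlongrightarrow> \<sigma> ^ d - \<sigma> ^ d) (finite_subsets_at_top X)"
    unfolding \<sigma>_def by (intro tendsto_intros infsum_tendsto X)
  then have "((\<lambda>F. \<sigma> ^ d - (\<Sum>x\<in>F. \<bar>x\<bar>) ^ d) \<longlongrightarrow> 0) (finite_subsets_at_top X)" by simp
  then have "((\<lambda>F. config_schur m X - finite_schur m F) \<longlongrightarrow> 0) (finite_subsets_at_top X)"
    using config_schur_diff_le[OF m X]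
    by (elim Lim_null_comparison[rotated]) (auto simp: \<sigma>_def d_def intro!: eventually_finite_subsets_at_top_weakI)
  from tendsto_diff[OF tendsto_const[of "config_schur m X"] this] show ?thesis by simp
qed

section \<open>Complete homogeneous symmetric functions\<close>

definition one_row :: "nat \<Rightarrow> nat \<Rightarrow> nat" where
  "one_row n = (\<lambda>i. if i = 0 then n else 0)"

lemma one_row_shapes: "K \<ge> 1 \<Longrightarrow> one_row n \<in> shapes K"
  by (auto simp: one_row_def shapes_def antimono_def)

lemma one_row_0: "one_row 0 = (\<lambda>_. 0)"
  by (auto simp: one_row_def)

definition complete_sym :: "nat \<Rightarrow> nat \<Rightarrow> (nat \<Rightarrow> real) \<Rightarrow> real" where
  "complete_sym K n x = tableau_sum (one_row n) {..<K} x"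

lemma complete_sym_0 [simp]: "complete_sym K 0 x = 1"
  by (simp add: complete_sym_def tableau_sum_def one_row_0 diagram_0 tableaux_empty)

lemma complete_sym_no_vars [simp]: "complete_sym 0 (Suc n) x = 0"
  unfolding complete_sym_def by (rule tableau_sum_eq_0[OF one_row_shapes]) (auto simp: one_row_def)

lemma complete_sym_Suc_eq:
  "complete_sym (Suc K) n x = (\<Sum>j\<le>n. complete_sym K j x * x K ^ (n - j))"
proof (cases K)
  case 0
  have "interlacing 0 (one_row n) = {one_row 0}" by (auto simp: interlacing_def one_row_0)
  moreover have "(\<Sum>j\<le>n. complete_sym 0 j x * x 0 ^ (n - j)) =
      (\<Sum>j\<in>{0}. complete_sym 0 j x * x 0 ^ (n - j))"
    by (rule sum.mono_neutral_right) (auto simp: gr0_conv_Suc)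
  ultimately show ?thesis
    using tableau_sum_Suc[of "one_row n" 0 x] one_row_shapes[of 1 n] complete_sym_0[of 0 x] 0
    by (simp add: complete_sym_def one_row_def)
next
  case (Suc L)
  have il: "interlacing K (one_row n) = one_row ` {..n}"
  proof
    show "interlacing K (one_row n) \<subseteq> one_row ` {..n}"
    proof
      fix \<mu> assume mu: "\<mu> \<in> interlacing K (one_row n)"
      have "\<mu> i = 0" if "i > 0" for i using mu that by (cases "i < K") (auto simp: interlacing_def one_row_def)
      then have "\<mu> = one_row (\<mu> 0)" by (auto simp: one_row_def)
      moreover have "\<mu> 0 \<le> n" using mu Suc by (auto simp: interlacing_def one_row_def)
      ultimately show "\<mu> \<in> one_row ` {..n}" by blast
    qed
    show "one_row ` {..n} \<subseteq> interlacing K (one_row n)" using Suc by (auto simp: interlacing_def one_row_def)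
  qed
  have "inj one_row" by (auto simp: inj_def one_row_def fun_eq_iff)
  then have "inj_on one_row {..n}" by (rule inj_on_subset) simp
  moreover have "(\<Sum>i<Suc K. one_row n i - one_row j i) = n - j" for j
    by (subst sum.lessThan_Suc_shift) (simp add: one_row_def)
  ultimately show ?thesis
    unfolding complete_sym_def using tableau_sum_Suc[of "one_row n" K x] one_row_shapes[of "Suc K" n]
    by (simp add: il sum.reindex del: sum.lessThan_Suc)
qed

lemma complete_sym_Suc:
  "complete_sym (Suc K) (Suc n) x = complete_sym K (Suc n) x + x K * complete_sym (Suc K) n x"
proof -
  have "(\<Sum>j\<le>n. complete_sym K j x * x K ^ (Suc n - j)) = (\<Sum>j\<le>n. x K * (complete_sym K j x * x K ^ (n - j)))"
    by (intro sum.cong refl) (simp add: Suc_diff_le)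
  then show ?thesis by (simp add: complete_sym_Suc_eq sum_distrib_left)
qed

text \<open>The values are the q-binomial coefficients \<open>[n + K - 1 choose n]\<close>, and this
  is the ratio of two consecutive ones. The form without division covers \<open>K = 0\<close> as
  well.\<close>

lemma complete_sym_geometric_Suc:
  fixes q :: real
  shows "(1 - q ^ Suc n) * complete_sym K (Suc n) ((^) q) = (1 - q ^ (n + K)) * complete_sym K n ((^) q)"
proof (induction K arbitrary: n)
  case 0
  show ?case by (cases n) auto
next
  case (Suc K)
  note IHK = Suc.IH
  show ?case
  proof (induction n)
    case 0
    have "(1 - q ^ Suc 0) * complete_sym (Suc K) (Suc 0) ((^) q) =
        (1 - q ^ Suc 0) * complete_sym K (Suc 0) ((^) q) + (1 - q) * q ^ K"
      by (simp add: complete_sym_Suc distrib_left)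
    then show ?case using IHK[of 0] by (simp add: algebra_simps)
  next
    case (Suc n)
    define a b c where "a = complete_sym K (Suc n) ((^) q)" and "b = complete_sym (Suc K) (Suc n) ((^) q)"
      and "c = complete_sym (Suc K) n ((^) q)"
    have b: "b = a + q ^ K * c" by (simp add: a_def b_def c_def complete_sym_Suc)
    have IHn: "(1 - q ^ Suc n) * b = (1 - q ^ (n + Suc K)) * c" using Suc.IH by (simp add: b_def c_def)
    have "(1 - q ^ Suc (Suc n)) * complete_sym (Suc K) (Suc (Suc n)) ((^) q) =
        (1 - q ^ Suc (Suc n)) * complete_sym K (Suc (Suc n)) ((^) q) + (1 - q ^ Suc (Suc n)) * q ^ K * b"
      by (simp add: complete_sym_Suc[of K "Suc n"] b_def distrib_left)
    also have "\<dots> = (1 - q ^ (Suc n + K)) * a + (1 - q ^ Suc (Suc n)) * q ^ K * b"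
      using IHK[of "Suc n"] by (simp add: a_def)
    also have "(1 - q ^ (Suc n + K)) * a = (1 - q ^ (Suc n + K)) * b - q ^ K * ((1 - q ^ (n + Suc K)) * c)"
      by (simp add: b algebra_simps)
    also have "\<dots> = (1 - q ^ (Suc n + K)) * b - q ^ K * ((1 - q ^ Suc n) * b)"
      by (simp only: IHn)
    finally show ?case by (simp add: b_def algebra_simps power_add)
  qed
qed

lemma tableau_sum_tendsto:
  assumes m: "m \<in> shapes K" and x: "(\<lambda>i. \<bar>x i\<bar>) summable_on UNIV"
  shows "(\<lambda>N. tableau_sum m {..<N} x) \<longlonglongrightarrow> tableau_series m x"
proof -
  define \<sigma> d where "\<sigma> = (\<Sum>\<^sub>\<infinity>i. \<bar>x i\<bar>)" and "d = card (diagram m)"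
  have "(\<lambda>N. \<Sum>i<N. \<bar>x i\<bar>) \<longlonglongrightarrow> \<sigma>"
    using has_sum_imp_sums[OF has_sum_infsum[OF x]] by (simp add: sums_def \<sigma>_def)
  then have "(\<lambda>N. \<sigma> ^ d - (\<Sum>i<N. \<bar>x i\<bar>) ^ d) \<longlonglongrightarrow> \<sigma> ^ d - \<sigma> ^ d" by (intro tendsto_intros)
  then have "(\<lambda>N. \<sigma> ^ d - (\<Sum>i<N. \<bar>x i\<bar>) ^ d) \<longlonglongrightarrow> 0" by simp
  then have "(\<lambda>N. tableau_series m x - tableau_sum m {..<N} x) \<longlonglongrightarrow> 0"
    using tableau_series_diff_le[OF finite_diagram[OF m] x]
    by (elim Lim_null_comparison[rotated]) (auto simp: \<sigma>_def d_def)
  from tendsto_diff[OF tendsto_const[of "tableau_series m x"] this] show ?thesis by simp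
qed

lemma geometric_summable_on: "0 < q \<Longrightarrow> q < (1::real) \<Longrightarrow> (\<lambda>i. \<bar>q ^ i\<bar>) summable_on UNIV"
  by (intro summable_nonneg_imp_summable_on) (auto intro: summable_geometric)

text \<open>The limit of the previous identity for infinitely many variables, in which
  \<open>q ^ (n + N)\<close> disappears.\<close>

lemma row_series_geometric_Suc:
  assumes q: "0 < q" "q < 1"
  shows "(1 - q ^ Suc n) * tableau_series (one_row (Suc n)) ((^) q) = tableau_series (one_row n) ((^) q)"
proof -
  have t: "(\<lambda>N. complete_sym N k ((^) q)) \<longlonglongrightarrow> tableau_series (one_row k) ((^) q)" for k
    unfolding complete_sym_def by (rule tableau_sum_tendsto[OF one_row_shapes[of 1] geometric_summable_on[OF q]]) simp
  have "(\<lambda>N. q ^ n * q ^ N) \<longlonglongrightarrow> q ^ n * 0"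
    by (intro tendsto_intros LIMSEQ_realpow_zero) (use q in auto)
  then have "(\<lambda>N. (1 - q ^ (n + N)) * complete_sym N n ((^) q)) \<longlonglongrightarrow> (1 - 0) * tableau_series (one_row n) ((^) q)"
    by (intro tendsto_intros t) (simp add: power_add)
  moreover have "(\<lambda>N. (1 - q ^ Suc n) * complete_sym N (Suc n) ((^) q)) \<longlonglongrightarrow>
      (1 - q ^ Suc n) * tableau_series (one_row (Suc n)) ((^) q)"
    by (intro tendsto_intros t)
  ultimately show ?thesis
    unfolding complete_sym_geometric_Suc by (simp add: LIMSEQ_unique)
qed

text \<open>For finite sets this is the recursion that splits off the last variable; the limit is
  then taken along finite subsets containing \<open>a\<close>, where \<open>F - {a}\<close> runs
  through the finite subsets of \<open>X - {a}\<close>.\<close>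

lemma config_schur_row_remove:
  assumes X: "countable X" "(\<lambda>x. \<bar>x\<bar>) summable_on X" and a: "a \<in> X"
  shows "config_schur (one_row (Suc n)) X = config_schur (one_row (Suc n)) (X - {a}) + a * config_schur (one_row n) X"
proof -
  have rs: "one_row k \<in> shapes 1" for k by (simp add: one_row_shapes)
  have fin: "finite_schur (one_row (Suc n)) F = finite_schur (one_row (Suc n)) (F - {a}) + a * finite_schur (one_row n) F"
    if F: "finite F" "a \<in> F" for F
  proof -
    obtain y where y: "bij_betw y {..<card (F - {a})} (F - {a})"
      using bij_betw_sorted_list_of_set[of "F - {a}"] F by auto
    define N where "N = card (F - {a})"
    \<comment> \<open>The point \<open>a\<close> is listed last, since
      \<open>complete_sym_Suc\<close> splits off the last variable.\<close>
    define x where "x = y(N := a)"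
    have x1: "bij_betw x {..<N} (F - {a})"
      using y by (subst bij_betw_cong[of _ _ y]) (auto simp: N_def x_def)
    have x2: "bij_betw x {..<Suc N} F"
    proof -
      have "bij_betw x ({..<N} \<union> {N}) ((F - {a}) \<union> {a})"
        by (rule bij_betw_combine[OF x1]) (auto simp: x_def bij_betw_def)
      moreover have "{..<N} \<union> {N} = {..<Suc N}" by auto
      moreover have "(F - {a}) \<union> {a} = F" using F by auto
      ultimately show ?thesis by simp
    qed
    show ?thesis
      using complete_sym_Suc[of N n x] finite_schur_eq[OF rs _ x1] finite_schur_eq[OF rs _ x2] F(1)
      by (simp add: complete_sym_def x_def)
  qed
  have X': "countable (X - {a})" "(\<lambda>x. \<bar>x\<bar>) summable_on (X - {a})"
    using X summable_on_subset_banach[OF X(2), of "X - {a}"] by auto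
  have ev: "eventually (\<lambda>F. finite F \<and> F \<subseteq> X \<and> a \<in> F) (finite_subsets_at_top X)"
    unfolding eventually_finite_subsets_at_top by (rule exI[of _ "{a}"]) (use a in auto)
  have fl: "filterlim (\<lambda>F. F - {a}) (finite_subsets_at_top (X - {a})) (finite_subsets_at_top X)"
    unfolding filterlim_finite_subsets_at_top
  proof (intro allI impI)
    fix G assume G: "finite G \<and> G \<subseteq> X - {a}"
    show "eventually (\<lambda>F. finite (F - {a}) \<and> G \<subseteq> F - {a} \<and> F - {a} \<subseteq> X - {a}) (finite_subsets_at_top X)"
      unfolding eventually_finite_subsets_at_top by (rule exI[of _ G]) (use G in auto)
  qed
  have "((\<lambda>F. finite_schur (one_row (Suc n)) (F - {a}) + a * finite_schur (one_row n) F) \<longlongrightarrow>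
      config_schur (one_row (Suc n)) (X - {a}) + a * config_schur (one_row n) X) (finite_subsets_at_top X)"
    by (intro tendsto_intros finite_schur_tendsto[OF rs X]
        filterlim_compose[OF finite_schur_tendsto[OF rs X'] fl])
  then have "(finite_schur (one_row (Suc n)) \<longlongrightarrow>
      config_schur (one_row (Suc n)) (X - {a}) + a * config_schur (one_row n) X) (finite_subsets_at_top X)"
    by (rule Lim_transform_eventually) (use ev in \<open>eventually_elim, simp add: fin\<close>)
  with finite_schur_tendsto[OF rs X, of "Suc n"] show ?thesis
    by (rule tendsto_unique[rotated]) simp
qed

section \<open>Configurations on the lattice and links\<close>

definition bounded_lattice :: "real \<Rightarrow> real \<Rightarrow> real \<Rightarrow> real \<Rightarrow> real set" where
  "bounded_lattice q zp zm R = {x \<in> qlattice q zp zm. \<bar>x\<bar> \<le> R}"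

lemma eps_close_bounded:
  assumes "Y \<in> inf_configs q zp zm" "X \<subseteq> bounded_lattice q zp zm R" "eps_close \<epsilon> X Y" "\<epsilon> \<le> R"
  shows "Y \<subseteq> bounded_lattice q zp zm R"
proof
  fix y assume y: "y \<in> Y"
  have "\<bar>y\<bar> \<le> R"
  proof (cases "y \<in> {-\<epsilon><..<\<epsilon>}")
    case True
    then show ?thesis using assms(4) by auto
  next
    case False
    then have "y \<in> X" using y assms(3) unfolding eps_close_def by blast
    then show ?thesis using assms(2) by (auto simp: bounded_lattice_def)
  qed
  then show "y \<in> bounded_lattice q zp zm R" using y assms(1) by (auto simp: inf_configs_def bounded_lattice_def)
qed

lemma geometric_progression_summable:
  fixes q z R :: real
  assumes q: "0 < q" "q < 1" and z: "z \<noteq> 0"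
  shows "(\<lambda>x. \<bar>x\<bar>) summable_on {x \<in> range (\<lambda>n::int. z * q powi n). \<bar>x\<bar> \<le> R}"
proof -
  \<comment> \<open>With this \<open>k\<close> every index below \<open>- int k\<close> gives a
    point of absolute value greater than \<open>R\<close>; what remains is covered by the geometric
    sequence \<open>g\<close>.\<close>
  obtain k where k: "R / \<bar>z\<bar> < (1 / q) ^ k" using real_arch_pow[of "1 / q"] q by auto
  define g where "g i = z * q powi (- int k) * q ^ i" for i :: nat
  have "inj g" using q z by (auto simp: inj_def g_def power_inject_exp')
  have "(\<lambda>i. \<bar>g i\<bar>) = (\<lambda>i. \<bar>z * q powi (- int k)\<bar> * q ^ i)"
    using q by (simp add: g_def abs_mult)
  then have "(\<lambda>i. \<bar>g i\<bar>) summable_on UNIV"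
    using q by (intro summable_nonneg_imp_summable_on) (auto intro!: summable_mult summable_geometric)
  then have "(\<lambda>x. \<bar>x\<bar>) summable_on range g"
    using summable_on_reindex[OF \<open>inj g\<close>, of "\<lambda>x. \<bar>x\<bar>"] by (simp add: o_def)
  moreover have "{x \<in> range (\<lambda>n::int. z * q powi n). \<bar>x\<bar> \<le> R} \<subseteq> range g"
  proof safe
    fix n :: int assume n: "\<bar>z * q powi n\<bar> \<le> R"
    have "- int k \<le> n"
    proof (rule ccontr)
      assume "\<not> - int k \<le> n"
      then have "q powi (- int k) \<le> q powi n" using q by (intro power_int_decreasing) auto
      then have "\<bar>z\<bar> * q powi (- int k) \<le> R" using n q by (simp add: abs_mult) (meson abs_ge_zero mult_left_mono order_trans)
      moreover have "q powi (- int k) = (1 / q) ^ k" by (simp add: power_int_minus power_one_over inverse_eq_divide)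
      ultimately show False using k z by (simp add: field_simps)
    qed
    then obtain i where "n = - int k + int i" by (metis add.commute diff_add_cancel diff_ge_0_iff_ge nonneg_int_cases diff_minus_eq_add)
    then have "q powi n = q powi (- int k) * q ^ i"
      using q power_int_add[of q "- int k" "int i"] by simp
    then have "z * q powi n = g i" by (simp add: g_def)
    then show "z * q powi n \<in> range g" by simp
  qed
  ultimately show ?thesis by (rule summable_on_subset_banach)
qed

context
  fixes q zp zm :: real
  assumes q: "0 < q" "q < 1" and zp: "zp > 0" and zm: "zm < 0"
begin

lemma zero_notin_qlattice: "0 \<notin> qlattice q zp zm"
  using q zp zm by (auto simp: qlattice_def)

lemma bounded_lattice_summable: "(\<lambda>x. \<bar>x\<bar>) summable_on bounded_lattice q zp zm R"
proof -
  have "bounded_lattice q zp zm R =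
      {x \<in> range (\<lambda>n::int. zp * q powi n). \<bar>x\<bar> \<le> R} \<union> {x \<in> range (\<lambda>n::int. zm * q powi n). \<bar>x\<bar> \<le> R}"
    by (auto simp: bounded_lattice_def qlattice_def)
  then show ?thesis
    using geometric_progression_summable[OF q, of zp R] geometric_progression_summable[OF q, of zm R] zp zm
    by (auto intro!: summable_on_union)
qed

lemma countable_qlattice: "countable (qlattice q zp zm)"
  by (simp add: qlattice_def)

text \<open>Arbitrarily many points of absolute value at least \<open>\<epsilon>\<close> would
  exceed the finite sum of all absolute values.\<close>

lemma finite_bounded_lattice_outer:
  assumes "\<epsilon> > 0"
  shows "finite {x \<in> bounded_lattice q zp zm R. \<epsilon> \<le> \<bar>x\<bar>}"
proof (rule ccontr)
  let ?S = "{x \<in> bounded_lattice q zp zm R. \<epsilon> \<le> \<bar>x\<bar>}"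
  assume inf: "infinite ?S"
  define s where "s = (\<Sum>\<^sub>\<infinity>x\<in>bounded_lattice q zp zm R. \<bar>x\<bar>)"
  obtain n where n: "s / \<epsilon> < real n" using reals_Archimedean2 by blast
  obtain T where T: "finite T" "card T = n" "T \<subseteq> ?S" using infinite_arbitrarily_large[OF inf] by blast
  have "real n * \<epsilon> = (\<Sum>x\<in>T. \<epsilon>)" using T by simp
  also have "\<dots> \<le> (\<Sum>x\<in>T. \<bar>x\<bar>)" using T(3) by (intro sum_mono) auto
  also have "\<dots> \<le> s" unfolding s_def using T by (intro finite_sum_le_infsum bounded_lattice_summable) auto
  finally show False using n assms by (simp add: field_simps)
qed

lemma bounded_lattice_tail:
  assumes "\<delta> > 0"
  obtains \<epsilon> where "0 < \<epsilon>" "\<epsilon> \<le> 1" "(\<Sum>\<^sub>\<infinity>x\<in>{x \<in> bounded_lattice q zp zm R. \<bar>x\<bar> < \<epsilon>}. \<bar>x\<bar>) < \<delta>"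
proof -
  let ?L = "bounded_lattice q zp zm R"
  have "((\<lambda>F. \<Sum>x\<in>F. \<bar>x\<bar>) \<longlongrightarrow> (\<Sum>\<^sub>\<infinity>x\<in>?L. \<bar>x\<bar>)) (finite_subsets_at_top ?L)"
    by (rule infsum_tendsto[OF bounded_lattice_summable])
  then have "eventually (\<lambda>F. (\<Sum>\<^sub>\<infinity>x\<in>?L. \<bar>x\<bar>) - \<delta> < (\<Sum>x\<in>F. \<bar>x\<bar>)) (finite_subsets_at_top ?L)"
    by (rule order_tendstoD) (use assms in simp)
  then obtain F where F: "finite F" "F \<subseteq> ?L" "(\<Sum>\<^sub>\<infinity>x\<in>?L. \<bar>x\<bar>) - \<delta> < (\<Sum>x\<in>F. \<bar>x\<bar>)"
    unfolding eventually_finite_subsets_at_top by blast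
  \<comment> \<open>\<open>F\<close> carries all but \<open>\<delta>\<close> of the total sum, and
    points closer to zero than every point of \<open>F\<close> lie outside \<open>F\<close>. The
    element 1 bounds the result and covers empty \<open>F\<close>.\<close>
  define \<epsilon> where "\<epsilon> = Min (insert 1 (abs ` F))"
  have F0: "x \<noteq> 0" if "x \<in> F" for x using that F(2) zero_notin_qlattice by (auto simp: bounded_lattice_def)
  have "0 < \<epsilon>" using F(1) F0 by (auto simp: \<epsilon>_def)
  moreover have "\<epsilon> \<le> 1" using F(1) by (simp add: \<epsilon>_def)
  moreover have "(\<Sum>\<^sub>\<infinity>x\<in>{x \<in> ?L. \<bar>x\<bar> < \<epsilon>}. \<bar>x\<bar>) < \<delta>"
  proof -
    have "\<epsilon> \<le> \<bar>x\<bar>" if "x \<in> F" for x using F(1) that by (simp add: \<epsilon>_def)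
    then have sub: "{x \<in> ?L. \<bar>x\<bar> < \<epsilon>} \<subseteq> ?L - F" by force
    have "(\<Sum>\<^sub>\<infinity>x\<in>{x \<in> ?L. \<bar>x\<bar> < \<epsilon>}. \<bar>x\<bar>) \<le> (\<Sum>\<^sub>\<infinity>x\<in>?L - F. \<bar>x\<bar>)"
      by (intro infsum_mono2 summable_on_subset_banach[OF bounded_lattice_summable[of R]] sub) auto
    also have "\<dots> = (\<Sum>\<^sub>\<infinity>x\<in>?L. \<bar>x\<bar>) - (\<Sum>x\<in>F. \<bar>x\<bar>)"
      using F by (subst infsum_Diff) (auto intro: bounded_lattice_summable)
    finally show ?thesis using F(3) by simp
  qed
  ultimately show thesis by (rule that)
qed

lemma inf_configs_bounded:
  assumes "X \<in> inf_configs q zp zm"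
  obtains R where "R \<ge> 1" "X \<subseteq> bounded_lattice q zp zm R"
proof -
  obtain R where "\<forall>x\<in>X. \<bar>x\<bar> \<le> R" using assms by (auto simp: inf_configs_def bounded_iff)
  then have "X \<subseteq> bounded_lattice q zp zm (max R 1)"
    using assms by (auto simp: inf_configs_def bounded_lattice_def)
  then show thesis by (rule that[rotated]) simp
qed

lemma bounded_lattice_configs: "X \<subseteq> bounded_lattice q zp zm R \<Longrightarrow> X \<in> inf_configs q zp zm"
  by (auto simp: inf_configs_def bounded_lattice_def bounded_iff)

lemma config_summable:
  "X \<subseteq> bounded_lattice q zp zm R \<Longrightarrow> countable X"
  "X \<subseteq> bounded_lattice q zp zm R \<Longrightarrow> (\<lambda>x. \<bar>x\<bar>) summable_on X"
proof -
  assume X: "X \<subseteq> bounded_lattice q zp zm R"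
  then have "X \<subseteq> qlattice q zp zm" by (auto simp: bounded_lattice_def)
  then show "countable X" using countable_qlattice by (rule countable_subset)
  show "(\<lambda>x. \<bar>x\<bar>) summable_on X" by (rule summable_on_subset_banach[OF bounded_lattice_summable X])
qed

lemma power_diff_le:
  fixes a b \<sigma> :: real
  assumes "0 \<le> b" "b \<le> a" "a \<le> \<sigma>" "1 \<le> \<sigma>"
  shows "a ^ d - b ^ d \<le> real d * \<sigma> ^ d * (a - b)"
proof (induction d)
  case (Suc d)
  have "a ^ Suc d - b ^ Suc d = a * (a ^ d - b ^ d) + b ^ d * (a - b)" by (simp add: algebra_simps)
  also have "\<dots> \<le> \<sigma> * (real d * \<sigma> ^ d * (a - b)) + \<sigma> ^ Suc d * (a - b)"
  proof (intro add_mono mult_mono mult_right_mono Suc)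
    have "b ^ d \<le> \<sigma> ^ d" using assms by (intro power_mono) auto
    also have "\<dots> \<le> \<sigma> ^ Suc d" using assms by (intro power_increasing) auto
    finally show "b ^ d \<le> \<sigma> ^ Suc d" .
  qed (use assms in \<open>auto intro: power_mono\<close>)
  finally show ?case by (simp add: algebra_simps)
qed simp

text \<open>Close configurations share the same finite part away from zero. Each is compared with
  this part, and the error is controlled by the total of all small lattice points, uniformly over
  the subsets of \<open>[-R, R]\<close>.\<close>

lemma config_schur_continuous:
  assumes m: "m \<in> shapes K" and X: "X \<in> inf_configs q zp zm" and "\<eta> > 0"
  shows "\<exists>\<epsilon>>0. \<forall>Y\<in>inf_configs q zp zm. eps_close \<epsilon> X Y \<longrightarrow> \<bar>config_schur m X - config_schur m Y\<bar> < \<eta>"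
proof -
  obtain R where R: "R \<ge> 1" "X \<subseteq> bounded_lattice q zp zm R" using inf_configs_bounded[OF X] .
  let ?L = "bounded_lattice q zp zm R"
  define \<sigma> d where "\<sigma> = max 1 (\<Sum>\<^sub>\<infinity>x\<in>?L. \<bar>x\<bar>)" and "d = card (diagram m)"
  \<comment> \<open>A Lipschitz constant for the \<open>d\<close>-th power on
    \<open>[0, \<sigma>]\<close>, increased by 1 to be positive even for
    \<open>d = 0\<close>.\<close>
  define C where "C = real d * \<sigma> ^ d + 1"
  have C: "C > 0" by (auto simp: C_def \<sigma>_def intro!: add_nonneg_pos)
  obtain \<epsilon> where \<epsilon>: "0 < \<epsilon>" "\<epsilon> \<le> 1" "(\<Sum>\<^sub>\<infinity>x\<in>{x \<in> ?L. \<bar>x\<bar> < \<epsilon>}. \<bar>x\<bar>) < \<eta> / (2 * C)"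
    using bounded_lattice_tail[of "\<eta> / (2 * C)" R] C assms(3) by auto
  define \<tau> where "\<tau> = (\<Sum>\<^sub>\<infinity>x\<in>{x \<in> ?L. \<bar>x\<bar> < \<epsilon>}. \<bar>x\<bar>)"
  have \<tau>: "0 \<le> \<tau>" "\<tau> < \<eta> / (2 * C)" using \<epsilon> by (auto simp: \<tau>_def intro: infsum_nonneg)
  have main: "\<bar>config_schur m Z - finite_schur m (Z - {-\<epsilon><..<\<epsilon>})\<bar> < \<eta> / 2" if Z: "Z \<subseteq> ?L" for Z
  proof -
    define F where "F = Z - {-\<epsilon><..<\<epsilon>}"
    have fin: "finite F"
      by (rule finite_subset[OF _ finite_bounded_lattice_outer[OF \<epsilon>(1), of R]]) (use Z in \<open>auto simp: F_def\<close>)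
    have FZ: "F \<subseteq> Z" by (auto simp: F_def)
    define a b where "a = (\<Sum>\<^sub>\<infinity>x\<in>Z. \<bar>x\<bar>)" and "b = (\<Sum>x\<in>F. \<bar>x\<bar>)"
    have sZ: "(\<lambda>x. \<bar>x\<bar>) summable_on Z" by (rule config_summable(2)[OF Z])
    have "a - b = (\<Sum>\<^sub>\<infinity>x\<in>Z - F. \<bar>x\<bar>)"
      using fin FZ sZ by (subst infsum_Diff) (auto simp: a_def b_def)
    also have "\<dots> \<le> \<tau>"
      unfolding \<tau>_def
      by (intro infsum_mono2 summable_on_subset_banach[OF bounded_lattice_summable[of R]])
        (use Z in \<open>auto simp: F_def\<close>)
    finally have ab: "a - b \<le> \<tau>" .
    have "a \<le> (\<Sum>\<^sub>\<infinity>x\<in>?L. \<bar>x\<bar>)" unfolding a_def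
      by (intro infsum_mono2 sZ bounded_lattice_summable Z) auto
    then have a: "a \<le> \<sigma>" by (simp add: \<sigma>_def)
    have ba: "b \<le> a" unfolding a_def b_def using fin FZ sZ by (intro finite_sum_le_infsum) auto
    have b: "0 \<le> b" by (auto simp: b_def intro: sum_nonneg)
    have "\<bar>config_schur m Z - finite_schur m F\<bar> \<le> a ^ d - b ^ d"
      unfolding a_def b_def d_def by (rule config_schur_diff_le[OF m config_summable[OF Z] fin FZ])
    also have "\<dots> \<le> real d * \<sigma> ^ d * (a - b)" by (rule power_diff_le[OF b ba a]) (simp add: \<sigma>_def)
    also have "\<dots> \<le> C * \<tau>" using ab ba by (intro mult_mono) (auto simp: C_def \<sigma>_def)
    also have "\<dots> < \<eta> / 2" using \<tau>(2) C by (simp add: field_simps)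
    finally show ?thesis unfolding F_def .
  qed
  show ?thesis
  proof (intro exI[of _ \<epsilon>] conjI ballI impI \<epsilon>(1))
    fix Y assume Y: "Y \<in> inf_configs q zp zm" and cl: "eps_close \<epsilon> X Y"
    \<comment> \<open>Since \<open>\<epsilon> \<le> 1 \<le> R\<close>, the points in which
      \<open>Y\<close> may differ from \<open>X\<close> also lie in \<open>[-R, R]\<close>.\<close>
    have YL: "Y \<subseteq> ?L" by (rule eps_close_bounded[OF Y R(2) cl]) (use \<epsilon>(2) R(1) in simp)
    have "X - {-\<epsilon><..<\<epsilon>} = Y - {-\<epsilon><..<\<epsilon>}" using cl by (simp add: eps_close_def)
    with main[OF R(2)]
    have "\<bar>config_schur m X - finite_schur m (Y - {-\<epsilon><..<\<epsilon>})\<bar> < \<eta> / 2" by simp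
    with main[OF YL] show "\<bar>config_schur m X - config_schur m Y\<bar> < \<eta>" by linarith
  qed
qed

end

section \<open>Partitions as shapes, and expectations under a link measure\<close>

lemma shape_partition:
  assumes m: "m \<in> shapes K"
  obtains \<nu> where "is_partition \<nu>" "length \<nu> \<le> K" "cells \<nu> = diagram m"
proof -
  define n where "n = (LEAST i. m i = 0)"
  have "m K = 0" using shapesD(2)[OF m] by simp
  then have n: "m n = 0" "n \<le> K" unfolding n_def by (auto intro: LeastI Least_le)
  have pos: "m i > 0" if "i < n" for i using not_less_Least[of i "\<lambda>i. m i = 0"] that by (auto simp: n_def)
  have zero: "m i = 0" if "n \<le> i" for i using shapesD(1)[OF m that] n(1) by simp
  define \<nu> where "\<nu> = map m [0..<n]"
  have "is_partition \<nu>"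
    using shapesD(1)[OF m] pos by (force simp: is_partition_def \<nu>_def sorted_wrt_iff_nth_less)
  moreover have "cells \<nu> = diagram m"
  proof -
    have "a < n" if "b < m a" for a b using zero[of a] that by (cases "a < n") auto
    then show ?thesis by (auto simp: cells_def \<nu>_def diagram_def)
  qed
  ultimately show thesis using n(2) that[of \<nu>] by (simp add: \<nu>_def)
qed

lemma ssyt_eq_tableaux: "ssyt \<nu> A = tableaux (cells \<nu>) A"
  by (simp add: ssyt_def tableaux_def)

text \<open>The tableau with every letter of row \<open>i\<close> equal to \<open>i\<close> is a
  positive term.\<close>

lemma tableau_sum_pos:
  assumes m: "m \<in> shapes K" and x: "\<And>i. x i > 0"
  shows "tableau_sum m {..<K} x > 0"
proof -
  define T where "T = restrict fst (diagram m)"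
  have "fst c < K" if "c \<in> diagram m" for c using that by (auto simp: diagram_eq_Sigma[OF m])
  then have "T \<in> tableaux (diagram m) {..<K}"
    using shapesD(1)[OF m, of i "Suc i" for i] 
    by (auto simp: T_def tableaux_def diagram_def intro: less_le_trans Suc_lessD)
  then have "tableaux (diagram m) {..<K} \<noteq> {}" by blast
  then show ?thesis unfolding tableau_sum_def
    using finite_tableaux[OF finite_diagram[OF m]] x by (intro sum_pos prod_pos) auto
qed

lemma tableau_sum_le_series:
  assumes m: "m \<in> shapes K" and x: "\<And>i. x i \<ge> 0" "(\<lambda>i. \<bar>x i\<bar>) summable_on UNIV"
  shows "tableau_sum m {..<N} x \<le> tableau_series m x"
  unfolding tableau_sum_def tableau_series_def
proof (rule finite_sum_le_infsum)
  have "(\<lambda>T. \<bar>\<Prod>c\<in>diagram m. x (T c)\<bar>) summable_on (diagram m \<rightarrow>\<^sub>E UNIV)"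
    by (rule fillings_summable[OF finite_diagram[OF m] x(2)])
  then have "(\<lambda>T. \<Prod>c\<in>diagram m. x (T c)) summable_on (diagram m \<rightarrow>\<^sub>E UNIV)"
    using x(1) by (simp add: abs_prod)
  then show "(\<lambda>T. \<Prod>c\<in>diagram m. x (T c)) summable_on tableaux (diagram m) UNIV"
    by (rule summable_on_subset_banach) (auto simp: tableaux_def)
qed (use finite_tableaux[OF finite_diagram[OF m]] x(1) in \<open>auto simp: tableaux_def intro: prod_nonneg\<close>)

text \<open>The quotient of the two normalizing constants: it converts the prescribed expectations
  of normalized Schur polynomials into expectations of the plain ones.\<close>

definition link_coeff :: "real \<Rightarrow> nat \<Rightarrow> (nat \<Rightarrow> nat) \<Rightarrow> real" where
  "link_coeff q K m = tableau_sum m {..<K} ((^) q) / tableau_series m ((^) q)"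

lemma link_coeff_bounds:
  assumes "0 < q" "q < 1" and m: "m \<in> shapes K"
  shows "0 < link_coeff q K m" "link_coeff q K m \<le> 1"
proof -
  have "0 < tableau_sum m {..<K} ((^) q)" using tableau_sum_pos[OF m] assms by simp
  moreover have "tableau_sum m {..<K} ((^) q) \<le> tableau_series m ((^) q)"
    using tableau_sum_le_series[OF m _ geometric_summable_on[OF assms(1,2)]] assms by simp
  ultimately show "0 < link_coeff q K m" "link_coeff q K m \<le> 1" by (auto simp: link_coeff_def)
qed

text \<open>The expectation of \<open>g\<close> under \<open>p\<close> exists and equals
  \<open>v\<close>. As a relation it carries absolute convergence along, so that sums and
  comparisons need no separate summability proofs.\<close>

definition pairs_to :: "real \<Rightarrow> real \<Rightarrow> real \<Rightarrow> nat \<Rightarrow> (nat \<Rightarrow> real) pmf \<Rightarrow> ((nat \<Rightarrow> real) \<Rightarrow> real) \<Rightarrow> real \<Rightarrow> bool" where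
  "pairs_to q zp zm K p g v \<longleftrightarrow> ((\<lambda>Y. pmf p Y * g Y) has_sum v) (ext_configs q zp zm K)"

lemma link_measure_schur:
  assumes "is_link_measure q zp zm K X p" and q: "0 < q" "q < 1" and m: "m \<in> shapes K"
  shows "pairs_to q zp zm K p (tableau_sum m {..<K}) (link_coeff q K m * config_schur m X)"
proof -
  obtain \<nu> where nu: "is_partition \<nu>" "length \<nu> \<le> K" "cells \<nu> = diagram m" using shape_partition[OF m] .
  have pos: "0 < tableau_sum m {..<K} ((^) q)" using tableau_sum_pos[OF m] q by simp
  have "((\<lambda>Y. pmf p Y * schur_norm q K \<nu> Y) has_sum schur_norm_inf q \<nu> X) (ext_configs q zp zm K)"
    using assms(1) nu by (simp add: is_link_measure_def)
  from has_sum_cmult_right[OF this, of "tableau_sum m {..<K} ((^) q)"] show ?thesis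
    using pos by (simp add: pairs_to_def schur_norm_def schur_norm_inf_def schur_poly_def schur_fun_def ssyt_eq_tableaux
        nu(3) link_coeff_def config_schur_def flip: tableau_sum_def tableau_series_def)
qed

section \<open>Bounded support of the links\<close>

text \<open>The type is left general for two uses: the complex unit as \<open>a\<close> bounds the
  coordinates, and real \<open>a = -1\<close> recovers the polynomial with the roots
  \<open>x i\<close>.\<close>

lemma prod_linear_elem_sym:
  fixes a b :: "'a :: {real_algebra_1, comm_ring_1}"
  shows "(\<Prod>i<n. a * of_real (x i) + b) = (\<Sum>r\<le>n. of_real (elem_sym n r x) * a ^ r * b ^ (n - r))"
proof -
  have "(\<Prod>i<n. a * of_real (x i) + b) =
      (\<Sum>S\<in>Pow {..<n}. (\<Prod>i\<in>S. a * of_real (x i)) * (\<Prod>i\<in>{..<n} - S. b))"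
    by (rule prod_add) simp
  also have "\<dots> = (\<Sum>S\<in>Pow {..<n}. of_real (prod x S) * a ^ card S * b ^ (n - card S))"
    by (intro sum.cong refl) (auto simp: prod.distrib card_Diff_subset finite_subset mult_ac of_real_prod)
  also have "\<dots> = (\<Sum>r\<le>n. \<Sum>S | S \<in> Pow {..<n} \<and> card S = r. of_real (prod x S) * a ^ card S * b ^ (n - card S))"
  proof (rule sum.group[symmetric])
    show "card ` Pow {..<n} \<subseteq> {..n}" using card_mono[of "{..<n}"] by auto
  qed auto
  also have "\<dots> = (\<Sum>r\<le>n. of_real (elem_sym n r x) * a ^ r * b ^ (n - r))"
    by (intro sum.cong refl) (simp add: elem_sym_def sum_distrib_right)
  finally show ?thesis .
qed

text \<open>The idea is to evaluate \<open>\<Prod>\<^sub>k (1 + \<i> x\<^sub>k)\<close>, each factor of which has modulus at least \<open>max 1 \<bar>x\<^sub>k\<bar>\<close>.\<close>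

lemma abs_le_elem_sym:
  assumes "i < n"
  shows "\<bar>x i\<bar> \<le> (\<Sum>r\<le>n. \<bar>elem_sym n r x\<bar>)"
proof -
  have ge: "max 1 \<bar>x j\<bar> \<le> cmod (\<i> * of_real (x j) + 1)" for j
    using abs_Re_le_cmod[of "\<i> * of_real (x j) + 1"] abs_Im_le_cmod[of "\<i> * of_real (x j) + 1"] by simp
  have "\<bar>x i\<bar> \<le> cmod (\<i> * of_real (x i) + 1) * 1" using ge[of i] by simp
  also have "\<dots> \<le> cmod (\<i> * of_real (x i) + 1) * (\<Prod>j\<in>{..<n} - {i}. cmod (\<i> * of_real (x j) + 1))"
    using ge by (intro mult_left_mono prod_ge_1) auto
  also have "\<dots> = (\<Prod>j<n. cmod (\<i> * of_real (x j) + 1))"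
    using assms by (subst prod.remove[of "{..<n}" i]) auto
  also have "\<dots> = cmod (\<Prod>j<n. \<i> * of_real (x j) + 1)" by (rule prod_norm)
  also have "\<dots> = cmod (\<Sum>r\<le>n. of_real (elem_sym n r x) * \<i> ^ r)" by (simp add: prod_linear_elem_sym)
  also have "\<dots> \<le> (\<Sum>r\<le>n. \<bar>elem_sym n r x\<bar>)"
    by (intro order_trans[OF norm_sum] sum_mono) (simp add: norm_mult norm_power)
  finally show ?thesis .
qed

text \<open>The last coordinate of either tuple is a root of the common polynomial, hence at most
  the last coordinate of the other one. So the two agree, and the common linear factor
  cancels.\<close>

lemma sorted_prod_unique:
  fixes x y :: "nat \<Rightarrow> real"
  assumes "mono_on {..<n} x" "mono_on {..<n} y"
    and "(\<Prod>i<n. [:- x i, 1:]) = (\<Prod>i<n. [:- y i, 1:])" and "i < n"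
  shows "x i = y i"
  using assms
proof (induction n arbitrary: i)
  case (Suc n)
  have le: "a n \<le> b n" if "mono_on {..<Suc n} b" "(\<Prod>i<Suc n. [:- a i, 1:]) = (\<Prod>i<Suc n. [:- b i, 1:])"
    for a b :: "nat \<Rightarrow> real"
  proof -
    have "poly (\<Prod>i<Suc n. [:- b i, 1:]) (a n) = 0" unfolding that(2)[symmetric] by simp
    then have "\<exists>j\<in>{..<Suc n}. a n = b j" by (auto simp: poly_prod simp del: prod.lessThan_Suc)
    then obtain j where "j < Suc n" "a n = b j" by auto
    then show ?thesis using that(1) by (auto simp: mono_on_def)
  qed
  have n: "x n = y n" using le[OF Suc.prems(2,3)] le[OF Suc.prems(1) Suc.prems(3)[symmetric]] by simp
  have "[:- x n, 1:] * (\<Prod>i<n. [:- x i, 1:]) = [:- x n, 1:] * (\<Prod>i<n. [:- y i, 1:])"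
    using Suc.prems(3) n by (simp add: mult.commute)
  then have "(\<Prod>i<n. [:- x i, 1:]) = (\<Prod>i<n. [:- y i, 1:])" by (subst (asm) mult_cancel_left) simp
  moreover have "mono_on {..<n} x" "mono_on {..<n} y"
    by (rule mono_on_subset[OF Suc.prems(1)], simp) (rule mono_on_subset[OF Suc.prems(2)], simp)
  ultimately have "i < n \<Longrightarrow> x i = y i" using Suc.IH by blast
  then show ?case using Suc.prems(4) n by (cases "i = n") simp_all
qed simp

text \<open>Up to sign the \<open>elem_sym\<close> values are the coefficients of the monic
  polynomial with roots \<open>x i\<close>, and a point of the cone is the ordered list of its roots
  with multiplicities.\<close>

lemma elem_sym_separates:
  assumes "x \<in> cone K" "y \<in> cone K" and e: "\<And>r. elem_sym K r x = elem_sym K r y"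
  shows "x = y"
proof -
  have "poly (\<Prod>i<K. [:- x i, 1:]) z = poly (\<Prod>i<K. [:- y i, 1:]) z" for z
    using prod_linear_elem_sym[of "-1" x z K] prod_linear_elem_sym[of "-1" y z K] e by (simp add: poly_prod)
  then have "(\<Prod>i<K. [:- x i, 1:]) = (\<Prod>i<K. [:- y i, 1:])" by (simp add: poly_eq_poly_eq_iff[symmetric] fun_eq_iff)
  then have "x i = y i" if "i < K" for i
    using sorted_prod_unique[of K x y i] assms that by (simp add: cone_def)
  then show ?thesis using assms(1,2) by (auto simp: cone_def PiE_def intro: extensionalityI)
qed

lemma continuous_map_tableau_sum:
  assumes "m \<in> shapes K"
  shows "continuous_map (powertop_real {..<K}) euclideanreal (tableau_sum m {..<K})"
proof -
  have "T c < K" if "T \<in> tableaux (diagram m) {..<K}" "c \<in> diagram m" for T c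
    using that by (auto simp: tableaux_def)
  then show ?thesis unfolding tableau_sum_def[abs_def]
    by (intro continuous_map_sum continuous_map_prod continuous_map_product_projection finite_tableaux
        finite_diagram[OF assms]) auto
qed

lemma continuous_map_elem_sym: "continuous_map (powertop_real {..<K}) euclideanreal (elem_sym K r)"
  unfolding elem_sym_def[abs_def]
  by (intro continuous_map_sum continuous_map_prod continuous_map_product_projection)
    (auto intro: finite_subset)

lemma ext_configs_subset_cone: "ext_configs q zp zm K \<subseteq> cone K"
  unfolding ext_configs_def using closure_of_subset_topspace[of "cone_topology K" "configs q zp zm K"]
  by (auto simp: cone_topology_def)

text \<open>Pieri's rule was obtained for distinct points; by continuity it extends to the closure,
  where zero may be repeated.\<close>

lemma pieri_ext_configs:
  assumes m: "m \<in> shapes K" and Y: "Y \<in> ext_configs q zp zm K"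
  shows "elem_sym K r Y * tableau_sum m {..<K} Y =
    (\<Sum>I\<in>vertical_strips K r m. tableau_sum (add_cells m I) {..<K} Y)"
proof (rule forall_in_closure_of_eq[OF Y[unfolded ext_configs_def] Hausdorff_space_euclidean])
  show "continuous_map (cone_topology K) euclideanreal (\<lambda>Y. elem_sym K r Y * tableau_sum m {..<K} Y)"
    unfolding cone_topology_def
    by (intro continuous_map_from_subtopology continuous_map_real_mult continuous_map_elem_sym
        continuous_map_tableau_sum m)
  show "continuous_map (cone_topology K) euclideanreal
      (\<lambda>Y. \<Sum>I\<in>vertical_strips K r m. tableau_sum (add_cells m I) {..<K} Y)"
    unfolding cone_topology_def
    by (intro continuous_map_from_subtopology continuous_map_sum card_vertical_strips continuous_map_tableau_sum)
      (simp add: vertical_strips_def)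
  fix Z assume "Z \<in> configs q zp zm K"
  then have "inj_on Z {..<K}" by (auto simp: configs_def intro: strict_mono_on_imp_inj_on)
  then show "elem_sym K r Z * tableau_sum m {..<K} Z =
      (\<Sum>I\<in>vertical_strips K r m. tableau_sum (add_cells m I) {..<K} Z)"
    by (rule pieri[OF m])
qed

lemma pairs_to_sum:
  assumes "finite I" "\<And>i. i \<in> I \<Longrightarrow> pairs_to q zp zm K p (g i) (v i)"
  shows "pairs_to q zp zm K p (\<lambda>Y. \<Sum>i\<in>I. g i Y) (\<Sum>i\<in>I. v i)"
  using assms
proof (induction I rule: finite_induct)
  case empty
  then show ?case by (simp add: pairs_to_def)
next
  case (insert i I)
  then have "pairs_to q zp zm K p (g i) (v i)" "pairs_to q zp zm K p (\<lambda>Y. \<Sum>i\<in>I. g i Y) (\<Sum>i\<in>I. v i)" by auto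
  from has_sum_add[OF this[unfolded pairs_to_def]] show ?case using insert(1,2)
    by (simp add: pairs_to_def distrib_left)
qed

lemma pairs_to_cong:
  "(\<And>Y. Y \<in> ext_configs q zp zm K \<Longrightarrow> g Y = h Y) \<Longrightarrow> pairs_to q zp zm K p g v \<longleftrightarrow> pairs_to q zp zm K p h v"
  unfolding pairs_to_def by (intro has_sum_cong) simp

lemma pairs_to_add:
  "pairs_to q zp zm K p g v \<Longrightarrow> pairs_to q zp zm K p h w \<Longrightarrow> pairs_to q zp zm K p (\<lambda>Y. g Y + h Y) (v + w)"
  unfolding pairs_to_def by (auto simp: distrib_left intro: has_sum_add)

lemma pairs_to_cmult:
  assumes "pairs_to q zp zm K p g v"
  shows "pairs_to q zp zm K p (\<lambda>Y. c * g Y) (c * v)"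
  using has_sum_cmult_right[OF assms[unfolded pairs_to_def], of c]
  by (simp add: pairs_to_def mult.left_commute)

lemma pairs_to_mono:
  assumes "pairs_to q zp zm K p g v" "pairs_to q zp zm K p h w"
    and "\<And>Y. Y \<in> ext_configs q zp zm K \<Longrightarrow> pmf p Y > 0 \<Longrightarrow> g Y \<le> h Y"
  shows "v \<le> w"
proof (rule has_sum_mono[OF assms(1,2)[unfolded pairs_to_def]])
  fix Y assume Y: "Y \<in> ext_configs q zp zm K"
  show "pmf p Y * g Y \<le> pmf p Y * h Y"
  proof (cases "pmf p Y = 0")
    case False
    then have "pmf p Y > 0" using pmf_nonneg[of p Y] by linarith
    then show ?thesis using assms(3)[OF Y] by simp
  qed simp
qed

lemma pmf_has_sum:
  assumes "set_pmf p \<subseteq> E"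
  shows "(pmf p has_sum 1) E"
proof -
  have "Infinite_Set_Sum.abs_summable_on (pmf p) E" by (rule pmf_abs_summable)
  then have "infsum (pmf p) E = infsetsum (pmf p) E" by (rule infsetsum_infsum[symmetric])
  moreover have "pmf p summable_on E"
    using \<open>Infinite_Set_Sum.abs_summable_on (pmf p) E\<close>
    unfolding abs_summable_equivalent[symmetric] by (rule abs_summable_summable)
  moreover have "infsetsum (pmf p) E = 1" by (rule infsetsum_pmf_eq_1[OF assms])
  ultimately show ?thesis by (metis has_sum_infsum)
qed

lemma pairs_to_const:
  "set_pmf p \<subseteq> ext_configs q zp zm K \<Longrightarrow> pairs_to q zp zm K p (\<lambda>_. c) c"
  using has_sum_cmult_right[OF pmf_has_sum, of p "ext_configs q zp zm K" c]
  by (simp add: pairs_to_def mult.commute[of c])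

lemma pairs_to_bounded:
  assumes p: "set_pmf p \<subseteq> ext_configs q zp zm K"
    and "\<And>Y. Y \<in> ext_configs q zp zm K \<Longrightarrow> pmf p Y > 0 \<Longrightarrow> \<bar>g Y\<bar> \<le> c"
  shows "pairs_to q zp zm K p g (\<Sum>\<^sub>\<infinity>Y\<in>ext_configs q zp zm K. pmf p Y * g Y)"
  unfolding pairs_to_def
proof (rule has_sum_infsum, rule abs_summable_summable, rule summable_on_comparison_test)
  show "(\<lambda>Y. pmf p Y * c) summable_on ext_configs q zp zm K"
    using pairs_to_const[OF p, of c] by (auto simp: pairs_to_def intro: has_sum_imp_summable)
  fix Y assume Y: "Y \<in> ext_configs q zp zm K"
  show "norm (pmf p Y * g Y) \<le> pmf p Y * c"
  proof (cases "pmf p Y = 0")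
    case False
    then have "pmf p Y > 0" using pmf_nonneg[of p Y] by linarith
    then show ?thesis using assms(2)[OF Y] by (simp add: abs_mult)
  qed simp
qed simp

section \<open>Moments of the elementary symmetric polynomials\<close>

context
  fixes q zp zm :: real and K :: nat and p :: "(nat \<Rightarrow> real) pmf" and X :: "real set"
  assumes q: "0 < q" "q < 1" and zp: "zp > 0" and zm: "zm < 0"
    and X: "X \<in> inf_configs q zp zm" and link: "is_link_measure q zp zm K X p"
begin

lemma link_config_summable: "countable X" "(\<lambda>x. \<bar>x\<bar>) summable_on X"
  using inf_configs_bounded[OF q zp zm X] config_summable[OF q zp zm] by metis+

text \<open>Each factor \<open>elem_sym\<close> is traded by Pieri's rule for at most
  \<open>2 ^ K\<close> Schur polynomials with \<open>r\<close> more cells, which is why the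
  induction runs over all shapes. The start uses that \<open>link_coeff\<close> is at most 1, so a
  Schur polynomial of \<open>d\<close> cells has expectation at most \<open>\<sigma> ^ d\<close> in
  absolute value.\<close>

lemma moment_bound:
  fixes \<sigma> :: real
  defines "\<sigma> \<equiv> (\<Sum>\<^sub>\<infinity>x\<in>X. \<bar>x\<bar>)"
  assumes "m \<in> shapes K"
  shows "\<exists>v. pairs_to q zp zm K p (\<lambda>Y. elem_sym K r Y ^ N * tableau_sum m {..<K} Y) v \<and>
    \<bar>v\<bar> \<le> (2 ^ K * \<sigma> ^ r) ^ N * \<sigma> ^ card (diagram m)"
  using assms(2)
proof (induction N arbitrary: m)
  case 0
  note lb = link_coeff_bounds[OF q 0]
  have "\<bar>link_coeff q K m * config_schur m X\<bar> \<le> 1 * \<sigma> ^ card (diagram m)"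
    unfolding abs_mult \<sigma>_def using lb by (intro mult_mono config_schur_abs_le[OF 0 link_config_summable]) auto
  then show ?case using link_measure_schur[OF link q 0] by auto
next
  case (Suc N)
  have \<sigma>: "\<sigma> \<ge> 0" by (simp add: \<sigma>_def infsum_nonneg)
  let ?V = "vertical_strips K r m"
  have "\<forall>I\<in>?V. \<exists>v. pairs_to q zp zm K p (\<lambda>Y. elem_sym K r Y ^ N * tableau_sum (add_cells m I) {..<K} Y) v \<and>
      \<bar>v\<bar> \<le> (2 ^ K * \<sigma> ^ r) ^ N * \<sigma> ^ (card (diagram m) + r)"
    using Suc.IH card_diagram_add_cells[OF Suc.prems] by (fastforce simp: vertical_strips_def)
  from bchoice[OF this] obtain v where "\<forall>I\<in>?V.
      pairs_to q zp zm K p (\<lambda>Y. elem_sym K r Y ^ N * tableau_sum (add_cells m I) {..<K} Y) (v I) \<and>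
      \<bar>v I\<bar> \<le> (2 ^ K * \<sigma> ^ r) ^ N * \<sigma> ^ (card (diagram m) + r)" ..
  then have v: "\<And>I. I \<in> ?V \<Longrightarrow>
      pairs_to q zp zm K p (\<lambda>Y. elem_sym K r Y ^ N * tableau_sum (add_cells m I) {..<K} Y) (v I)"
    and vb: "\<And>I. I \<in> ?V \<Longrightarrow> \<bar>v I\<bar> \<le> (2 ^ K * \<sigma> ^ r) ^ N * \<sigma> ^ (card (diagram m) + r)"
    by simp_all
  have "pairs_to q zp zm K p (\<lambda>Y. \<Sum>I\<in>?V. elem_sym K r Y ^ N * tableau_sum (add_cells m I) {..<K} Y) (\<Sum>I\<in>?V. v I)"
    by (intro pairs_to_sum card_vertical_strips v)
  moreover have "(\<Sum>I\<in>?V. elem_sym K r Y ^ N * tableau_sum (add_cells m I) {..<K} Y) =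
      elem_sym K r Y ^ Suc N * tableau_sum m {..<K} Y" if "Y \<in> ext_configs q zp zm K" for Y
    using pieri_ext_configs[OF Suc.prems that, of r] by (simp add: sum_distrib_left[symmetric] mult_ac)
  ultimately have "pairs_to q zp zm K p (\<lambda>Y. elem_sym K r Y ^ Suc N * tableau_sum m {..<K} Y) (\<Sum>I\<in>?V. v I)"
    using pairs_to_cong[of q zp zm K] by (metis (no_types, lifting))
  moreover have "\<bar>\<Sum>I\<in>?V. v I\<bar> \<le> (2 ^ K * \<sigma> ^ r) ^ Suc N * \<sigma> ^ card (diagram m)"
  proof -
    have "\<bar>\<Sum>I\<in>?V. v I\<bar> \<le> (\<Sum>I\<in>?V. (2 ^ K * \<sigma> ^ r) ^ N * \<sigma> ^ (card (diagram m) + r))"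
    by (intro order_trans[OF sum_abs] sum_mono vb)
    also have "\<dots> = real (card ?V) * ((2 ^ K * \<sigma> ^ r) ^ N * \<sigma> ^ (card (diagram m) + r))" by simp
    also have "\<dots> \<le> 2 ^ K * ((2 ^ K * \<sigma> ^ r) ^ N * \<sigma> ^ (card (diagram m) + r))"
    proof (rule mult_right_mono)
      show "real (card ?V) \<le> 2 ^ K"
        using card_vertical_strips(2)[of K r m] by (metis of_nat_le_iff of_nat_numeral of_nat_power)
    qed (use \<sigma> in simp)
    also have "\<dots> = (2 ^ K * \<sigma> ^ r) ^ Suc N * \<sigma> ^ card (diagram m)" by (simp add: power_add)
    finally show ?thesis .
  qed
  ultimately show ?case by blast
qed

text \<open>Moments growing like \<open>b ^ N\<close> forbid atoms where the absolute value exceeds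
  \<open>b\<close>: such an atom has weight at most \<open>(b / e) ^ (2 N)\<close> for every
  \<open>N\<close>.\<close>

lemma elem_sym_support_bound:
  assumes Y: "Y \<in> ext_configs q zp zm K" "pmf p Y > 0"
  shows "\<bar>elem_sym K r Y\<bar> \<le> 2 ^ K * (\<Sum>\<^sub>\<infinity>x\<in>X. \<bar>x\<bar>) ^ r"
proof (rule ccontr)
  define b where "b = 2 ^ K * (\<Sum>\<^sub>\<infinity>x\<in>X. \<bar>x\<bar>) ^ r"
  define e where "e = \<bar>elem_sym K r Y\<bar>"
  have b: "b \<ge> 0" by (simp add: b_def infsum_nonneg)
  assume "\<not> \<bar>elem_sym K r Y\<bar> \<le> 2 ^ K * (\<Sum>\<^sub>\<infinity>x\<in>X. \<bar>x\<bar>) ^ r"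
  then have eb: "b < e" by (simp add: b_def e_def)
  have "pmf p Y \<le> ((b / e) ^ 2) ^ N" for N
  proof -
    obtain v where v: "pairs_to q zp zm K p (\<lambda>Y. elem_sym K r Y ^ (2 * N)) v" "\<bar>v\<bar> \<le> b ^ (2 * N)"
      using moment_bound[OF empty_shape, of r "2 * N"] by (auto simp: tableau_sum_empty_shape b_def diagram_0)
    \<comment> \<open>With an even exponent all terms are nonnegative, so a single one is bounded by
      the whole sum.\<close>
    have "(\<Sum>Z\<in>{Y}. pmf p Z * elem_sym K r Z ^ (2 * N)) \<le> v"
      by (rule finite_sum_le_has_sum[OF v(1)[unfolded pairs_to_def]]) (use Y in \<open>auto simp: power_mult\<close>)
    then have "pmf p Y * e ^ (2 * N) \<le> b ^ (2 * N)" using v(2) by (simp add: e_def power_even_abs)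
    then have "pmf p Y \<le> b ^ (2 * N) / e ^ (2 * N)" using eb b by (simp add: pos_le_divide_eq)
    then show ?thesis by (simp add: power_divide power_mult)
  qed
  moreover have "(\<lambda>N. ((b / e) ^ 2) ^ N) \<longlonglongrightarrow> 0"
  proof (rule LIMSEQ_realpow_zero)
    show "(b / e) ^ 2 < 1" using eb b by (simp add: power_less_one_iff abs_square_less_1)
  qed simp
  ultimately have "pmf p Y \<le> 0" by (intro LIMSEQ_le_const[where X = "\<lambda>N. ((b / e) ^ 2) ^ N"]) auto
  then show False using Y by simp
qed

end

definition support_bound :: "nat \<Rightarrow> real \<Rightarrow> real" where
  "support_bound K \<sigma> = (\<Sum>r\<le>K. 2 ^ K * \<sigma> ^ r)"

text \<open>The bound depends on \<open>X\<close> only through an interval containing it. This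
  uniformity lets one approximating polynomial serve all configurations in the interval.\<close>

lemma link_support_bound:
  assumes "0 < q" "q < 1" "zp > 0" "zm < 0" "X \<subseteq> bounded_lattice q zp zm R" "is_link_measure q zp zm K X p"
    and Y: "Y \<in> ext_configs q zp zm K" "pmf p Y > 0" and "i < K"
  shows "\<bar>Y i\<bar> \<le> support_bound K (\<Sum>\<^sub>\<infinity>x\<in>bounded_lattice q zp zm R. \<bar>x\<bar>)"
proof -
  have X: "X \<in> inf_configs q zp zm" by (rule bounded_lattice_configs[OF assms(1-5)])
  have \<sigma>: "(\<Sum>\<^sub>\<infinity>x\<in>X. \<bar>x\<bar>) \<le> (\<Sum>\<^sub>\<infinity>x\<in>bounded_lattice q zp zm R. \<bar>x\<bar>)"
    using assms by (intro infsum_mono2 config_summable bounded_lattice_summable) auto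
  have "\<bar>Y i\<bar> \<le> (\<Sum>r\<le>K. \<bar>elem_sym K r Y\<bar>)" using abs_le_elem_sym[OF \<open>i < K\<close>] .
  also have "\<dots> \<le> support_bound K (\<Sum>\<^sub>\<infinity>x\<in>X. \<bar>x\<bar>)"
    unfolding support_bound_def using assms by (intro sum_mono elem_sym_support_bound[OF assms(1-4) X]) auto
  also have "\<dots> \<le> support_bound K (\<Sum>\<^sub>\<infinity>x\<in>bounded_lattice q zp zm R. \<bar>x\<bar>)"
    unfolding support_bound_def using \<sigma> by (intro sum_mono mult_left_mono power_mono) (auto simp: infsum_nonneg)
  finally show ?thesis .
qed

section \<open>Continuity\<close>

text \<open>The linear span of the Schur polynomials, as functions on \<open>E\<close>. Equality is
  demanded on \<open>E\<close> only, since that is where Pieri's rule is available.\<close>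

inductive schur_span :: "(nat \<Rightarrow> real) set \<Rightarrow> nat \<Rightarrow> ((nat \<Rightarrow> real) \<Rightarrow> real) \<Rightarrow> bool" for E K where
  base: "m \<in> shapes K \<Longrightarrow> (\<And>Y. Y \<in> E \<Longrightarrow> g Y = a * tableau_sum m {..<K} Y) \<Longrightarrow> schur_span E K g"
| add: "schur_span E K g \<Longrightarrow> schur_span E K h \<Longrightarrow> (\<And>Y. Y \<in> E \<Longrightarrow> f Y = g Y + h Y) \<Longrightarrow> schur_span E K f"

lemma schur_span_zero: "schur_span E K (\<lambda>_. 0)"
  by (rule schur_span.base[of "\<lambda>_. 0" K E _ 0]) (simp_all add: empty_shape)

lemma schur_span_cong:
  assumes "schur_span E K g" "\<And>Y. Y \<in> E \<Longrightarrow> h Y = g Y"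
  shows "schur_span E K h"
  by (rule schur_span.add[OF assms(1) schur_span_zero]) (simp add: assms(2))

lemma schur_span_cmult: "schur_span E K g \<Longrightarrow> schur_span E K (\<lambda>Y. c * g Y)"
proof (induction rule: schur_span.induct)
  case (base m g a)
  show ?case by (rule schur_span.base[OF base(1), of _ _ "c * a"]) (simp add: base(2))
next
  case (add g h f)
  show ?case by (rule schur_span.add[OF add(4,5)]) (simp add: add(3) distrib_left)
qed

lemma schur_span_sum:
  assumes "finite I" "\<And>i. i \<in> I \<Longrightarrow> schur_span E K (g i)"
  shows "schur_span E K (\<lambda>Y. \<Sum>i\<in>I. g i Y)"
  using assms
proof (induction I rule: finite_induct)
  case empty
  then show ?case by (simp add: schur_span_zero)
next
  case (insert i I)
  then have "schur_span E K (g i)" "schur_span E K (\<lambda>Y. \<Sum>i\<in>I. g i Y)" by auto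
  then show ?case by (rule schur_span.add) (simp add: insert)
qed

text \<open>Functions that multiply the span into itself. They are closed under sums and products at
  once, without any rule for products of Schur polynomials, and they lie in the span because the
  empty shape gives the constant 1.\<close>

definition schur_multiplier :: "(nat \<Rightarrow> real) set \<Rightarrow> nat \<Rightarrow> ((nat \<Rightarrow> real) \<Rightarrow> real) \<Rightarrow> bool" where
  "schur_multiplier E K g \<longleftrightarrow> (\<forall>m\<in>shapes K. schur_span E K (\<lambda>Y. g Y * tableau_sum m {..<K} Y))"

lemma schur_multiplier_span:
  assumes g: "schur_multiplier E K g"
  shows "schur_span E K h \<Longrightarrow> schur_span E K (\<lambda>Y. g Y * h Y)"
proof (induction rule: schur_span.induct)
  case (base m h a)
  have "schur_span E K (\<lambda>Y. a * (g Y * tableau_sum m {..<K} Y))"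
    using g base(1) by (intro schur_span_cmult) (simp add: schur_multiplier_def)
  then show ?case by (rule schur_span_cong) (simp add: base(2))
next
  case (add h1 h2 h)
  show ?case by (rule schur_span.add[OF add(4,5)]) (simp add: add(3) distrib_left)
qed

lemma schur_multiplier_imp_span: "schur_multiplier E K g \<Longrightarrow> schur_span E K g"
  using schur_multiplier_span[of E K g "\<lambda>_. 1"] schur_span.base[OF empty_shape, of E "\<lambda>_. 1" 1 K]
  by (simp add: tableau_sum_empty_shape)

lemma schur_multiplier_const: "schur_multiplier E K (\<lambda>_. c)"
  unfolding schur_multiplier_def by (auto intro: schur_span.base)

lemma schur_multiplier_add:
  "schur_multiplier E K g \<Longrightarrow> schur_multiplier E K h \<Longrightarrow> schur_multiplier E K (\<lambda>Y. g Y + h Y)"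
  unfolding schur_multiplier_def
proof
  fix m assume "\<forall>m\<in>shapes K. schur_span E K (\<lambda>Y. g Y * tableau_sum m {..<K} Y)"
    "\<forall>m\<in>shapes K. schur_span E K (\<lambda>Y. h Y * tableau_sum m {..<K} Y)" "m \<in> shapes K"
  then have "schur_span E K (\<lambda>Y. g Y * tableau_sum m {..<K} Y)"
    "schur_span E K (\<lambda>Y. h Y * tableau_sum m {..<K} Y)" by blast+
  then show "schur_span E K (\<lambda>Y. (g Y + h Y) * tableau_sum m {..<K} Y)"
    by (rule schur_span.add) (rule distrib_right)
qed

lemma schur_multiplier_mult:
  assumes "schur_multiplier E K g" "schur_multiplier E K h"
  shows "schur_multiplier E K (\<lambda>Y. g Y * h Y)"
  unfolding schur_multiplier_def
proof
  fix m assume "m \<in> shapes K"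
  with assms(2) have "schur_span E K (\<lambda>Y. h Y * tableau_sum m {..<K} Y)" by (simp add: schur_multiplier_def)
  from schur_multiplier_span[OF assms(1) this] show "schur_span E K (\<lambda>Y. g Y * h Y * tableau_sum m {..<K} Y)"
    by (simp add: mult.assoc)
qed

lemma schur_multiplier_elem_sym: "schur_multiplier (ext_configs q zp zm K) K (elem_sym K r)"
  unfolding schur_multiplier_def
proof
  fix m assume m: "m \<in> shapes K"
  have "schur_span (ext_configs q zp zm K) K
      (\<lambda>Y. \<Sum>I\<in>vertical_strips K r m. tableau_sum (add_cells m I) {..<K} Y)"
  proof (rule schur_span_sum[OF card_vertical_strips(1)])
    fix I assume "I \<in> vertical_strips K r m"
    then show "schur_span (ext_configs q zp zm K) K (tableau_sum (add_cells m I) {..<K})"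
      by (intro schur_span.base[where a = 1 and m = "add_cells m I"]) (auto simp: vertical_strips_def)
  qed
  then show "schur_span (ext_configs q zp zm K) K (\<lambda>Y. elem_sym K r Y * tableau_sum m {..<K} Y)"
    by (rule schur_span_cong) (rule pieri_ext_configs[OF m])
qed

definition eps_continuous :: "real \<Rightarrow> real \<Rightarrow> real \<Rightarrow> (real set \<Rightarrow> real) \<Rightarrow> bool" where
  "eps_continuous q zp zm V \<longleftrightarrow> (\<forall>X\<in>inf_configs q zp zm. \<forall>\<eta>>0. \<exists>\<epsilon>>0. \<forall>Y\<in>inf_configs q zp zm.
     eps_close \<epsilon> X Y \<longrightarrow> \<bar>V X - V Y\<bar> < \<eta>)"

lemma eps_continuousD:
  assumes "eps_continuous q zp zm V" "X \<in> inf_configs q zp zm" "\<eta> > 0"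
  obtains \<epsilon> where "\<epsilon> > 0" "\<And>Y. Y \<in> inf_configs q zp zm \<Longrightarrow> eps_close \<epsilon> X Y \<Longrightarrow> \<bar>V X - V Y\<bar> < \<eta>"
  using assms unfolding eps_continuous_def by meson

text \<open>The expectation is a fixed linear combination of Schur functions of \<open>X\<close>, so
  continuity is inherited from these.\<close>

lemma schur_span_pairs_to:
  assumes q: "0 < q" "q < 1" and z: "zp > 0" "zm < 0"
  shows "schur_span (ext_configs q zp zm K) K g \<Longrightarrow> \<exists>V. eps_continuous q zp zm V \<and>
    (\<forall>X p. is_link_measure q zp zm K X p \<longrightarrow> pairs_to q zp zm K p g (V X))"
proof (induction rule: schur_span.induct)
  case (base m g a)
  define c where "c = a * link_coeff q K m"
  have "eps_continuous q zp zm (\<lambda>X. c * config_schur m X)"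
    unfolding eps_continuous_def
  proof (intro ballI allI impI)
    fix X \<eta> assume X: "X \<in> inf_configs q zp zm" and \<eta>: "(0::real) < \<eta>"
    obtain \<epsilon> where \<epsilon>: "\<epsilon> > 0" "\<And>Y. Y \<in> inf_configs q zp zm \<Longrightarrow> eps_close \<epsilon> X Y \<Longrightarrow>
        \<bar>config_schur m X - config_schur m Y\<bar> < \<eta> / (\<bar>c\<bar> + 1)"
      using config_schur_continuous[OF q z base(1) X, of "\<eta> / (\<bar>c\<bar> + 1)"] \<eta> by auto
    have "\<bar>c * config_schur m X - c * config_schur m Y\<bar> < \<eta>"
      if "\<bar>config_schur m X - config_schur m Y\<bar> < \<eta> / (\<bar>c\<bar> + 1)" for Y
    proof -
      have "\<bar>c * config_schur m X - c * config_schur m Y\<bar> = \<bar>c\<bar> * \<bar>config_schur m X - config_schur m Y\<bar>"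
        by (simp add: abs_mult right_diff_distrib[symmetric])
      also have "\<dots> \<le> (\<bar>c\<bar> + 1) * \<bar>config_schur m X - config_schur m Y\<bar>" by (simp add: mult_right_mono)
      also have "\<dots> < \<eta>" using that by (simp add: field_simps)
      finally show ?thesis .
    qed
    then show "\<exists>\<epsilon>>0. \<forall>Y\<in>inf_configs q zp zm. eps_close \<epsilon> X Y \<longrightarrow> \<bar>c * config_schur m X - c * config_schur m Y\<bar> < \<eta>"
      using \<epsilon> by blast
  qed
  moreover have "pairs_to q zp zm K p g (c * config_schur m X)" if "is_link_measure q zp zm K X p" for X p
    using pairs_to_cmult[OF link_measure_schur[OF that q base(1)], of a] pairs_to_cong[OF base(2), of q zp zm K]
    by (simp add: c_def mult.assoc)
  ultimately show ?case by (intro exI[of _ "\<lambda>X. c * config_schur m X"]) simp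
next
  case (add g h f)
  obtain V where V: "eps_continuous q zp zm V"
    "\<And>X p. is_link_measure q zp zm K X p \<Longrightarrow> pairs_to q zp zm K p g (V X)" using add(4) by blast
  obtain W where W: "eps_continuous q zp zm W"
    "\<And>X p. is_link_measure q zp zm K X p \<Longrightarrow> pairs_to q zp zm K p h (W X)" using add(5) by blast
  have "eps_continuous q zp zm (\<lambda>X. V X + W X)"
    unfolding eps_continuous_def
  proof (intro ballI allI impI)
    fix X \<eta> assume X: "X \<in> inf_configs q zp zm" and "(0::real) < \<eta>"
    then have \<eta>: "\<eta> / 2 > 0" by simp
    obtain d where d: "d > 0" "\<And>Y. Y \<in> inf_configs q zp zm \<Longrightarrow> eps_close d X Y \<Longrightarrow> \<bar>V X - V Y\<bar> < \<eta> / 2"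
      using eps_continuousD[OF V(1) X \<eta>] by blast
    obtain e where e: "e > 0" "\<And>Y. Y \<in> inf_configs q zp zm \<Longrightarrow> eps_close e X Y \<Longrightarrow> \<bar>W X - W Y\<bar> < \<eta> / 2"
      using eps_continuousD[OF W(1) X \<eta>] by blast
    have "\<bar>(V X + W X) - (V Y + W Y)\<bar> < \<eta>"
      if Y: "Y \<in> inf_configs q zp zm" and cl: "eps_close (min d e) X Y" for Y
    proof -
      have "\<bar>V X - V Y\<bar> < \<eta> / 2" "\<bar>W X - W Y\<bar> < \<eta> / 2"
        using d(2)[OF Y eps_close_mono[OF cl]] e(2)[OF Y eps_close_mono[OF cl]] by simp_all
      then show ?thesis by linarith
    qed
    then show "\<exists>\<epsilon>>0. \<forall>Y\<in>inf_configs q zp zm. eps_close \<epsilon> X Y \<longrightarrow> \<bar>(V X + W X) - (V Y + W Y)\<bar> < \<eta>"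
      using d(1) e(1) by (intro exI[of _ "min d e"]) simp
  qed
  moreover have "pairs_to q zp zm K p f (V X + W X)" if "is_link_measure q zp zm K X p" for X p
    using pairs_to_add[OF V(2)[OF that] W(2)[OF that]] pairs_to_cong[OF add(3), of q zp zm K] by simp
  ultimately show ?case by (intro exI[of _ "\<lambda>X. V X + W X"]) simp
qed

section \<open>Compact sets of finite configurations and uniform approximation\<close>

definition bounded_ext_configs :: "real \<Rightarrow> real \<Rightarrow> real \<Rightarrow> nat \<Rightarrow> real \<Rightarrow> (nat \<Rightarrow> real) set" where
  "bounded_ext_configs q zp zm K M = {Y \<in> ext_configs q zp zm K. \<forall>i<K. \<bar>Y i\<bar> \<le> M}"

lemma closedin_cone: "closedin (powertop_real {..<K}) (cone K)"
proof -
  let ?T = "powertop_real {..<K}"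
  \<comment> \<open>The whole space is added so that the intersection is over a nonempty family even
    for \<open>K = 0\<close>.\<close>
  define \<C> where "\<C> = insert (topspace ?T) ((\<lambda>(i, j). {x \<in> topspace ?T. x j - x i \<in> {0..}}) ` {(i, j). i \<le> j \<and> j < K})"
  have "closedin ?T C" if "C \<in> \<C>" for C
  proof -
    have "closedin ?T {x \<in> topspace ?T. x j - x i \<in> {0..}}" if "i \<le> j" "j < K" for i j
      using that by (intro closedin_continuous_map_preimage[where Y = euclideanreal] continuous_map_diff
          continuous_map_product_projection) auto
    then show ?thesis using that by (auto simp: \<C>_def simp del: topspace_product_topology)
  qed
  then have "closedin ?T (\<Inter>\<C>)" by (intro closedin_Inter) (auto simp: \<C>_def)
  also have "\<Inter>\<C> = cone K"
    by (auto simp: \<C>_def cone_def mono_on_def)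
  finally show ?thesis .
qed

lemma closedin_ext_configs: "closedin (powertop_real {..<K}) (ext_configs q zp zm K)"
  unfolding ext_configs_def
  by (rule closedin_trans_full[OF _ closedin_cone]) (simp add: cone_topology_def)

text \<open>Compactness is transferred to the topology of the type
  \<open>nat \<Rightarrow> real\<close>, in which the approximation theorem is applied. The
  inclusion is continuous because the coordinates from \<open>K\<close> on are constantly
  \<open>undefined\<close>.\<close>

lemma compact_bounded_ext_configs: "compact (bounded_ext_configs q zp zm K M)"
proof -
  let ?S = "bounded_ext_configs q zp zm K M" and ?T = "powertop_real {..<K}"
  have "compactin ?T (PiE {..<K} (\<lambda>_. {-M..M}))"
    by (subst compactin_PiE) auto
  then have "compactin ?T (ext_configs q zp zm K \<inter> PiE {..<K} (\<lambda>_. {-M..M}))"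
    by (rule closed_Int_compactin[OF closedin_ext_configs])
  also have "ext_configs q zp zm K \<inter> PiE {..<K} (\<lambda>_. {-M..M}) = ?S"
  proof -
    have "Y \<in> extensional {..<K}" if "Y \<in> ext_configs q zp zm K" for Y
      using that ext_configs_subset_cone[of q zp zm K] by (auto simp: cone_def PiE_def)
    then show ?thesis
      unfolding bounded_ext_configs_def PiE_iff abs_le_iff minus_le_iff[of _ M]
      by auto (metis extensional_arb lessThan_iff)
  qed
  finally have S: "compactin ?T ?S" .
  have "continuous_map ?T (product_topology (\<lambda>_. euclideanreal) UNIV) (\<lambda>x. x)"
    unfolding continuous_map_componentwise_UNIV
  proof
    fix k show "continuous_map ?T euclideanreal (\<lambda>x. x k)"
    proof (cases "k < K")
      case True
      then show ?thesis by (intro continuous_map_product_projection) auto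
    next
      case False
      have "continuous_map ?T euclideanreal (\<lambda>_. undefined)" by simp
      then show ?thesis by (rule continuous_map_eq) (use False in \<open>auto simp: PiE_def extensional_def\<close>)
    qed
  qed
  from image_compactin[OF S this] show ?thesis by (simp add: euclidean_product_topology)
qed

lemma continuous_on_bounded_ext_configs:
  assumes "continuous_map (ext_configs_topology q zp zm K) euclideanreal f"
  shows "continuous_on (bounded_ext_configs q zp zm K M) f"
proof -
  let ?S = "bounded_ext_configs q zp zm K M"
  have S: "?S \<subseteq> ext_configs q zp zm K" "?S \<subseteq> cone K"
    using ext_configs_subset_cone[of q zp zm K] by (auto simp: bounded_ext_configs_def)
  have "continuous_map (top_of_set ?S) (powertop_real {..<K}) (\<lambda>x. x)"
    unfolding continuous_map_componentwise
  proof
    show "(\<lambda>x. x) ` topspace (top_of_set ?S) \<subseteq> extensional {..<K}"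
      using S(2) by (auto simp: cone_def PiE_def)
    show "\<forall>k\<in>{..<K}. continuous_map (top_of_set ?S) euclideanreal (\<lambda>x. x k)"
      by (auto intro: continuous_on_subset[OF continuous_on_product_coordinates])
  qed
  then have "continuous_map (top_of_set ?S) (ext_configs_topology q zp zm K) (\<lambda>x. x)"
    using S by (auto simp: ext_configs_topology_def cone_topology_def continuous_map_in_subtopology)
  from continuous_map_compose[OF this assms] show ?thesis by (simp add: o_def)
qed

lemma schur_multiplier_approximation:
  assumes f: "continuous_map (ext_configs_topology q zp zm K) euclideanreal f" and "\<eta> > 0"
  obtains g where "schur_multiplier (ext_configs q zp zm K) K g"
    "\<And>Y. Y \<in> bounded_ext_configs q zp zm K M \<Longrightarrow> \<bar>f Y - g Y\<bar> < \<eta>"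
proof -
  let ?S = "bounded_ext_configs q zp zm K M"
  define R where "R = {g. continuous_on ?S g \<and> schur_multiplier (ext_configs q zp zm K) K g}"
  have elem: "elem_sym K r \<in> R" for r
  proof -
    have "continuous_map (ext_configs_topology q zp zm K) euclideanreal (elem_sym K r)"
      unfolding ext_configs_topology_def cone_topology_def
      by (intro continuous_map_from_subtopology continuous_map_elem_sym)
    then show ?thesis unfolding R_def
      using continuous_on_bounded_ext_configs schur_multiplier_elem_sym by blast
  qed
  interpret function_ring_on R ?S
  proof
    fix x y assume xy: "x \<in> ?S" "y \<in> ?S" "x \<noteq> y"
    then have "x \<in> cone K" "y \<in> cone K"
      using ext_configs_subset_cone[of q zp zm K] by (auto simp: bounded_ext_configs_def)
    then show "\<exists>f\<in>R. f x \<noteq> f y" using elem_sym_separates[of x K y] xy(3) elem by blast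
  qed (auto simp: R_def compact_bounded_ext_configs schur_multiplier_const
      intro: schur_multiplier_add schur_multiplier_mult continuous_on_add continuous_on_mult)
  obtain F where F: "F \<in> UNIV \<rightarrow> R" "LIM n sequentially. F n :> uniformly_on ?S f"
    using Stone_Weierstrass[OF continuous_on_bounded_ext_configs[OF f]] by blast
  from F(2) have "eventually (\<lambda>n. \<forall>x\<in>?S. dist (F n x) (f x) < \<eta>) sequentially"
    using assms(2) by (rule uniform_limitD)
  then obtain n where n: "\<forall>x\<in>?S. dist (F n x) (f x) < \<eta>" by (auto simp: eventually_sequentially)
  show thesis
  proof (rule that)
    show "schur_multiplier (ext_configs q zp zm K) K (F n)" using F(1) by (auto simp: R_def)
    show "Y \<in> ?S \<Longrightarrow> \<bar>f Y - F n Y\<bar> < \<eta>" for Y using n by (simp add: dist_real_def abs_minus_commute)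
  qed
qed

text \<open>On the compact set that carries the links of all subsets of \<open>[-R, R]\<close>,
  \<open>f\<close> is replaced by a multiplier \<open>g\<close> at the cost of
  \<open>\<eta> / 4\<close> for each configuration; the remaining \<open>\<eta> / 2\<close> is spent
  on the continuity of the expectation of \<open>g\<close>.\<close>

lemma kernel_eps_continuous:
  assumes q: "0 < q" "q < 1" and z: "zp > 0" "zm < 0"
    and link: "\<And>X. X \<in> inf_configs q zp zm \<Longrightarrow> is_link_measure q zp zm K X (\<Lambda> X)"
    and f: "continuous_map (ext_configs_topology q zp zm K) euclideanreal f"
  shows "eps_continuous q zp zm (kernel_op (ext_configs_topology q zp zm K) \<Lambda> f)"
  unfolding eps_continuous_def
proof (intro ballI allI impI)
  fix X \<eta> assume X: "X \<in> inf_configs q zp zm" and \<eta>: "(0::real) < \<eta>"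
  let ?E = "ext_configs q zp zm K" and ?A = "kernel_op (ext_configs_topology q zp zm K) \<Lambda> f"
  obtain R where R: "R \<ge> 1" "X \<subseteq> bounded_lattice q zp zm R" using inf_configs_bounded[OF q z X] .
  define M where "M = support_bound K (\<Sum>\<^sub>\<infinity>x\<in>bounded_lattice q zp zm R. \<bar>x\<bar>)"
  obtain g where g: "schur_multiplier ?E K g" "\<And>Y. Y \<in> bounded_ext_configs q zp zm K M \<Longrightarrow> \<bar>f Y - g Y\<bar> < \<eta> / 4"
    using schur_multiplier_approximation[OF f, of "\<eta> / 4" M] \<eta> by auto
  obtain V where V: "eps_continuous q zp zm V"
    "\<And>X p. is_link_measure q zp zm K X p \<Longrightarrow> pairs_to q zp zm K p g (V X)"
    using schur_span_pairs_to[OF q z schur_multiplier_imp_span[OF g(1)]] by blast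
  have approx: "\<bar>?A Z - V Z\<bar> \<le> \<eta> / 4" if Z: "Z \<subseteq> bounded_lattice q zp zm R" for Z
  proof -
    have "Z \<in> inf_configs q zp zm" by (rule bounded_lattice_configs[OF q z Z])
    note lZ = link[OF this]
    have supp: "set_pmf (\<Lambda> Z) \<subseteq> ?E" using lZ by (simp add: is_link_measure_def)
    have inS: "Y \<in> bounded_ext_configs q zp zm K M" if "Y \<in> ?E" "pmf (\<Lambda> Z) Y > 0" for Y
      using link_support_bound[OF q z Z lZ that] that by (simp add: bounded_ext_configs_def M_def)
    have "\<exists>B. \<forall>Y\<in>bounded_ext_configs q zp zm K M. \<bar>f Y\<bar> \<le> B"
      using compact_imp_bounded[OF compact_continuous_image[OF continuous_on_bounded_ext_configs[OF f]
            compact_bounded_ext_configs]] by (auto simp: bounded_iff)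
    then obtain B where B: "\<And>Y. Y \<in> bounded_ext_configs q zp zm K M \<Longrightarrow> \<bar>f Y\<bar> \<le> B" by blast
    have pf: "pairs_to q zp zm K (\<Lambda> Z) f (?A Z)"
      unfolding kernel_op_def topspace_ext_configs_topology using B inS by (intro pairs_to_bounded[OF supp]) auto
    have fg: "f Y \<le> g Y + \<eta> / 4 \<and> g Y \<le> f Y + \<eta> / 4" if "Y \<in> ?E" "pmf (\<Lambda> Z) Y > 0" for Y
      using g(2)[OF inS[OF that]] by linarith
    note pg = V(2)[OF lZ] and pc = pairs_to_const[OF supp, of "\<eta> / 4"]
    have "?A Z \<le> V Z + \<eta> / 4"
      by (rule pairs_to_mono[OF pf pairs_to_add[OF pg pc]]) (use fg in force)
    moreover have "V Z \<le> ?A Z + \<eta> / 4"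
      by (rule pairs_to_mono[OF pg pairs_to_add[OF pf pc]]) (use fg in force)
    ultimately show ?thesis by linarith
  qed
  obtain \<epsilon> where \<epsilon>: "\<epsilon> > 0" "\<And>Y. Y \<in> inf_configs q zp zm \<Longrightarrow> eps_close \<epsilon> X Y \<Longrightarrow> \<bar>V X - V Y\<bar> < \<eta> / 2"
    using eps_continuousD[OF V(1) X, of "\<eta> / 2"] \<eta> by auto
  show "\<exists>\<epsilon>>0. \<forall>Y\<in>inf_configs q zp zm. eps_close \<epsilon> X Y \<longrightarrow> \<bar>?A X - ?A Y\<bar> < \<eta>"
  \<comment> \<open>The minimum with 1 keeps \<open>Y\<close> inside \<open>[-R, R]\<close>, where
    the approximation by \<open>g\<close> is valid.\<close>
  proof (intro exI[of _ "min \<epsilon> 1"] conjI ballI impI)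
    fix Y assume Y: "Y \<in> inf_configs q zp zm" and cl: "eps_close (min \<epsilon> 1) X Y"
    have YR: "Y \<subseteq> bounded_lattice q zp zm R"
      using eps_close_bounded[OF Y R(2) cl] R(1) by simp
    have "\<bar>V X - V Y\<bar> < \<eta> / 2" using \<epsilon>(2)[OF Y eps_close_mono[OF cl]] by simp
    then show "\<bar>?A X - ?A Y\<bar> < \<eta>" using approx[OF R(2)] approx[OF YR] \<eta> by linarith
  qed (use \<epsilon>(1) in simp)
qed

section \<open>Divided differences\<close>

lemma complete_sym_1: "complete_sym (Suc 0) n x = x 0 ^ n"
  by (induction n) (simp_all add: complete_sym_Suc)

text \<open>The divided difference of \<open>P\<close> at the \<open>k + 1\<close> points \<open>Y 0, \<dots>, Y k\<close>, in a form
  which remains meaningful for multiple points.\<close>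

definition divided_diff :: "nat \<Rightarrow> (nat \<Rightarrow> real) \<Rightarrow> real poly \<Rightarrow> real" where
  "divided_diff k Y P = (\<Sum>n\<le>Polynomial.degree P. Polynomial.coeff P (n + k) * complete_sym (Suc k) n Y)"

lemma divided_diff_eq:
  assumes "Polynomial.degree P \<le> N"
  shows "divided_diff k Y P = (\<Sum>n\<le>N. Polynomial.coeff P (n + k) * complete_sym (Suc k) n Y)"
  unfolding divided_diff_def using assms
  by (intro sum.mono_neutral_left) (auto simp: coeff_eq_0)

lemma divided_diff_add: "divided_diff k Y (P + Q) = divided_diff k Y P + divided_diff k Y Q"
proof -
  let ?N = "max (Polynomial.degree P) (Polynomial.degree Q)"
  have "Polynomial.degree (P + Q) \<le> ?N" by (rule degree_add_le_max)
  then show ?thesis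
    using divided_diff_eq[of P ?N k Y] divided_diff_eq[of Q ?N k Y] divided_diff_eq[of "P + Q" ?N k Y]
    by (simp add: sum.distrib distrib_right)
qed

lemma divided_diff_smult: "divided_diff k Y (Polynomial.smult c P) = c * divided_diff k Y P"
  using divided_diff_eq[of "Polynomial.smult c P" "Polynomial.degree P" k Y]
  by (simp add: degree_smult_le divided_diff_def sum_distrib_left mult.assoc)

lemma divided_diff_monom: "divided_diff k Y (Polynomial.monom c k) = c"
proof -
  have "divided_diff k Y (Polynomial.monom c k) =
      (\<Sum>n\<le>k. Polynomial.coeff (Polynomial.monom c k) (n + k) * complete_sym (Suc k) n Y)"
    by (rule divided_diff_eq) (simp add: degree_monom_le)
  also have "\<dots> = (\<Sum>n\<le>k. if n = 0 then c else 0)" by (intro sum.cong) auto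
  finally show ?thesis by simp
qed

lemma divided_diff_0: "divided_diff 0 Y P = poly P (Y 0)"
  by (simp add: divided_diff_def complete_sym_1 poly_altdef)

text \<open>\<open>synthetic_div P c\<close> is the quotient \<open>(P(z) - P(c)) / (z - c)\<close>,
  so this is the classical recursion. In coefficients, \<open>P_(j+1) = S_j - c S_(j+1)\<close>, and
  the sum telescopes by the recursion that splits off the last variable.\<close>

lemma divided_diff_Suc: "divided_diff (Suc k) Y P = divided_diff k Y (synthetic_div P (Y (Suc k)))"
proof -
  define c S N where "c = Y (Suc k)" and "S = synthetic_div P c" and "N = Polynomial.degree P"
  have "P + Polynomial.smult c S = pCons (poly P c) S" unfolding S_def by (rule synthetic_div_correct)
  then have "Polynomial.coeff (P + Polynomial.smult c S) (Suc j) = Polynomial.coeff S j" for j by simp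
  then have co: "Polynomial.coeff P (Suc j) = Polynomial.coeff S j - c * Polynomial.coeff S (Suc j)" for j
    by (simp add: algebra_simps)
  have dS: "Polynomial.degree S \<le> N" by (simp add: S_def N_def degree_synthetic_div)
  let ?H = "\<lambda>n. complete_sym (Suc (Suc k)) n Y" and ?h = "\<lambda>n. complete_sym (Suc k) n Y"
  have zero: "Polynomial.coeff S (Suc N + k) = 0" using dS by (intro coeff_eq_0) simp
  have "divided_diff (Suc k) Y P =
      (\<Sum>n\<le>N. (Polynomial.coeff S (n + k) - c * Polynomial.coeff S (Suc n + k)) * ?H n)"
    by (simp add: divided_diff_def N_def co)
  also have "\<dots> = (\<Sum>n\<le>N. Polynomial.coeff S (n + k) * ?H n) - (\<Sum>n\<le>N. Polynomial.coeff S (Suc n + k) * (c * ?H n))"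
    by (simp add: sum_subtractf[symmetric] algebra_simps)
  also have "(\<Sum>n\<le>N. Polynomial.coeff S (n + k) * ?H n) =
      Polynomial.coeff S k + (\<Sum>n\<le>N. Polynomial.coeff S (Suc n + k) * ?H (Suc n))"
  proof -
    have "(\<Sum>n\<le>N. Polynomial.coeff S (n + k) * ?H n) = (\<Sum>n\<le>Suc N. Polynomial.coeff S (n + k) * ?H n)"
      using zero by simp
    also have "\<dots> = Polynomial.coeff S k + (\<Sum>n\<le>N. Polynomial.coeff S (Suc n + k) * ?H (Suc n))"
      by (subst sum.atMost_Suc_shift) simp
    finally show ?thesis .
  qed
  also have "Polynomial.coeff S k + (\<Sum>n\<le>N. Polynomial.coeff S (Suc n + k) * ?H (Suc n)) -
      (\<Sum>n\<le>N. Polynomial.coeff S (Suc n + k) * (c * ?H n)) =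
      Polynomial.coeff S k + (\<Sum>n\<le>N. Polynomial.coeff S (Suc n + k) * ?h (Suc n))"
    by (simp add: complete_sym_Suc[of "Suc k"] c_def sum.distrib distrib_left)
  also have "\<dots> = (\<Sum>n\<le>Suc N. Polynomial.coeff S (n + k) * ?h n)"
    by (subst sum.atMost_Suc_shift) simp
  also have "\<dots> = divided_diff k Y S" using dS by (intro divided_diff_eq[symmetric]) simp
  finally show ?thesis by (simp add: S_def c_def)
qed

lemma higher_pderiv_linear_mult:
  fixes S :: "real poly"
  shows "(pderiv ^^ Suc n) ([:- c, 1:] * S) =
    [:- c, 1:] * (pderiv ^^ Suc n) S + Polynomial.smult (real (Suc n)) ((pderiv ^^ n) S)"
proof (induction n)
  case 0
  show ?case by (simp only: funpow.simps o_apply id_apply pderiv_mult) (simp add: pderiv_pCons)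
next
  case (Suc n)
  have "(pderiv ^^ Suc (Suc n)) ([:- c, 1:] * S) =
      pderiv ([:- c, 1:] * (pderiv ^^ Suc n) S + Polynomial.smult (real (Suc n)) ((pderiv ^^ n) S))"
    unfolding Suc[symmetric] by simp
  also have "\<dots> = [:- c, 1:] * (pderiv ^^ Suc (Suc n)) S + (pderiv ^^ Suc n) S
      + Polynomial.smult (real (Suc n)) ((pderiv ^^ Suc n) S)"
    by (simp only: pderiv_add pderiv_mult pderiv_smult) (simp add: pderiv_pCons)
  also have "\<dots> = [:- c, 1:] * (pderiv ^^ Suc (Suc n)) S
      + Polynomial.smult (1 + real (Suc n)) ((pderiv ^^ Suc n) S)"
    by (simp only: smult_add_left smult_1_left add.assoc)
  finally show ?case by (simp only: of_nat_Suc)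
qed

text \<open>Let \<open>R\<close> be the \<open>k\<close>-th derivative of the quotient. Then
  \<open>(z - c)^(k+1) R(z)\<close> has the derivative \<open>(z - c)^k P^(k+1)(z)\<close>, and the
  mean value theorem expresses \<open>R(z)\<close> as a nonnegative multiple of
  \<open>P^(k+1)\<close> at an intermediate point.\<close>

lemma synthetic_div_higher_deriv_nonneg:
  fixes P :: "real poly"
  assumes P: "\<And>z. a \<le> z \<Longrightarrow> z \<le> b \<Longrightarrow> 0 \<le> poly ((pderiv ^^ Suc k) P) z"
    and c: "a \<le> c" "c \<le> b" and z: "a \<le> z" "z \<le> b"
  shows "0 \<le> poly ((pderiv ^^ k) (synthetic_div P c)) z"
proof -
  define S where "S = synthetic_div P c"
  define R where "R = (pderiv ^^ k) S"
  have P_eq: "P = [:- c, 1:] * S + [:poly P c:]"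
    using synthetic_div_correct'[of c P] by (simp add: S_def)
  have const: "(pderiv ^^ Suc k) [:poly P c:] = 0" by (simp only: funpow_Suc_right o_apply) simp
  have eq: "(pderiv ^^ Suc k) P = [:- c, 1:] * pderiv R + Polynomial.smult (real (Suc k)) R"
    unfolding R_def by (subst P_eq) (simp only: higher_pderiv_add const higher_pderiv_linear_mult, simp)
  then have PR: "poly ((pderiv ^^ Suc k) P) t = (t - c) * poly (pderiv R) t + real (Suc k) * poly R t" for t
    unfolding eq by (simp add: algebra_simps)
  show ?thesis
  proof (cases "z = c")
    case True
    then have "0 \<le> real (Suc k) * poly R z" using PR[of z] P[OF z] by simp
    then show ?thesis by (simp add: R_def S_def zero_le_mult_iff)
  next
    case False
    define \<phi> where "\<phi> t = (t - c) ^ Suc k * poly R t" for t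
    have der: "DERIV \<phi> t :> (t - c) ^ k * poly ((pderiv ^^ Suc k) P) t" for t
      unfolding \<phi>_def PR by (rule derivative_eq_intros refl)+ (simp add: algebra_simps)
    obtain \<xi> where \<xi>: "min z c < \<xi>" "\<xi> < max z c"
      "\<phi> z - \<phi> c = (z - c) * ((\<xi> - c) ^ k * poly ((pderiv ^^ Suc k) P) \<xi>)"
    proof (cases "z < c")
      case True
      from MVT2[OF this der] obtain \<xi> where "z < \<xi>" "\<xi> < c"
        "\<phi> c - \<phi> z = (c - z) * ((\<xi> - c) ^ k * poly ((pderiv ^^ Suc k) P) \<xi>)" by blast
      moreover from this(3) have "\<phi> z - \<phi> c = (z - c) * ((\<xi> - c) ^ k * poly ((pderiv ^^ Suc k) P) \<xi>)"
        by (simp add: algebra_simps)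
      ultimately show thesis using True by (intro that) auto
    next
      case False
      with \<open>z \<noteq> c\<close> have "c < z" by simp
      from MVT2[OF this der] obtain \<xi> where "c < \<xi>" "\<xi> < z"
        "\<phi> z - \<phi> c = (z - c) * ((\<xi> - c) ^ k * poly ((pderiv ^^ Suc k) P) \<xi>)" by blast
      then show thesis using \<open>c < z\<close> by (intro that) auto
    qed
    have "(z - c) * ((z - c) ^ k * poly R z) = (z - c) * ((\<xi> - c) ^ k * poly ((pderiv ^^ Suc k) P) \<xi>)"
      using \<xi>(3) by (simp add: \<phi>_def mult.assoc)
    then have "(z - c) ^ k * poly R z = (\<xi> - c) ^ k * poly ((pderiv ^^ Suc k) P) \<xi>"
      using False by simp
    then have "poly R z = ((\<xi> - c) / (z - c)) ^ k * poly ((pderiv ^^ Suc k) P) \<xi>"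
      using False by (simp add: power_divide field_simps)
    moreover have "0 \<le> (\<xi> - c) / (z - c)" using \<xi>(1,2) False by (auto simp: zero_le_divide_iff min_def max_def split: if_splits)
    moreover have "0 \<le> poly ((pderiv ^^ Suc k) P) \<xi>" using \<xi>(1,2) c z by (intro P) auto
    ultimately show ?thesis by (simp add: R_def S_def)
  qed
qed

text \<open>Removing the points one at a time, each synthetic division lowers the order of the
  nonnegative derivative by one. Coinciding points need no special treatment.\<close>

lemma divided_diff_nonneg:
  assumes "\<And>z. a \<le> z \<Longrightarrow> z \<le> b \<Longrightarrow> 0 \<le> poly ((pderiv ^^ k) P) z"
    and "\<And>i. i \<le> k \<Longrightarrow> a \<le> Y i \<and> Y i \<le> b"
  shows "0 \<le> divided_diff k Y P"
  using assms
proof (induction k arbitrary: P)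
  case 0
  then show ?case by (simp add: divided_diff_0)
next
  case (Suc k)
  show ?case unfolding divided_diff_Suc
    using Suc.prems by (intro Suc.IH synthetic_div_higher_deriv_nonneg[of a b]) auto
qed

lemma higher_pderiv_monom_same: "(pderiv ^^ k) (Polynomial.monom c k) = [:fact k * (c::real):]"
  by (rule poly_eqI) (simp add: coeff_higher_pderiv pochhammer_fact coeff_pCons split: nat.split)

text \<open>Subtracting \<open>(c / k!) z^k\<close> lowers the \<open>k\<close>-th derivative by
  \<open>c\<close> and the divided difference by \<open>c / k!\<close>, which reduces the bound to
  nonnegativity.\<close>

lemma divided_diff_ge:
  assumes "\<And>z. a \<le> z \<Longrightarrow> z \<le> b \<Longrightarrow> c \<le> poly ((pderiv ^^ k) P) z"
    and "\<And>i. i \<le> k \<Longrightarrow> a \<le> Y i \<and> Y i \<le> b"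
  shows "c / fact k \<le> divided_diff k Y P"
proof -
  have "0 \<le> divided_diff k Y (P + Polynomial.monom (- (c / fact k)) k)"
    by (rule divided_diff_nonneg[OF _ assms(2)])
      (use assms(1) in \<open>simp_all add: higher_pderiv_add higher_pderiv_monom_same\<close>)
  then show ?thesis by (simp add: divided_diff_add divided_diff_monom)
qed

lemma divided_diff_abs_le:
  assumes "\<And>z. a \<le> z \<Longrightarrow> z \<le> b \<Longrightarrow> \<bar>poly ((pderiv ^^ k) P) z\<bar> \<le> c"
    and "\<And>i. i \<le> k \<Longrightarrow> a \<le> Y i \<and> Y i \<le> b"
  shows "\<bar>divided_diff k Y P\<bar> \<le> c / fact k"
proof -
  have "(- c) / fact k \<le> divided_diff k Y P"
    by (rule divided_diff_ge[OF _ assms(2)]) (use assms(1) in \<open>force simp: abs_le_iff\<close>)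
  moreover have "(- c) / fact k \<le> divided_diff k Y (Polynomial.smult (-1) P)"
  proof (rule divided_diff_ge[OF _ assms(2)])
    fix z assume "a \<le> z" "z \<le> b"
    from assms(1)[OF this] show "- c \<le> poly ((pderiv ^^ k) (Polynomial.smult (-1) P)) z"
      unfolding higher_pderiv_smult poly_smult by linarith
  qed
  ultimately show ?thesis unfolding divided_diff_smult by linarith
qed

section \<open>Vanishing at infinity\<close>

text \<open>The coefficient relation says \<open>F(z) - F(q z) = z G(z)\<close> for the part of
  \<open>F\<close> without constant term. Hence \<open>G\<close> is the integral of
  \<open>F'(s z)\<close> over \<open>s\<close> from \<open>q\<close> to 1, and its
  \<open>k\<close>-th derivative is the integral of \<open>s^k w(s z)\<close>; the intermediate
  value \<open>\<xi>\<close> comes from this integral.\<close>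

lemma antiderivative_polynomials:
  fixes w :: "real poly" and q :: real
  assumes q: "0 < q" "q < 1"
  obtains F G :: "real poly" where
    "\<And>m. Polynomial.coeff F (Suc m) * (1 - q ^ Suc m) = Polynomial.coeff G m"
    "Polynomial.coeff F k = 0"
    "pderiv ((pderiv ^^ k) F) = w" "poly ((pderiv ^^ k) F) 0 = 0"
    "\<And>z. \<exists>\<xi>. q < \<xi> \<and> \<xi> < 1 \<and> poly ((pderiv ^^ k) G) z = (1 - q) * \<xi> ^ k * poly w (\<xi> * z)"
proof -
  define d where "d = Polynomial.degree w"
  \<comment> \<open>Integrating \<open>w\<close> termwise \<open>k + 1\<close> times divides the
    coefficient \<open>j\<close> by the rising factorial \<open>(j + 1) ... (j + k + 1)\<close>; all
    constants of integration are zero.\<close>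
  define F where "F = (\<Sum>j\<le>d. Polynomial.monom (Polynomial.coeff w j / pochhammer (real (Suc j)) (Suc k)) (j + Suc k))"
  define G where "G = (\<Sum>m\<le>Polynomial.degree F. Polynomial.monom (Polynomial.coeff F (Suc m) * (1 - q ^ Suc m)) m)"
  have poch: "pochhammer (real (Suc j)) n \<noteq> 0" for j n
    using pochhammer_pos[of "real (Suc j)" n] by simp
  have F1: "Polynomial.coeff F (j + Suc k) = Polynomial.coeff w j / pochhammer (real (Suc j)) (Suc k)" for j
  proof -
    have "Polynomial.coeff F (j + Suc k) =
        (\<Sum>i\<le>d. if i = j then Polynomial.coeff w i / pochhammer (real (Suc i)) (Suc k) else 0)"
      unfolding F_def coeff_sum coeff_monom by (intro sum.cong) auto
    then show ?thesis by (simp add: d_def coeff_eq_0)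
  qed
  have F2: "Polynomial.coeff F k = 0" unfolding F_def coeff_sum coeff_monom by simp
  have G1: "Polynomial.coeff F (Suc m) * (1 - q ^ Suc m) = Polynomial.coeff G m" for m
    by (simp add: G_def coeff_sum coeff_eq_0)
  have dw: "pderiv ((pderiv ^^ k) F) = w"
  proof (rule poly_eqI)
    fix n
    have "Polynomial.coeff ((pderiv ^^ Suc k) F) n = Polynomial.coeff w n"
      unfolding coeff_higher_pderiv F1 using poch[of n "Suc k"] by simp
    then show "Polynomial.coeff (pderiv ((pderiv ^^ k) F)) n = Polynomial.coeff w n" by simp
  qed
  have F0: "poly ((pderiv ^^ k) F) 0 = 0"
    by (simp add: poly_0_coeff_0 coeff_higher_pderiv F2)
  have Gk: "(pderiv ^^ k) G =
      (\<Sum>j\<le>d. Polynomial.monom (Polynomial.coeff w j * (1 - q ^ (j + Suc k)) / real (j + Suc k)) j)"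
  proof (rule poly_eqI)
    fix n
    have "Polynomial.coeff ((pderiv ^^ k) G) n =
        pochhammer (real (Suc n)) k * (Polynomial.coeff F (n + Suc k) * (1 - q ^ (n + Suc k)))"
      using G1[of "n + k"] by (simp add: coeff_higher_pderiv)
    also have "\<dots> = Polynomial.coeff w n * (1 - q ^ (n + Suc k)) / real (n + Suc k)"
    proof -
      have "real (Suc n) + real k = real (n + Suc k)" by simp
      then have "pochhammer (real (Suc n)) (Suc k) = pochhammer (real (Suc n)) k * real (n + Suc k)"
        by (simp only: pochhammer_Suc)
      moreover have "P * (c / (P * r) * g) = c * g / r" if "P \<noteq> 0" for P c r g :: real
        using that by simp
      ultimately show ?thesis unfolding F1 using poch[of n k] by simp
    qed
    finally show "Polynomial.coeff ((pderiv ^^ k) G) n = Polynomial.coeff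
        (\<Sum>j\<le>d. Polynomial.monom (Polynomial.coeff w j * (1 - q ^ (j + Suc k)) / real (j + Suc k)) j) n"
      by (simp add: coeff_sum d_def coeff_eq_0)
  qed
  have "\<exists>\<xi>. q < \<xi> \<and> \<xi> < 1 \<and> poly ((pderiv ^^ k) G) z = (1 - q) * \<xi> ^ k * poly w (\<xi> * z)" for z
  proof -
    \<comment> \<open>An antiderivative of \<open>s^k w(s z)\<close> in the variable
      \<open>s\<close>, with \<open>z\<close> fixed.\<close>
    define \<psi> where "\<psi> s = (\<Sum>j\<le>d. Polynomial.coeff w j * z ^ j / real (j + Suc k) * s ^ (j + Suc k))" for s
    have der: "DERIV \<psi> s :> s ^ k * poly w (s * z)" for s
    proof -
      have "DERIV \<psi> s :> (\<Sum>j\<le>d. Polynomial.coeff w j * z ^ j / real (j + Suc k) * (real (j + Suc k) * s ^ (j + k)))"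
        unfolding \<psi>_def by (intro DERIV_sum DERIV_cmult) (use DERIV_pow[of "_ + Suc k" s] in simp)
      moreover have "(\<Sum>j\<le>d. Polynomial.coeff w j * z ^ j / real (j + Suc k) * (real (j + Suc k) * s ^ (j + k))) =
          s ^ k * poly w (s * z)"
        unfolding poly_altdef d_def[symmetric] sum_distrib_left
        by (intro sum.cong refl) (simp add: power_add power_mult_distrib)
      ultimately show ?thesis by simp
    qed
    obtain \<xi> where "q < \<xi>" "\<xi> < 1" "\<psi> 1 - \<psi> q = (1 - q) * (\<xi> ^ k * poly w (\<xi> * z))"
      using MVT2[OF q(2) der] by blast
    moreover have "\<psi> 1 - \<psi> q = poly ((pderiv ^^ k) G) z"
      unfolding Gk \<psi>_def poly_sum poly_monom sum_subtractf[symmetric]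
      by (intro sum.cong refl) (simp add: left_diff_distrib right_diff_distrib diff_divide_distrib)
    ultimately show ?thesis by (intro exI[of _ \<xi>]) (simp add: mult.assoc)
  qed
  with G1 F2 dw F0 show thesis by (rule that)
qed

text \<open>With \<open>t = u^2 / N\<close>, the upper bound follows from
  \<open>(1 - t)^N (1 + t)^N \<le> 1\<close> and Bernoulli's inequality
  \<open>1 + u^2 \<le> (1 + t)^N\<close>; the lower one is Bernoulli's inequality for
  \<open>- t\<close>. The majorant is the derivative of the arctangent.\<close>

lemma bump_polynomial_bounds:
  fixes u :: real
  assumes N: "N \<ge> 1" and u: "u\<^sup>2 \<le> real N"
  shows "0 \<le> (1 - u\<^sup>2 / real N) ^ N" "(1 - u\<^sup>2 / real N) ^ N \<le> 1 / (1 + u\<^sup>2)"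
    "1 - u\<^sup>2 \<le> (1 - u\<^sup>2 / real N) ^ N"
proof -
  define t where "t = u\<^sup>2 / real N"
  have t: "0 \<le> t" "t \<le> 1" "real N * t = u\<^sup>2" using assms by (auto simp: t_def)
  show "0 \<le> (1 - u\<^sup>2 / real N) ^ N" using t by (simp add: t_def[symmetric])
  have "(1 - t) ^ N * (1 + t) ^ N = (1 - t\<^sup>2) ^ N"
    by (simp add: power_mult_distrib[symmetric] algebra_simps power2_eq_square)
  also have "\<dots> \<le> 1" using t by (intro power_le_one) (auto simp: power_le_one)
  finally have "(1 - t) ^ N * (1 + t) ^ N \<le> 1" .
  moreover have "1 + u\<^sup>2 \<le> (1 + t) ^ N" using Bernoulli_inequality[of t N] t by simp
  ultimately have "(1 - t) ^ N * (1 + u\<^sup>2) \<le> 1"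
    using t by (meson mult_left_mono order_trans zero_le_power diff_ge_0_iff_ge)
  then show "(1 - u\<^sup>2 / real N) ^ N \<le> 1 / (1 + u\<^sup>2)"
    by (simp add: t_def[symmetric] pos_le_divide_eq add_pos_nonneg)
  show "1 - u\<^sup>2 \<le> (1 - u\<^sup>2 / real N) ^ N"
    using Bernoulli_inequality[of "- t" N] t by (simp add: t_def[symmetric])
qed

text \<open>If \<open>z G(z) = F(z) - F(q z)\<close>, then \<open>a\<close> times the expectation of the divided difference of \<open>G\<close>
  is a difference of expectations for \<open>F\<close> (lemma \<open>poly_moment_remove\<close> below). So we need a bounded
  \<open>k\<close>-th derivative of \<open>F\<close> for which the \<open>k\<close>-th derivative of \<open>G\<close> is nonnegative, and not small
  near the origin: a polynomial approximation to the arctangent.\<close>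

lemma test_polynomials:
  fixes q B M :: real
  assumes q: "0 < q" "q < 1" and B: "B > 0"
  obtains F G :: "real poly" where
    "\<And>m. Polynomial.coeff F (Suc m) * (1 - q ^ Suc m) = Polynomial.coeff G m"
    "Polynomial.coeff F k = 0"
    "\<And>z. \<bar>z\<bar> \<le> M \<Longrightarrow> \<bar>poly ((pderiv ^^ k) F) z\<bar> \<le> B * pi"
    "\<And>z. \<bar>z\<bar> \<le> M \<Longrightarrow> 0 \<le> poly ((pderiv ^^ k) G) z"
    "\<And>z. \<bar>z\<bar> \<le> B \<Longrightarrow> (1 - q) * q ^ k / 2 \<le> poly ((pderiv ^^ k) G) z"
proof -
  \<comment> \<open>The scale \<open>2 B\<close> makes the bump at least 3/4 on
    \<open>[-B, B]\<close>, while \<open>D arctan(z / D)\<close> stays below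
    \<open>D pi / 2 = B pi\<close>.\<close>
  define D where "D = 2 * B"
  have D: "D > 0" using B by (simp add: D_def)
  \<comment> \<open>The degree must grow with \<open>M\<close> to keep \<open>[-M, M]\<close> within
    the range of the bump estimates; the bounds obtained do not change with it.\<close>
  obtain N0 where N0: "(max M B / D)\<^sup>2 \<le> real N0" using real_arch_simple by blast
  define N where "N = Suc N0"
  have N: "N \<ge> 1" "(max M B / D)\<^sup>2 \<le> real N" using N0 by (auto simp: N_def)
  define w where "w = [:1, 0, - (1 / (D\<^sup>2 * real N)):] ^ N"
  have pw: "poly w z = (1 - (z / D)\<^sup>2 / real N) ^ N" for z
    using D N by (simp add: w_def poly_power power2_eq_square field_simps)
  have small: "(z / D)\<^sup>2 \<le> real N" if "\<bar>z\<bar> \<le> max M B" for z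
  proof -
    have "\<bar>z / D\<bar> \<le> \<bar>max M B / D\<bar>" using that D by (simp add: divide_right_mono)
    then have "(z / D)\<^sup>2 \<le> (max M B / D)\<^sup>2" by (simp only: abs_le_square_iff)
    then show ?thesis using N(2) by linarith
  qed
  have w0: "0 \<le> poly w z" and w1: "poly w z \<le> 1 / (1 + (z / D)\<^sup>2)" and w2: "1 - (z / D)\<^sup>2 \<le> poly w z"
    if "\<bar>z\<bar> \<le> max M B" for z
    unfolding pw using bump_polynomial_bounds[OF N(1) small[OF that]] by auto
  obtain F G where FG:
    "\<And>m. Polynomial.coeff F (Suc m) * (1 - q ^ Suc m) = Polynomial.coeff G m"
    "Polynomial.coeff F k = 0"
    "pderiv ((pderiv ^^ k) F) = w" "poly ((pderiv ^^ k) F) 0 = 0"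
    "\<And>z. \<exists>\<xi>. q < \<xi> \<and> \<xi> < 1 \<and> poly ((pderiv ^^ k) G) z = (1 - q) * \<xi> ^ k * poly w (\<xi> * z)"
    using antiderivative_polynomials[OF q] by blast
  define A where "A = (\<lambda>z. poly ((pderiv ^^ k) F) z)"
  \<comment> \<open>\<open>A\<close> and \<open>H\<close> are both nondecreasing on
    \<open>[-M, M]\<close> and vanish at 0, so \<open>A\<close> lies between 0 and
    \<open>D arctan(z / D)\<close>.\<close>
  define H where "H z = D * arctan (z / D) - A z" for z
  have dA: "DERIV A z :> poly w z" for z unfolding A_def FG(3)[symmetric] by (rule poly_DERIV)
  have dH: "DERIV H z :> 1 / (1 + (z / D)\<^sup>2) - poly w z" for z
  proof -
    have "DERIV (\<lambda>z. D * arctan (z / D)) z :> D * (inverse (1 + (z / D)\<^sup>2) * (1 / D))"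
      by (intro DERIV_cmult DERIV_chain2[OF DERIV_arctan] DERIV_cdivide DERIV_ident)
    moreover have "D * (inverse (1 + (z / D)\<^sup>2) * (1 / D)) = 1 / (1 + (z / D)\<^sup>2)"
      using D by (simp add: inverse_eq_divide)
    ultimately have "DERIV (\<lambda>z. D * arctan (z / D)) z :> 1 / (1 + (z / D)\<^sup>2)" by simp
    then show ?thesis unfolding H_def by (rule DERIV_diff) (rule dA)
  qed
  have A0: "A 0 = 0" "H 0 = 0" using FG(4) by (auto simp: A_def H_def)
  have A: "A a \<le> A b \<and> H a \<le> H b" if "a \<le> b" "\<bar>a\<bar> \<le> M" "\<bar>b\<bar> \<le> M" for a b
  proof
    show "A a \<le> A b"
    proof (rule DERIV_nonneg_imp_nondecreasing[OF that(1)])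
      fix x assume "a \<le> x" "x \<le> b"
      then have "\<bar>x\<bar> \<le> max M B" using that by linarith
      from w0[OF this] dA show "\<exists>y. DERIV A x :> y \<and> 0 \<le> y" by blast
    qed
    show "H a \<le> H b"
    proof (rule DERIV_nonneg_imp_nondecreasing[OF that(1)])
      fix x assume "a \<le> x" "x \<le> b"
      then have "\<bar>x\<bar> \<le> max M B" using that by linarith
      from w1[OF this] dH[of x] show "\<exists>y. DERIV H x :> y \<and> 0 \<le> y" by (metis diff_ge_0_iff_ge)
    qed
  qed
  have at: "\<bar>D * arctan (z / D)\<bar> \<le> B * pi" for z
  proof -
    have "\<bar>arctan (z / D)\<bar> \<le> pi / 2" using arctan_ubound[of "z / D"] arctan_lbound[of "z / D"] by simp
    then have "D * \<bar>arctan (z / D)\<bar> \<le> D * (pi / 2)" using D by (intro mult_left_mono) auto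
    then show ?thesis using D by (simp add: abs_mult D_def)
  qed
  have 1: "\<bar>poly ((pderiv ^^ k) F) z\<bar> \<le> B * pi" if "\<bar>z\<bar> \<le> M" for z
  proof (cases "0 \<le> z")
    case True
    then have "0 \<le> A z" "0 \<le> H z" using A[of 0 z] that A0 by auto
    then show ?thesis using at[of z] by (simp add: H_def A_def[symmetric])
  next
    case False
    then have "A z \<le> 0" "H z \<le> 0" using A[of z 0] that A0 by auto
    then show ?thesis using at[of z] by (simp add: H_def A_def[symmetric])
  qed
  have shrink: "\<bar>\<xi> * z\<bar> \<le> \<bar>z\<bar>" if "q < \<xi>" "\<xi> < 1" for \<xi> z :: real
    using that q by (simp add: abs_mult mult_left_le_one_le)
  have 2: "0 \<le> poly ((pderiv ^^ k) G) z" if z: "\<bar>z\<bar> \<le> M" for z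
  proof -
    obtain \<xi> where \<xi>: "q < \<xi>" "\<xi> < 1" "poly ((pderiv ^^ k) G) z = (1 - q) * \<xi> ^ k * poly w (\<xi> * z)"
      using FG(5) by blast
    have "0 \<le> poly w (\<xi> * z)" using shrink[OF \<xi>(1,2), of z] z by (intro w0) simp
    then show ?thesis using \<xi> q by simp
  qed
  have 3: "(1 - q) * q ^ k / 2 \<le> poly ((pderiv ^^ k) G) z" if z: "\<bar>z\<bar> \<le> B" for z
  proof -
    obtain \<xi> where \<xi>: "q < \<xi>" "\<xi> < 1" "poly ((pderiv ^^ k) G) z = (1 - q) * \<xi> ^ k * poly w (\<xi> * z)"
      using FG(5) by blast
    have le: "\<bar>\<xi> * z\<bar> \<le> B" using shrink[OF \<xi>(1,2), of z] z by simp
    then have "\<bar>\<xi> * z / D\<bar> \<le> 1 / 2" using B by (simp add: D_def divide_simps)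
    then have "(\<xi> * z / D)\<^sup>2 \<le> (1 / 2)\<^sup>2" by (metis abs_le_square_iff abs_of_nonneg zero_le_divide_1_iff zero_le_numeral)
    also have "(1 / 2 :: real)\<^sup>2 = 1 / 4" by (simp add: power2_eq_square)
    finally have "(\<xi> * z / D)\<^sup>2 \<le> 1 / 4" .
    moreover have "1 - (\<xi> * z / D)\<^sup>2 \<le> poly w (\<xi> * z)" by (rule w2) (use le in simp)
    ultimately have "1 / 2 \<le> poly w (\<xi> * z)" by linarith
    then have "q ^ k * (1 / 2) \<le> \<xi> ^ k * poly w (\<xi> * z)"
      using \<xi> q by (intro mult_mono power_mono) auto
    then have "(1 - q) * (q ^ k * (1 / 2)) \<le> (1 - q) * (\<xi> ^ k * poly w (\<xi> * z))"
      using q by (intro mult_left_mono) auto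
    then show ?thesis using \<xi> by (simp add: mult.assoc)
  qed
  show thesis by (rule that[OF FG(1,2) 1 2 3])
qed

section \<open>Removal of a point and the mass of bounded sets\<close>

lemma link_coeff_row_Suc:
  assumes q: "0 < q" "q < 1"
  shows "link_coeff q K (one_row (Suc n)) = (1 - q ^ (n + K)) * link_coeff q K (one_row n)"
proof -
  have "1 - q ^ Suc n > 0" using q by (simp add: power_less_one_iff del: power_Suc)
  then have "link_coeff q K (one_row (Suc n)) = ((1 - q ^ Suc n) * complete_sym K (Suc n) ((^) q)) /
      ((1 - q ^ Suc n) * tableau_series (one_row (Suc n)) ((^) q))"
    by (simp add: link_coeff_def complete_sym_def)
  also have "\<dots> = (1 - q ^ (n + K)) * link_coeff q K (one_row n)"
    unfolding complete_sym_geometric_Suc row_series_geometric_Suc[OF q] by (simp add: link_coeff_def complete_sym_def)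
  finally show ?thesis .
qed

text \<open>The expectation of \<open>h_n\<close> under the link of \<open>X\<close>, written as a
  function of \<open>X\<close> alone so that \<open>X\<close> and \<open>X - {a}\<close> can be
  compared.\<close>

definition row_moment :: "real \<Rightarrow> nat \<Rightarrow> real set \<Rightarrow> nat \<Rightarrow> real" where
  "row_moment q K X n = link_coeff q K (one_row n) * config_schur (one_row n) X"

lemma row_moment_remove:
  assumes q: "0 < q" "q < 1" and X: "countable X" "(\<lambda>x. \<bar>x\<bar>) summable_on X" and a: "a \<in> X"
  shows "row_moment q K X (Suc n) - row_moment q K (X - {a}) (Suc n) = a * (1 - q ^ (n + K)) * row_moment q K X n"
  unfolding row_moment_def link_coeff_row_Suc[OF q] config_schur_row_remove[OF X a]
  by (simp add: algebra_simps)

definition poly_moment :: "real \<Rightarrow> nat \<Rightarrow> real set \<Rightarrow> real poly \<Rightarrow> real" where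
  "poly_moment q k X P = (\<Sum>n\<le>Polynomial.degree P. Polynomial.coeff P (n + k) * row_moment q (Suc k) X n)"

lemma poly_moment_eq:
  "Polynomial.degree P \<le> N \<Longrightarrow>
    poly_moment q k X P = (\<Sum>n\<le>N. Polynomial.coeff P (n + k) * row_moment q (Suc k) X n)"
  unfolding poly_moment_def by (intro sum.mono_neutral_left) (auto simp: coeff_eq_0)

lemma pairs_to_divided_diff:
  assumes q: "0 < q" "q < 1" and link: "is_link_measure q zp zm (Suc k) X p"
  shows "pairs_to q zp zm (Suc k) p (\<lambda>Y. divided_diff k Y P) (poly_moment q k X P)"
proof -
  have "pairs_to q zp zm (Suc k) p (complete_sym (Suc k) n) (row_moment q (Suc k) X n)" for n
    using link_measure_schur[OF link q one_row_shapes[of "Suc k" n]]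
    by (simp add: row_moment_def complete_sym_def[abs_def])
  then show ?thesis unfolding divided_diff_def poly_moment_def
    by (intro pairs_to_sum pairs_to_cmult) simp_all
qed

text \<open>With \<open>K = k + 1\<close>, the factor \<open>1 - q ^ (n + K)\<close> in the removal
  of a point is exactly the factor by which the coefficient \<open>n + k\<close> of \<open>G\<close>
  differs from the coefficient \<open>n + k + 1\<close> of \<open>F\<close>.\<close>

lemma poly_moment_remove:
  assumes q: "0 < q" "q < 1" and X: "countable X" "(\<lambda>x. \<bar>x\<bar>) summable_on X" and a: "a \<in> X"
    and F: "\<And>m. Polynomial.coeff F (Suc m) * (1 - q ^ Suc m) = Polynomial.coeff G m" "Polynomial.coeff F k = 0"
  shows "poly_moment q k X F - poly_moment q k (X - {a}) F = a * poly_moment q k X G"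
proof -
  define N where "N = Polynomial.degree F + Polynomial.degree G"
  let ?v = "row_moment q (Suc k) X" and ?v' = "row_moment q (Suc k) (X - {a})"
  have "poly_moment q k X F - poly_moment q k (X - {a}) F =
      (\<Sum>n\<le>Suc N. Polynomial.coeff F (n + k) * (?v n - ?v' n))"
    using poly_moment_eq[of F "Suc N" q k X] poly_moment_eq[of F "Suc N" q k "X - {a}"]
    by (simp add: N_def sum_subtractf right_diff_distrib)
  also have "\<dots> = (\<Sum>n\<le>N. Polynomial.coeff F (Suc n + k) * (?v (Suc n) - ?v' (Suc n)))"
    by (subst sum.atMost_Suc_shift) (simp add: F(2))
  also have "\<dots> = (\<Sum>n\<le>N. a * (Polynomial.coeff G (n + k) * ?v n))"
  proof (intro sum.cong refl)
    fix n
    have "Polynomial.coeff F (Suc n + k) * (?v (Suc n) - ?v' (Suc n)) =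
        Polynomial.coeff F (Suc (n + k)) * (a * (1 - q ^ Suc (n + k)) * ?v n)"
      using row_moment_remove[OF q X a, of "Suc k" n] by simp
    also have "\<dots> = a * ((Polynomial.coeff F (Suc (n + k)) * (1 - q ^ Suc (n + k))) * ?v n)"
      by (simp only: mult_ac)
    finally show "Polynomial.coeff F (Suc n + k) * (?v (Suc n) - ?v' (Suc n)) = a * (Polynomial.coeff G (n + k) * ?v n)"
      unfolding F(1) .
  qed
  also have "\<dots> = a * poly_moment q k X G"
    using poly_moment_eq[of G N q k X] by (simp add: N_def sum_distrib_left)
  finally show ?thesis .
qed

text \<open>The test function for \<open>G\<close> is nonnegative on the support and at least
  \<open>(1 - q) q^k / (2 k!)\<close> on the box, while the two expectations for \<open>F\<close>
  are at most \<open>B pi / k!\<close> in absolute value. The factor \<open>k!\<close>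
  cancels.\<close>

lemma link_mass_bound:
  assumes q: "0 < q" "q < 1" and z: "zp > 0" "zm < 0" and B: "B > 0"
    and X: "X \<in> inf_configs q zp zm" and a: "a \<in> X"
    and p: "is_link_measure q zp zm (Suc k) X p" and p': "is_link_measure q zp zm (Suc k) (X - {a}) p'"
    and P: "pairs_to q zp zm (Suc k) p (\<lambda>Y. if \<forall>i\<le>k. \<bar>Y i\<bar> \<le> B then 1 else 0) v"
  shows "\<bar>a\<bar> * ((1 - q) * q ^ k * v) \<le> 4 * pi * B"
proof -
  obtain R where R: "X \<subseteq> bounded_lattice q zp zm R" using inf_configs_bounded[OF q z X] .
  \<comment> \<open>Removing a point does not leave the interval, so one \<open>M\<close> bounds the
    supports of both links.\<close>
  define M where "M = support_bound (Suc k) (\<Sum>\<^sub>\<infinity>x\<in>bounded_lattice q zp zm R. \<bar>x\<bar>)"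
  have R': "X - {a} \<subseteq> bounded_lattice q zp zm R" using R by blast
  obtain F G where FG:
    "\<And>m. Polynomial.coeff F (Suc m) * (1 - q ^ Suc m) = Polynomial.coeff G m"
    "Polynomial.coeff F k = 0"
    "\<And>z. \<bar>z\<bar> \<le> M \<Longrightarrow> \<bar>poly ((pderiv ^^ k) F) z\<bar> \<le> B * pi"
    "\<And>z. \<bar>z\<bar> \<le> M \<Longrightarrow> 0 \<le> poly ((pderiv ^^ k) G) z"
    "\<And>z. \<bar>z\<bar> \<le> B \<Longrightarrow> (1 - q) * q ^ k / 2 \<le> poly ((pderiv ^^ k) G) z"
    using test_polynomials[OF q B, of k M] by blast
  have Fbound: "\<bar>poly_moment q k Z F\<bar> \<le> B * pi / fact k"
    if Z: "Z \<subseteq> bounded_lattice q zp zm R" and r: "is_link_measure q zp zm (Suc k) Z r" for Z r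
  proof -
    have supp: "set_pmf r \<subseteq> ext_configs q zp zm (Suc k)" using r by (simp add: is_link_measure_def)
    have bd: "\<bar>divided_diff k Y F\<bar> \<le> B * pi / fact k"
      if "Y \<in> ext_configs q zp zm (Suc k)" "pmf r Y > 0" for Y
    proof (rule divided_diff_abs_le[of "- M" M])
      show "- M \<le> Y i \<and> Y i \<le> M" if "i \<le> k" for i
        using link_support_bound[OF q z Z r \<open>Y \<in> _\<close> \<open>pmf r Y > 0\<close>, of i] that by (simp add: M_def abs_le_iff)
    qed (use FG(3) in auto)
    note pd = pairs_to_divided_diff[OF q r, of F]
    have "poly_moment q k Z F \<le> B * pi / fact k"
      by (rule pairs_to_mono[OF pd pairs_to_const[OF supp]]) (use bd in \<open>force simp: abs_le_iff\<close>)
    moreover have "- (B * pi / fact k) \<le> poly_moment q k Z F"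
      by (rule pairs_to_mono[OF pairs_to_const[OF supp] pd]) (use bd in \<open>force simp: abs_le_iff\<close>)
    ultimately show ?thesis by (simp add: abs_le_iff)
  qed
  have "(1 - q) * q ^ k / 2 / fact k * v \<le> poly_moment q k X G"
  proof (rule pairs_to_mono[OF pairs_to_cmult[OF P] pairs_to_divided_diff[OF q p]])
    fix Y assume Y: "Y \<in> ext_configs q zp zm (Suc k)" "0 < pmf p Y"
    have YM: "- M \<le> Y i \<and> Y i \<le> M" if "i \<le> k" for i
      using link_support_bound[OF q z R p Y, of i] that by (simp add: M_def abs_le_iff)
    show "(1 - q) * q ^ k / 2 / fact k * (if \<forall>i\<le>k. \<bar>Y i\<bar> \<le> B then 1 else 0) \<le> divided_diff k Y G"
    proof (cases "\<forall>i\<le>k. \<bar>Y i\<bar> \<le> B")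
      case True
      have "(1 - q) * q ^ k / 2 / fact k \<le> divided_diff k Y G"
      proof (rule divided_diff_ge[of "- B" B])
        show "- B \<le> Y i \<and> Y i \<le> B" if "i \<le> k" for i using True that by (auto simp: abs_le_iff)
      qed (use FG(5) in \<open>simp add: abs_le_iff\<close>)
      then show ?thesis using True by simp
    next
      case False
      have "0 \<le> divided_diff k Y G"
        by (rule divided_diff_nonneg[of "- M" M]) (use FG(4) YM in \<open>auto simp: abs_le_iff\<close>)
      then show ?thesis unfolding if_not_P[OF False] by simp
    qed
  qed
  then have "\<bar>a\<bar> * ((1 - q) * q ^ k / 2 / fact k * v) \<le> \<bar>a\<bar> * \<bar>poly_moment q k X G\<bar>"
    by (intro mult_left_mono) auto
  also have "\<dots> = \<bar>poly_moment q k X F - poly_moment q k (X - {a}) F\<bar>"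
    using poly_moment_remove[OF q config_summable[OF q z R] a FG(1,2)] by (simp add: abs_mult)
  also have "\<dots> \<le> 2 * (B * pi / fact k)"
    using Fbound[OF R p] Fbound[OF R' p'] by linarith
  finally have "\<bar>a\<bar> * ((1 - q) * q ^ k * v) / (2 * fact k) \<le> 4 * pi * B / (2 * fact k)" by (simp add: mult_ac)
  moreover have "x \<le> y" if "x / c \<le> y / c" "c > 0" for x y c :: real
    using that by (simp add: divide_le_cancel)
  ultimately show ?thesis by (metis fact_gt_zero mult_pos_pos zero_less_numeral)
qed

section \<open>Compact sets of infinite configurations and the conclusion\<close>

text \<open>The subsets of a bounded part of the lattice are the image of a product of two-point
  spaces, compact by Tychonoff's theorem. The map is continuous because being
  \<open>\<epsilon>\<close>-close constrains only the finitely many points away from zero.\<close>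

lemma compactin_bounded_subsets:
  assumes q: "0 < q" "q < 1" and z: "zp > 0" "zm < 0"
  shows "compactin (inf_configs_topology q zp zm) (Pow (bounded_lattice q zp zm R))"
proof -
  let ?L = "bounded_lattice q zp zm R"
  define T where "T = product_topology (\<lambda>_. discrete_topology (UNIV :: bool set)) ?L"
  define h where "h g = {x \<in> ?L. g x}" for g :: "real \<Rightarrow> bool"
  have "compact_space T" by (simp add: T_def compact_space_product_topology compact_space_discrete_topology)
  then have cT: "compactin T (topspace T)" by (simp add: compact_space_def)
  have hL: "h g \<in> inf_configs q zp zm" for g
    by (rule bounded_lattice_configs[OF q z, of _ R]) (auto simp: h_def)
  have "continuous_map T (inf_configs_topology q zp zm) h"
    unfolding continuous_map_def topspace_inf_configs_topology
  proof (intro conjI allI impI)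
    show "h \<in> topspace T \<rightarrow> inf_configs q zp zm" using hL by auto
    fix U assume U: "openin (inf_configs_topology q zp zm) U"
    show "openin T {g \<in> topspace T. h g \<in> U}"
    proof (subst openin_subopen, intro ballI)
      fix g assume "g \<in> {g \<in> topspace T. h g \<in> U}"
      then have g: "g \<in> topspace T" "h g \<in> U" by auto
      obtain \<epsilon> where \<epsilon>: "\<epsilon> > 0" "\<forall>Y\<in>inf_configs q zp zm. eps_close \<epsilon> (h g) Y \<longrightarrow> Y \<in> U"
        using U g(2) unfolding openin_inf_configs_topology by blast
      define F where "F = {x \<in> ?L. \<epsilon> \<le> \<bar>x\<bar>}"
      have F: "finite F" unfolding F_def by (rule finite_bounded_lattice_outer[OF q z \<epsilon>(1)])
      define W where "W = PiE ?L (\<lambda>x. if x \<in> F then {g x} else UNIV)"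
      have "openin T W" unfolding T_def W_def
        by (rule product_topology_basis) (use F in \<open>auto intro: finite_subset\<close>)
      moreover have "g \<in> W" using g(1) by (auto simp: W_def T_def PiE_iff)
      moreover have "W \<subseteq> {g \<in> topspace T. h g \<in> U}"
      proof
        fix g' assume g': "g' \<in> W"
        have "g' x = g x" if "x \<in> F" for x
          using PiE_mem[OF g'[unfolded W_def], of x] that by (auto simp: F_def)
        then have "eps_close \<epsilon> (h g) (h g')" by (auto simp: eps_close_def h_def F_def)
        then have "h g' \<in> U" using \<epsilon>(2) hL by blast
        moreover have "g' \<in> topspace T" using g' by (auto simp: T_def W_def PiE_iff)
        ultimately show "g' \<in> {g \<in> topspace T. h g \<in> U}" by simp
      qed
      ultimately show "\<exists>W. openin T W \<and> g \<in> W \<and> W \<subseteq> {g \<in> topspace T. h g \<in> U}" by blast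
    qed
  qed
  from image_compactin[OF cT this] have "compactin (inf_configs_topology q zp zm) (h ` topspace T)" .
  moreover have "h ` topspace T = Pow ?L"
  proof
    show "Pow ?L \<subseteq> h ` topspace T"
    proof
      fix X assume X: "X \<in> Pow ?L"
      have "X = h (restrict (\<lambda>x. x \<in> X) ?L)" using X by (auto simp: h_def)
      moreover have "restrict (\<lambda>x. x \<in> X) ?L \<in> topspace T" by (simp add: T_def)
      ultimately show "X \<in> h ` topspace T" by blast
    qed
  qed (auto simp: h_def)
  ultimately show ?thesis by simp
qed

lemma eps_continuous_imp_continuous_map:
  assumes "eps_continuous q zp zm V"
  shows "continuous_map (inf_configs_topology q zp zm) euclideanreal V"
  unfolding continuous_map_def topspace_inf_configs_topology
proof (intro conjI allI impI)
  fix U :: "real set" assume U: "openin euclideanreal U"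
  show "openin (inf_configs_topology q zp zm) {X \<in> inf_configs q zp zm. V X \<in> U}"
    unfolding openin_inf_configs_topology
  proof (intro conjI ballI)
    fix X assume "X \<in> {X \<in> inf_configs q zp zm. V X \<in> U}"
    then have X: "X \<in> inf_configs q zp zm" "V X \<in> U" by auto
    from U have "open U" by simp
    with X(2) obtain \<eta> where \<eta>: "\<eta> > 0" "\<And>y. dist y (V X) < \<eta> \<Longrightarrow> y \<in> U" unfolding open_dist by blast
    obtain \<epsilon> where "\<epsilon> > 0" "\<And>Y. Y \<in> inf_configs q zp zm \<Longrightarrow> eps_close \<epsilon> X Y \<Longrightarrow> \<bar>V X - V Y\<bar> < \<eta>"
      using eps_continuousD[OF assms X(1) \<eta>(1)] by blast
    then show "\<exists>\<epsilon>>0. \<forall>Y\<in>inf_configs q zp zm. eps_close \<epsilon> X Y \<longrightarrow> Y \<in> {X \<in> inf_configs q zp zm. V X \<in> U}"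
      using \<eta>(2) by (intro exI[of _ \<epsilon>]) (simp add: dist_real_def abs_minus_commute)
  qed auto
qed auto

lemma compactin_ext_configs_bounded:
  assumes "compactin (ext_configs_topology q zp zm K) C"
  obtains B where "B > 0" "\<And>Y i. Y \<in> C \<Longrightarrow> i < K \<Longrightarrow> \<bar>Y i\<bar> \<le> B"
proof -
  have "\<exists>B. \<forall>Y\<in>C. \<bar>Y i\<bar> \<le> B" if "i < K" for i
  proof -
    have "continuous_map (ext_configs_topology q zp zm K) euclideanreal (\<lambda>Y. Y i)"
      unfolding ext_configs_topology_def cone_topology_def
      by (intro continuous_map_from_subtopology continuous_map_product_projection) (use that in auto)
    from image_compactin[OF assms this] show ?thesis
      using compact_imp_bounded by (fastforce simp: bounded_iff)
  qed
  then obtain B where B: "\<And>i Y. i < K \<Longrightarrow> Y \<in> C \<Longrightarrow> \<bar>Y i\<bar> \<le> B i" by metis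
  show thesis
  proof (rule that)
    show "1 + (\<Sum>i<K. \<bar>B i\<bar>) > 0" by (intro add_pos_nonneg sum_nonneg) auto
    fix Y i assume "Y \<in> C" "i < K"
    then have "\<bar>Y i\<bar> \<le> \<bar>B i\<bar>" using B by fastforce
    also have "\<dots> \<le> (\<Sum>i<K. \<bar>B i\<bar>)" using \<open>i < K\<close> by (intro member_le_sum) auto
    finally show "\<bar>Y i\<bar> \<le> 1 + (\<Sum>i<K. \<bar>B i\<bar>)" by simp
  qed
qed

theorem theorem9p5:
  fixes q zp zm :: real and K :: nat
    and \<Lambda> :: "real set \<Rightarrow> (nat \<Rightarrow> real) pmf"
  assumes "0 < q" and "q < 1" and "zp > 0" and "zm < 0" and "K \<ge> 1"
    and "\<And>X. X \<in> inf_configs q zp zm \<Longrightarrow> is_link_measure q zp zm K X (\<Lambda> X)"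
  shows "feller (inf_configs_topology q zp zm) (ext_configs_topology q zp zm K) \<Lambda>"
  unfolding feller_def
proof
  let ?S = "inf_configs_topology q zp zm" and ?T = "ext_configs_topology q zp zm K" and ?E = "ext_configs q zp zm K"
  note q = assms(1,2) and z = assms(3,4) and link = assms(6)
  fix f assume "f \<in> C0 ?T"
  then have f: "continuous_map ?T euclideanreal f"
    and f0: "\<And>\<epsilon>. \<epsilon> > 0 \<Longrightarrow> \<exists>C. compactin ?T C \<and> (\<forall>Y\<in>?E - C. \<bar>f Y\<bar> < \<epsilon>)"
    by (auto simp: C0_def topspace_ext_configs_topology)
  let ?A = "kernel_op ?T \<Lambda> f"
  obtain k where k: "K = Suc k" using assms(5) by (cases K) auto
  have "continuous_map ?S euclideanreal ?A"
    by (rule eps_continuous_imp_continuous_map[OF kernel_eps_continuous[OF q z link f]])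
  moreover have "\<exists>C. compactin ?S C \<and> (\<forall>X\<in>topspace ?S - C. \<bar>?A X\<bar> < \<epsilon>)" if \<epsilon>: "\<epsilon> > 0" for \<epsilon>
  proof -
    obtain C where C: "compactin ?T C" "\<And>Y. Y \<in> ?E - C \<Longrightarrow> \<bar>f Y\<bar> < \<epsilon> / 2"
      using f0[of "\<epsilon> / 2"] \<epsilon> by auto
    obtain B where B: "B > 0" "\<And>Y i. Y \<in> C \<Longrightarrow> i < K \<Longrightarrow> \<bar>Y i\<bar> \<le> B"
      using compactin_ext_configs_bounded[OF C(1)] by blast
    have "compact (f ` C)" using image_compactin[OF C(1) f] by simp
    then obtain F where "\<And>Y. Y \<in> C \<Longrightarrow> \<bar>f Y\<bar> \<le> F"
      using compact_imp_bounded by (fastforce simp: bounded_iff)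
    then have F: "\<And>Y. Y \<in> C \<Longrightarrow> \<bar>f Y\<bar> \<le> max F 1" by fastforce
    \<comment> \<open>The indicator of a box containing \<open>C\<close>: outside \<open>C\<close>
      the function is already small, so only the mass of this box has to be made small.\<close>
    define I where "I Y = (if \<forall>i\<le>k. \<bar>Y i\<bar> \<le> B then 1 else 0 :: real)" for Y :: "nat \<Rightarrow> real"
    have fle: "\<bar>f Y\<bar> \<le> \<epsilon> / 2 + max F 1 * I Y" if "Y \<in> ?E" for Y
    proof (cases "Y \<in> C")
      case True
      then have "I Y = 1" using B(2) by (simp add: I_def k)
      then show ?thesis using F[OF True] \<epsilon> by simp
    next
      case False
      then have "\<bar>f Y\<bar> < \<epsilon> / 2" using C(2) that by simp
      moreover have "0 \<le> max F 1 * I Y" by (simp add: I_def)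
      ultimately show ?thesis by linarith
    qed
    define c where "c = (1 - q) * q ^ k"
    have c: "c > 0" using q by (simp add: c_def)
    \<comment> \<open>Chosen such that the mass bound with \<open>R\<close> in place of the absolute
      value of \<open>a\<close> gives exactly \<open>\<epsilon> / 2\<close> after multiplication by
      \<open>max F 1\<close>.\<close>
    define R where "R = 2 * max F 1 * (4 * pi * B) / (c * \<epsilon>)"
    have "\<bar>?A X\<bar> < \<epsilon>" if X: "X \<in> inf_configs q zp zm" "X \<notin> Pow (bounded_lattice q zp zm R)" for X
    proof -
      \<comment> \<open>A configuration outside the compact set
        \<open>Pow (bounded_lattice q zp zm R)\<close> has a point beyond \<open>R\<close>, and one
        such point suffices.\<close>
      obtain a where a: "a \<in> X" "R < \<bar>a\<bar>" using X by (fastforce simp: bounded_lattice_def inf_configs_def)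
      have X': "X - {a} \<in> inf_configs q zp zm" using X(1) bounded_subset[of X "X - {a}"] by (auto simp: inf_configs_def)
      note p = link[OF X(1)] and p' = link[OF X']
      have supp: "set_pmf (\<Lambda> X) \<subseteq> ?E" using p by (simp add: is_link_measure_def)
      define v where "v = (\<Sum>\<^sub>\<infinity>Y\<in>?E. pmf (\<Lambda> X) Y * I Y)"
      have v: "pairs_to q zp zm K (\<Lambda> X) I v"
        unfolding v_def by (rule pairs_to_bounded[OF supp, of _ 1]) (simp add: I_def)
      have "\<bar>a\<bar> * (c * v) \<le> 4 * pi * B"
        unfolding c_def using link_mass_bound[OF q z B(1) X(1) a(1) p[unfolded k] p'[unfolded k], of v] v
        by (simp add: I_def[abs_def] k)
      have "0 \<le> R" using c \<epsilon> B(1) by (simp add: R_def)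
      have vlt: "max F 1 * v < \<epsilon> / 2"
      proof (rule ccontr)
        assume "\<not> max F 1 * v < \<epsilon> / 2"
        then have le: "\<epsilon> / 2 \<le> max F 1 * v" by simp
        have "R * (c * (\<epsilon> / 2)) < \<bar>a\<bar> * (c * (\<epsilon> / 2))" using a(2) c \<epsilon> by (intro mult_strict_right_mono) auto
        also have "\<dots> \<le> \<bar>a\<bar> * (c * (max F 1 * v))" using le c by (intro mult_left_mono) auto
        also have "\<dots> = max F 1 * (\<bar>a\<bar> * (c * v))" by (simp only: mult_ac)
        also have "\<dots> \<le> max F 1 * (4 * pi * B)" using \<open>\<bar>a\<bar> * (c * v) \<le> 4 * pi * B\<close> by (intro mult_left_mono) auto
        also have "\<dots> = R * (c * (\<epsilon> / 2))" using c \<epsilon> by (simp add: R_def)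
        finally show False by simp
      qed
      have bd: "\<bar>f Y\<bar> \<le> \<epsilon> / 2 + max F 1" if "Y \<in> ?E" for Y
      proof -
        have "max F 1 * I Y \<le> max F 1 * 1" by (intro mult_left_mono) (simp_all add: I_def)
        then show ?thesis using fle[OF that] by linarith
      qed
      have pf: "pairs_to q zp zm K (\<Lambda> X) f (?A X)"
        unfolding kernel_op_def topspace_ext_configs_topology by (rule pairs_to_bounded[OF supp bd])
      have pg: "pairs_to q zp zm K (\<Lambda> X) (\<lambda>Y. \<epsilon> / 2 + max F 1 * I Y) (\<epsilon> / 2 + max F 1 * v)"
        by (intro pairs_to_add pairs_to_const[OF supp] pairs_to_cmult v)
      have "?A X \<le> \<epsilon> / 2 + max F 1 * v"
        by (rule pairs_to_mono[OF pf pg]) (use fle in \<open>force simp: abs_le_iff\<close>)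
      moreover have "- (\<epsilon> / 2 + max F 1 * v) \<le> ?A X"
        using pairs_to_mono[OF pairs_to_cmult[OF pg, of "-1"] pf] fle by (force simp: abs_le_iff)
      ultimately show ?thesis using vlt by (simp add: abs_less_iff)
    qed
    then show ?thesis
      using compactin_bounded_subsets[OF q z, of R] by (auto simp: topspace_inf_configs_topology)
  qed
  ultimately show "?A \<in> C0 ?S" by (auto simp: C0_def)
qed

end
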